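(* Let $X$ be a compact subset of $\mathbb{R}^d$ and $m$ a positive integer. There are bijections between the following three sets: (1) the set $\mathfrak{D}$ of closed subspaces $D\subseteq\mathscr{E}^m(\mathbb{R}^d)$ such that $\mathscr{E}^m(\mathbb{R}^d)=\mathcal{I}^m(X,\mathbb{R}^d)\oplus D$; (2) the set of continuous linear sections $T:\mathscr{E}^m(X)\to\mathscr{E}^m(\mathbb{R}^d)$ of $J^m$ (i.e. $J^m\circ T=\mathrm{Id}$) in the short exact sequence $0\to\mathcal{I}^m(X,\mathbb{R}^d)\xrightarrow{i}\mathscr{E}^m(\mathbb{R}^d)\xrightarrow{J^m}\mathscr{E}^m(X)\to0$; (3) the set of continuous linear sections $\mathcal{R}:\mathcal{I}^m(X,\mathbb{R}^d)'\to\mathscr{E}^m(\mathbb{R}^d)'$ of $i'$ (i.e. $i'\circ\mathcal{R}=\mathrm{Id}$) in the dual sequence $0\to\mathscr{E}^m(X)'\xrightarrow{(J^m)'}\mathscr{E}^m(\mathbb{R}^d)'\xrightarrow{i'}\mathcal{I}^m(X,\mathbb{R}^d)'\to0$, where all duals carry the weak star topology. Moreover, the set $\mathfrak{D}$ is nonempty.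
   Context: $\mathscr{E}^m(\mathbb{R}^d)$ is the space of $m$ times continuously differentiable complex functions on $\mathbb{R}^d$ with the Fréchet topology given by the seminorms $\|f\|_k^K=\sup_{x\in K,|\nu|\le k}|\partial^\nu f(x)|$, $K$ compact, $0\le k\le m$. $\mathcal{I}^m(X,\mathbb{R}^d)$ is the closed subspace of $f$ with $\partial^\nu f=0$ on $X$ for all $|\nu|\le m$, and $i$ the inclusion. A jet of order $m$ on $X$ is a family $F=(f^k)_{|k|\le m}$ of continuous functions on $X$; its remainder at $x\in X$ is $(R^m_xF)^k(y)=f^k(y)-\sum_{|l|\le m-|k|}\frac{(y-x)^l}{l!}f^{k+l}(x)$. $\mathscr{E}^m(X)$ (Whitney functions) is the space of jets with $(R^m_xF)^k(y)=o(|x-y|^{m-|k|})$ as $|x-y|\to0$, $x,y\in X$, for all $|k|\le m$, a Banach space with norm $\sup_{x\in X,|k|\le m}|f^k(x)|+\sup_{x\ne y\in X,|k|\le m}|(R^m_xF)^k(y)|/|x-y|^{m-|k|}$. $J^m(f)=(\partial^kf|_X)_{|k|\le m}$. The sequence in (2) is exact (Whitney). For a topological vector space $E$, $E'$ is its continuous dual, the weak star topology is that of pointwise convergence on $E$, and $u'$ denotes the transpose of a continuous linear map $u$. *)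

theory Defs
  imports "HOL-Analysis.Analysis" "HOL-Library.FuncSet" "HOL-Library.Function_Algebras"
begin

class cscale =
  fixes cscale :: "complex \<Rightarrow> 'a \<Rightarrow> 'a"

instantiation complex :: cscale
begin
definition cscale_complex :: "complex \<Rightarrow> complex \<Rightarrow> complex" where
  "cscale_complex c z = c * z"
instance ..
end

instantiation "fun" :: (type, cscale) cscale
begin
definition cscale_fun :: "complex \<Rightarrow> ('a \<Rightarrow> 'b) \<Rightarrow> ('a \<Rightarrow> 'b)" where
  "cscale_fun c f = (\<lambda>x. cscale c (f x))"
instance ..
end

text \<open>Complex-linearity of a map on a subset S (S is a subspace in all uses).\<close>
definition lin_on :: "('a::{plus,cscale}) set \<Rightarrow> ('a \<Rightarrow> 'b::{plus,cscale}) \<Rightarrow> bool" where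
  "lin_on S u \<longleftrightarrow> (\<forall>f\<in>S. \<forall>g\<in>S. u (f + g) = u f + u g)
                 \<and> (\<forall>f\<in>S. \<forall>c. u (cscale c f) = cscale c (u f))"

definition seminorm_topology :: "('a::minus) set \<Rightarrow> ('a \<Rightarrow> real) set \<Rightarrow> 'a topology" where
  "seminorm_topology S P =
     topology_generated_by {{g\<in>S. p (g - f) < e} | f p e. f \<in> S \<and> p \<in> P \<and> e > 0}"

definition partial :: "'n::finite \<Rightarrow> (real^'n \<Rightarrow> complex) \<Rightarrow> real^'n \<Rightarrow> complex" where
  "partial i f x = vector_derivative (\<lambda>t. f (x + t *\<^sub>R axis i 1)) (at 0)"

fun Ck :: "nat \<Rightarrow> (real^'n::finite \<Rightarrow> complex) \<Rightarrow> bool" where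
  "Ck 0 f = continuous_on UNIV f"
| "Ck (Suc k) f = (continuous_on UNIV f \<and>
      (\<forall>i x. ((\<lambda>t. f (x + t *\<^sub>R axis i 1)) has_vector_derivative partial i f x) (at 0)) \<and>
      (\<forall>i. Ck k (partial i f)))"

fun ipartial :: "'n::finite list \<Rightarrow> (real^'n \<Rightarrow> complex) \<Rightarrow> real^'n \<Rightarrow> complex" where
  "ipartial [] f = f"
| "ipartial (i # is) f = partial i (ipartial is f)"

definition mlen :: "('n::finite \<Rightarrow> nat) \<Rightarrow> nat" where
  "mlen \<nu> = (\<Sum>i\<in>UNIV. \<nu> i)"

definition mpartial :: "('n::finite \<Rightarrow> nat) \<Rightarrow> (real^'n \<Rightarrow> complex) \<Rightarrow> real^'n \<Rightarrow> complex" where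
  "mpartial \<nu> f = ipartial (SOME l. \<forall>i. count_list l i = \<nu> i) f"

definition Em :: "nat \<Rightarrow> (real^'n::finite \<Rightarrow> complex) set" where
  "Em m = {f. Ck m f}"

definition snorm :: "(real^'n::finite) set \<Rightarrow> nat \<Rightarrow> (real^'n \<Rightarrow> complex) \<Rightarrow> real" where
  "snorm K k f = Sup (insert 0 {norm (mpartial \<nu> f x) | \<nu> x. x \<in> K \<and> mlen \<nu> \<le> k})"

definition Em_top :: "nat \<Rightarrow> (real^'n::finite \<Rightarrow> complex) topology" where
  "Em_top m = seminorm_topology (Em m) {snorm K k | K k. compact K \<and> k \<le> m}"

definition Ideal :: "(real^'n::finite) set \<Rightarrow> nat \<Rightarrow> (real^'n \<Rightarrow> complex) set" where
  "Ideal X m = {f \<in> Em m. \<forall>\<nu> x. mlen \<nu> \<le> m \<and> x \<in> X \<longrightarrow> mpartial \<nu> f x = 0}"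

definition Ideal_top :: "(real^'n::finite) set \<Rightarrow> nat \<Rightarrow> (real^'n \<Rightarrow> complex) topology" where
  "Ideal_top X m = subtopology (Em_top m) (Ideal X m)"

text \<open>A jet of order m on X is represented as F :: ('n => nat) => real^'n => complex,
  with F k = 0 for |k| > m and F k x = 0 for x outside X (canonical representative).\<close>

definition jet_rem :: "nat \<Rightarrow> (('n::finite \<Rightarrow> nat) \<Rightarrow> real^'n \<Rightarrow> complex)
     \<Rightarrow> real^'n \<Rightarrow> ('n \<Rightarrow> nat) \<Rightarrow> real^'n \<Rightarrow> complex" where
  "jet_rem m F x k y = F k y -
     (\<Sum>l\<in>{l. mlen l \<le> m - mlen k}.
        complex_of_real ((\<Prod>i\<in>UNIV. (y $ i - x $ i) ^ l i) / (\<Prod>i\<in>UNIV. fact (l i))) * F (k + l) x)"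

definition Whitney :: "(real^'n::finite) set \<Rightarrow> nat \<Rightarrow> (('n \<Rightarrow> nat) \<Rightarrow> real^'n \<Rightarrow> complex) set" where
  "Whitney X m = {F.
     (\<forall>k x. (x \<notin> X \<or> mlen k > m) \<longrightarrow> F k x = 0) \<and>
     (\<forall>k. mlen k \<le> m \<longrightarrow> continuous_on X (F k)) \<and>
     (\<forall>k. mlen k \<le> m \<longrightarrow> (\<forall>e>0. \<exists>\<delta>>0. \<forall>x\<in>X. \<forall>y\<in>X. dist x y < \<delta> \<longrightarrow>
          norm (jet_rem m F x k y) \<le> e * dist x y ^ (m - mlen k)))}"

definition Whitney_norm :: "(real^'n::finite) set \<Rightarrow> nat \<Rightarrow> (('n \<Rightarrow> nat) \<Rightarrow> real^'n \<Rightarrow> complex) \<Rightarrow> real" where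
  "Whitney_norm X m F =
     Sup (insert 0 {norm (F k x) | k x. x \<in> X \<and> mlen k \<le> m}) +
     Sup (insert 0 {norm (jet_rem m F x k y) / dist x y ^ (m - mlen k) | k x y.
                      x \<in> X \<and> y \<in> X \<and> x \<noteq> y \<and> mlen k \<le> m})"

definition Whitney_top :: "(real^'n::finite) set \<Rightarrow> nat \<Rightarrow> (('n \<Rightarrow> nat) \<Rightarrow> real^'n \<Rightarrow> complex) topology" where
  "Whitney_top X m = seminorm_topology (Whitney X m) {Whitney_norm X m}"

definition Jm :: "(real^'n::finite) set \<Rightarrow> nat \<Rightarrow> (real^'n \<Rightarrow> complex) \<Rightarrow> ('n \<Rightarrow> nat) \<Rightarrow> real^'n \<Rightarrow> complex" where
  "Jm X m f = (\<lambda>k x. if x \<in> X \<and> mlen k \<le> m then mpartial k f x else 0)"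

definition dual :: "('a::{plus,cscale}) set \<Rightarrow> 'a topology \<Rightarrow> ('a \<Rightarrow> complex) set" where
  "dual S tp = {\<phi>. lin_on S \<phi> \<and> continuous_map tp euclidean \<phi> \<and> (\<forall>g. g \<notin> S \<longrightarrow> \<phi> g = 0)}"

definition weak_star :: "('a::{plus,cscale}) set \<Rightarrow> 'a topology \<Rightarrow> ('a \<Rightarrow> complex) topology" where
  "weak_star S tp = seminorm_topology (dual S tp) ((\<lambda>f \<psi>. norm (\<psi> f)) ` S)"

definition incl_transp :: "('a::{plus,cscale}) set \<Rightarrow> ('a \<Rightarrow> complex) \<Rightarrow> 'a \<Rightarrow> complex" where
  "incl_transp I \<phi> = (\<lambda>g. if g \<in> I then \<phi> g else 0)"

definition complements :: "(real^'n::finite) set \<Rightarrow> nat \<Rightarrow> (real^'n \<Rightarrow> complex) set set" where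
  "complements X m = {D. D \<subseteq> Em m \<and> 0 \<in> D \<and> (\<forall>f\<in>D. \<forall>g\<in>D. f + g \<in> D) \<and>
      (\<forall>c. \<forall>f\<in>D. cscale c f \<in> D) \<and> closedin (Em_top m) D \<and>
      Ideal X m \<inter> D = {0} \<and> (\<forall>f\<in>Em m. \<exists>g\<in>Ideal X m. \<exists>h\<in>D. f = g + h)}"

definition jet_sections :: "(real^'n::finite) set \<Rightarrow> nat
     \<Rightarrow> ((('n \<Rightarrow> nat) \<Rightarrow> real^'n \<Rightarrow> complex) \<Rightarrow> (real^'n \<Rightarrow> complex)) set" where
  "jet_sections X m = {T. T \<in> extensional (Whitney X m) \<and> T \<in> Whitney X m \<rightarrow> Em m \<and>
      lin_on (Whitney X m) T \<and> continuous_map (Whitney_top X m) (Em_top m) T \<and>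
      (\<forall>F\<in>Whitney X m. Jm X m (T F) = F)}"

definition dual_sections :: "(real^'n::finite) set \<Rightarrow> nat
     \<Rightarrow> (((real^'n \<Rightarrow> complex) \<Rightarrow> complex) \<Rightarrow> ((real^'n \<Rightarrow> complex) \<Rightarrow> complex)) set" where
  "dual_sections X m = {R.
      R \<in> extensional (dual (Ideal X m) (Ideal_top X m)) \<and>
      R \<in> dual (Ideal X m) (Ideal_top X m) \<rightarrow> dual (Em m) (Em_top m) \<and>
      lin_on (dual (Ideal X m) (Ideal_top X m)) R \<and>
      continuous_map (weak_star (Ideal X m) (Ideal_top X m)) (weak_star (Em m) (Em_top m)) R \<and>
      (\<forall>\<psi>\<in>dual (Ideal X m) (Ideal_top X m). incl_transp (Ideal X m) (R \<psi>) = \<psi>)}"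

end

theory Submission
  imports Defs
begin

text \<open>
  Everything rests on a continuous linear right inverse of the jet map (Whitney's extension
  operator). For a lattice of mesh \<open>4^-j\<close> with its partition of unity, replace each lattice point
  close to \<open>X\<close> by a nearby point of \<open>X\<close> and glue the Taylor polynomials of the jet at these points;
  interpolating from scale \<open>j\<close> to scale \<open>j + 1\<close> only close to \<open>X\<close> gives smooth functions
  that form a Cauchy sequence in \<open>C^m\<close>. The limit is therefore \<open>C^m\<close>, and its derivatives on \<open>X\<close>
  are those of the jet, so no differentiation at boundary points of \<open>X\<close> is needed. All estimates
  are by one downward induction on the order of the derivative with the mean value inequality.

  A section \<open>T\<close> corresponds to the complement \<open>range T\<close>. Conversely, for a closed complement \<open>D\<close>
  the projection \<open>\<pi>\<close> onto the ideal along \<open>D\<close> has a closed graph, hence is continuous, and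
  \<open>(id - \<pi>) \<circ> W\<close> is the section with range \<open>D\<close>, where \<open>W\<close> is the extension operator.
  A section \<open>T\<close> also corresponds to the transpose of \<open>id - T \<circ> J\<close>. Conversely, a section \<open>R\<close> of
  the dual sequence determines the closed complement of all \<open>f\<close> with \<open>R \<psi> f = 0\<close> for all \<open>\<psi>\<close>;
  that it is a complement holds because \<open>\<psi> \<mapsto> R \<psi> f\<close> is weak star continuous, hence the
  evaluation at an element of the ideal.
\<close>

text \<open>The obstacle is that a cutoff at scale \<open>s j\<close> loses a factor
  \<open>4 ^ j\<close> per derivative. Two Taylor polynomials of the jet at points about
  \<open>s j\<close> apart differ, in derivatives of order k, by about
  \<open>M * s j ^ (m - k)\<close>, where M bounds the remainder quotients at that distance; this is
  \<open>M * s j ^ m\<close> times k factors \<open>4 ^ j\<close>. The predicate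
  \<open>derivs_le\<close> records size and scale together, so the loss is paid exactly and an error
  of order M remains. Adding such errors over all scales would give no bound; instead each point is
  compared with one Taylor polynomial, at the last scale where the point is still close to X, and
  later steps do not change the function there. The same estimate is used twice: with M small at
  fine scales (the little-o condition) it gives convergence, and with M the Whitney norm it gives
  continuity. The projection onto the ideal is treated as an operator from the space of C^m
  functions to itself, so that a Baire argument and a successive approximation with a single
  increasing sequence of seminorms prove that it is bounded.\<close>

section \<open>Iterated partial derivatives\<close>

definition has_partial :: "'n::finite \<Rightarrow> (real^'n \<Rightarrow> complex) \<Rightarrow> complex \<Rightarrow> real^'n \<Rightarrow> bool" where
  "has_partial i f d x \<longleftrightarrow> ((\<lambda>t. f (x + t *\<^sub>R axis i 1)) has_vector_derivative d) (at 0)"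

lemma has_partial_imp_partial: "has_partial i f d x \<Longrightarrow> partial i f x = d"
  by (simp add: has_partial_def partial_def vector_derivative_at)

text \<open>The definition differentiates at parameter 0 from each base point; translating the
  parameter gives the derivative all along a line, as the mean value theorem requires.\<close>

lemma has_partial_line:
  assumes "\<And>x. has_partial i f (g x) x"
  shows "((\<lambda>t. f (x + t *\<^sub>R axis i 1)) has_vector_derivative g (x + s *\<^sub>R axis i 1)) (at s)"
proof -
  have "((\<lambda>t. t - s) has_vector_derivative 1) (at s)"
    by (auto intro!: derivative_eq_intros)
  moreover have "((\<lambda>t. f ((x + s *\<^sub>R axis i 1) + t *\<^sub>R axis i 1)) has_vector_derivative
      g (x + s *\<^sub>R axis i 1)) (at (s - s))"
    using assms[of "x + s *\<^sub>R axis i 1"] by (simp add: has_partial_def)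
  ultimately have "((\<lambda>t. f ((x + s *\<^sub>R axis i 1) + t *\<^sub>R axis i 1)) \<circ> (\<lambda>t. t - s)
      has_vector_derivative 1 *\<^sub>R g (x + s *\<^sub>R axis i 1)) (at s)"
    by (rule vector_diff_chain_at)
  moreover have "(\<lambda>t. f ((x + s *\<^sub>R axis i 1) + t *\<^sub>R axis i 1)) \<circ> (\<lambda>t. t - s)
      = (\<lambda>t. f (x + t *\<^sub>R axis i 1))"
    by (simp add: fun_eq_iff algebra_simps)
  ultimately show ?thesis by simp
qed

lemma Ck_continuous: "Ck k f \<Longrightarrow> continuous_on UNIV f"
  by (cases k) auto

lemma Ck_Suc_has_partial: "Ck (Suc k) f \<Longrightarrow> has_partial i f (partial i f x) x"
  by (simp add: has_partial_def)

lemma Ck_Suc_partial: "Ck (Suc k) f \<Longrightarrow> Ck k (partial i f)"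
  by simp

declare Ck.simps(2)[simp del]

text \<open>\<open>partial\<close> selects a value without asserting that a derivative exists. With
  candidate derivatives \<open>g\<close> and the relation \<open>has_partial\<close>, the closure
  rules can supply explicit formulas.\<close>

lemma Ck_SucI:
  assumes "continuous_on UNIV f" "\<And>i x. has_partial i f (g i x) x" "\<And>i. Ck k (g i)"
  shows "Ck (Suc k) f"
proof -
  have "partial i f = g i" for i
    using assms(2) by (auto intro!: ext has_partial_imp_partial)
  then show ?thesis
    using assms by (simp add: Ck.simps has_partial_def)
qed

lemma Ck_SucD: "Ck (Suc k) f \<Longrightarrow> Ck k f"
proof (induction k arbitrary: f)
  case 0
  then show ?case using Ck_continuous by auto
next
  case (Suc k)
  show ?case
    using Suc.prems Suc.IH Ck_Suc_has_partial[OF Suc.prems] Ck_Suc_partial[OF Suc.prems]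
    by (intro Ck_SucI[where g = "\<lambda>i. partial i f"]) (auto intro: Ck_continuous)
qed

lemma Ck_mono: "Ck n f \<Longrightarrow> k \<le> n \<Longrightarrow> Ck k f"
  by (induction n) (auto simp: le_Suc_eq dest: Ck_SucD)

lemma has_partial_add:
  "has_partial i f a x \<Longrightarrow> has_partial i g b x \<Longrightarrow> has_partial i (\<lambda>x. f x + g x) (a + b) x"
  unfolding has_partial_def by (rule has_vector_derivative_add)

lemma has_partial_diff:
  "has_partial i f a x \<Longrightarrow> has_partial i g b x \<Longrightarrow> has_partial i (\<lambda>x. f x - g x) (a - b) x"
  unfolding has_partial_def by (rule has_vector_derivative_diff)

lemma has_partial_const: "has_partial i (\<lambda>x. c) 0 x"
  unfolding has_partial_def by (rule has_vector_derivative_const)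

lemma has_partial_mult:
  "has_partial i f a x \<Longrightarrow> has_partial i g b x \<Longrightarrow>
     has_partial i (\<lambda>x. f x * g x) (a * g x + f x * b) x"
  unfolding has_partial_def
  by (drule (1) has_vector_derivative_mult) (simp add: add.commute)

lemma has_partial_cmult:
  "has_partial i f a x \<Longrightarrow> has_partial i (\<lambda>x. c * f x) (c * a) x"
  unfolding has_partial_def by (rule has_vector_derivative_mult_right)

lemma has_partial_sum:
  "(\<And>z. z \<in> A \<Longrightarrow> has_partial i (f z) (a z) x) \<Longrightarrow>
     has_partial i (\<lambda>x. \<Sum>z\<in>A. f z x) (\<Sum>z\<in>A. a z) x"
  unfolding has_partial_def by (rule has_vector_derivative_sum)

lemma has_partial_dilate:
  assumes "has_partial i f a (c *\<^sub>R x + v)"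
  shows "has_partial i (\<lambda>x. f (c *\<^sub>R x + v)) (complex_of_real c * a) x"
proof -
  have "((\<lambda>t. c * t) has_vector_derivative c) (at 0)"
    by (auto intro!: derivative_eq_intros)
  moreover have "((\<lambda>t. f (c *\<^sub>R x + v + t *\<^sub>R axis i 1)) has_vector_derivative a) (at (c * 0))"
    using assms by (simp add: has_partial_def)
  ultimately have "((\<lambda>t. f (c *\<^sub>R x + v + t *\<^sub>R axis i 1)) \<circ> (\<lambda>t. c * t)
      has_vector_derivative c *\<^sub>R a) (at 0)"
    by (rule vector_diff_chain_at)
  then show ?thesis
    by (simp add: has_partial_def o_def algebra_simps scaleR_conv_of_real)
qed

lemma Ck_const: "Ck k (\<lambda>x. c)"
proof (induction k arbitrary: c)
  case (Suc k)
  then show ?case by (intro Ck_SucI[where g = "\<lambda>i x. 0"] has_partial_const) auto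
qed auto

lemma Ck_add: "Ck k f \<Longrightarrow> Ck k g \<Longrightarrow> Ck k (\<lambda>x. f x + g x)"
proof (induction k arbitrary: f g)
  case 0
  then show ?case by (auto intro: continuous_on_add)
next
  case (Suc k)
  show ?case
    using Suc.prems
    by (intro Ck_SucI[where g = "\<lambda>i x. partial i f x + partial i g x"] has_partial_add Suc.IH
        continuous_on_add) (auto intro: Ck_continuous Ck_Suc_has_partial Ck_Suc_partial)
qed

lemma Ck_mult: "Ck k f \<Longrightarrow> Ck k g \<Longrightarrow> Ck k (\<lambda>x. f x * g x)"
proof (induction k arbitrary: f g)
  case 0
  then show ?case by (auto intro: continuous_on_mult)
next
  case (Suc k)
  show ?case
    using Suc.prems
    by (intro Ck_SucI[where g = "\<lambda>i x. partial i f x * g x + f x * partial i g x"]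
        has_partial_mult Suc.IH Ck_add continuous_on_mult)
      (auto intro: Ck_continuous Ck_Suc_has_partial Ck_Suc_partial Ck_SucD)
qed

lemma Ck_cmult: "Ck k f \<Longrightarrow> Ck k (\<lambda>x. c * f x)"
  by (intro Ck_mult Ck_const)

lemma Ck_diff: "Ck k f \<Longrightarrow> Ck k g \<Longrightarrow> Ck k (\<lambda>x. f x - g x)"
  using Ck_add[of k f "\<lambda>x. -1 * g x"] Ck_cmult[of k g "-1"] by simp

lemma Ck_sum: "(\<And>z. z \<in> A \<Longrightarrow> Ck k (f z)) \<Longrightarrow> Ck k (\<lambda>x. \<Sum>z\<in>A. f z x)"
  by (induction A rule: infinite_finite_induct) (auto intro: Ck_const Ck_add)

lemma Ck_prod: "(\<And>z. z \<in> A \<Longrightarrow> Ck k (f z)) \<Longrightarrow> Ck k (\<lambda>x. \<Prod>z\<in>A. f z x)"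
  by (induction A rule: infinite_finite_induct) (auto intro: Ck_const Ck_mult)

lemma Ck_dilate: "Ck k f \<Longrightarrow> Ck k (\<lambda>x. f (c *\<^sub>R x + v))"
proof (induction k arbitrary: f)
  case 0
  then show ?case
    by (auto intro!: continuous_intros continuous_on_compose2[of UNIV f])
next
  case (Suc k)
  have "continuous_on UNIV (\<lambda>x. f (c *\<^sub>R x + v))"
    by (intro continuous_on_compose2[OF Ck_continuous[OF Suc.prems]] continuous_intros) auto
  then show ?case
    using Suc.prems
    by (intro Ck_SucI[where g = "\<lambda>i x. complex_of_real c * partial i f (c *\<^sub>R x + v)"]
        has_partial_dilate
        Ck_cmult Suc.IH) (auto intro: Ck_continuous Ck_Suc_has_partial Ck_Suc_partial)
qed

section \<open>Rules for derivatives indexed by lists of directions\<close>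

lemma ipartial_append: "ipartial (xs @ ys) f = ipartial xs (ipartial ys f)"
  by (induction xs) auto

lemma Ck_ipartial: "Ck (n + length xs) f \<Longrightarrow> Ck n (ipartial xs f)"
  by (induction xs arbitrary: n) (auto intro!: Ck_Suc_partial simp flip: add_Suc)

lemma Ck_ipartial': "Ck m f \<Longrightarrow> n + length xs \<le> m \<Longrightarrow> Ck n (ipartial xs f)"
  by (metis Ck_ipartial Ck_mono)

lemma has_partial_ipartial:
  "Ck m f \<Longrightarrow> length xs < m \<Longrightarrow> has_partial i (ipartial xs f) (ipartial (i # xs) f x) x"
  using Ck_Suc_has_partial[of 0 "ipartial xs f"] Ck_ipartial'[of m f 1 xs] by auto

lemma continuous_on_ipartial:
  "Ck m f \<Longrightarrow> length xs \<le> m \<Longrightarrow> continuous_on A (ipartial xs f)"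
  using Ck_ipartial'[of m f 0 xs] by (auto intro: continuous_on_subset)

text \<open>One-step consistency of a family indexed by lists suffices, since each derivative is
  taken of a function already identified. This serves sums, multiples, dilations, Taylor polynomials
  and limits alike.\<close>

lemma ipartial_eqI:
  assumes "\<And>xs i x. length xs < n \<Longrightarrow> has_partial i (G xs) (G (i # xs) x) x"
    and "G [] = f" and "length xs \<le> n"
  shows "ipartial xs f = G xs"
  using assms(3)
proof (induction xs)
  case (Cons i xs)
  then have *: "ipartial xs f = G xs" by simp
  have "partial i (G xs) = G (i # xs)"
    using Cons.prems by (intro ext has_partial_imp_partial assms) simp
  then show ?case by (simp only: ipartial.simps *)
qed (use assms in auto)

lemma Ck_family:
  assumes "\<And>xs i x. length xs < n \<Longrightarrow> has_partial i (G xs) (G (i # xs) x) x"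
    and "\<And>xs. length xs \<le> n \<Longrightarrow> continuous_on UNIV (G xs)"
  shows "Ck n (G [])"
proof -
  have "k + length xs = n \<Longrightarrow> Ck k (G xs)" for k xs
  proof (induction k arbitrary: xs)
    case (Suc k)
    then show ?case by (intro Ck_SucI[where g = "\<lambda>i. G (i # xs)"] assms) auto
  qed (use assms(2) in auto)
  then show ?thesis by auto
qed

lemma ipartial_add:
  assumes "Ck n f" "Ck n g" "length xs \<le> n"
  shows "ipartial xs (\<lambda>x. f x + g x) = (\<lambda>x. ipartial xs f x + ipartial xs g x)"
  using assms
  by (intro ipartial_eqI[where n = n and G = "\<lambda>xs x. ipartial xs f x + ipartial xs g x"]
      has_partial_add has_partial_ipartial) auto

lemma ipartial_diff:
  assumes "Ck n f" "Ck n g" "length xs \<le> n"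
  shows "ipartial xs (\<lambda>x. f x - g x) = (\<lambda>x. ipartial xs f x - ipartial xs g x)"
  using assms
  by (intro ipartial_eqI[where n = n and G = "\<lambda>xs x. ipartial xs f x - ipartial xs g x"]
      has_partial_diff has_partial_ipartial) auto

lemma ipartial_cmult:
  assumes "Ck n f" "length xs \<le> n"
  shows "ipartial xs (\<lambda>x. c * f x) = (\<lambda>x. c * ipartial xs f x)"
  using assms
  by (intro ipartial_eqI[where n = n and G = "\<lambda>xs x. c * ipartial xs f x"] has_partial_cmult
      has_partial_ipartial) auto

lemma ipartial_sum:
  assumes "\<And>z. z \<in> A \<Longrightarrow> Ck n (f z)" "length xs \<le> n"
  shows "ipartial xs (\<lambda>x. \<Sum>z\<in>A. f z x) = (\<lambda>x. \<Sum>z\<in>A. ipartial xs (f z) x)"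
  using assms
  by (intro ipartial_eqI[where n = n and G = "\<lambda>xs x. \<Sum>z\<in>A. ipartial xs (f z) x"] has_partial_sum
      has_partial_ipartial) auto

lemma ipartial_const: "ipartial xs (\<lambda>x. c) = (\<lambda>x. if xs = [] then c else 0)"
  by (intro ipartial_eqI[where n = "length xs" and G = "\<lambda>xs x. if xs = [] then c else 0"])
    (auto simp: has_partial_const)

lemma ipartial_dilate:
  assumes "Ck n f" "length xs \<le> n"
  shows "ipartial xs (\<lambda>x. f (c *\<^sub>R x + v)) = (\<lambda>x. complex_of_real c ^ length xs * ipartial xs f (c
      *\<^sub>R x + v))"
proof -
  have "has_partial i (\<lambda>x. complex_of_real c ^ length xs * ipartial xs f (c *\<^sub>R x + v))
     (complex_of_real c ^ length (i # xs) * ipartial (i # xs) f (c *\<^sub>R x + v)) x"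
    if "length xs < n" for i xs x
    using has_partial_cmult[OF has_partial_dilate[OF has_partial_ipartial[OF assms(1) that]],
        where c = "complex_of_real c ^ length xs"] by (simp add: mult_ac)
  then show ?thesis
    using assms by (intro ipartial_eqI[where n = n and
          G = "\<lambda>xs x. complex_of_real c ^ length xs * ipartial xs f (c *\<^sub>R x + v)"]) auto
qed

text \<open>\<open>vector_derivative\<close> depends only on the germ of the function along a line,
  so the recursion stays local. Used to discard cutoffs away from their support and to replace them
  by 1 where they are constant.\<close>

lemma ipartial_cong_open:
  assumes "open U" "\<And>x. x \<in> U \<Longrightarrow> f x = g x" "x \<in> U"
  shows "ipartial xs f x = ipartial xs g x"
  using assms(3)
proof (induction xs arbitrary: x)
  case (Cons i xs)
  let ?l = "\<lambda>t::real. x + t *\<^sub>R axis i 1"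
  have "open (?l -` U)"
    by (intro continuous_open_vimage assms continuous_intros)
  then have "eventually (\<lambda>t. t \<in> ?l -` U) (nhds 0)"
    using Cons.prems by (intro eventually_nhds_in_open) auto
  then have "eventually (\<lambda>t. ipartial xs f (?l t) = ipartial xs g (?l t)) (nhds 0)"
    by eventually_elim (use Cons.IH in auto)
  then show ?case
    using Cons by (auto simp: partial_def intro!: vector_derivative_cong_eq)
qed (use assms in auto)

section \<open>Mean value estimates and symmetry of derivatives\<close>

text \<open>Mean value inequality for \<open>f\<close> minus the linear function with slope
  \<open>c\<close>. The slope 0 gives the plain bound; \<open>second_difference\<close> takes
  multiples of a mixed derivative.\<close>

lemma mean_value_line:
  assumes "\<And>y. has_partial i f (g y) y"
    and "\<And>s. s \<in> closed_segment 0 t \<Longrightarrow> norm (g (x + s *\<^sub>R axis i 1) - c) \<le> B"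
  shows "norm (f (x + t *\<^sub>R axis i 1) - f x - of_real t * c) \<le> B * \<bar>t\<bar>"
proof -
  let ?u = "\<lambda>s. f (x + s *\<^sub>R axis i 1) - s *\<^sub>R c"
  have "norm (?u t - ?u 0) \<le> B * norm (t - 0)"
  proof (rule differentiable_bound[where S = "closed_segment 0 t"])
    fix s assume s: "s \<in> closed_segment 0 t"
    have "(?u has_vector_derivative (g (x + s *\<^sub>R axis i 1) - c)) (at s)"
      by (auto intro!: derivative_eq_intros has_partial_line assms)
    then show "(?u has_derivative (\<lambda>h. h *\<^sub>R (g (x + s *\<^sub>R axis i 1) - c))) (at s within
        closed_segment 0 t)"
      by (auto simp: has_vector_derivative_def intro: has_derivative_at_withinI)
    show "onorm (\<lambda>h. h *\<^sub>R (g (x + s *\<^sub>R axis i 1) - c)) \<le> B"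
      using mult_right_mono[OF assms(2)[OF s] abs_ge_zero] by (intro onorm_le)
          (simp add: mult.commute)
  qed auto
  then show ?thesis by (simp add: scaleR_conv_of_real algebra_simps)
qed

text \<open>Move from \<open>b\<close> to \<open>y\<close> one coordinate at a time; every
  intermediate point stays in the cube, which is why cubes are used here instead of balls. Each of
  the \<open>CARD('n)\<close> moves costs at most \<open>B * \<rho>\<close>.\<close>

lemma mean_value_cube:
  fixes f :: "real^'n::finite \<Rightarrow> complex"
  assumes f: "\<And>i y. has_partial i f (g i y) y"
    and g: "\<And>i z. (\<And>j. \<bar>z $ j - b $ j\<bar> \<le> \<rho>) \<Longrightarrow> norm (g i z) \<le> B"
    and y: "\<And>j. \<bar>y $ j - b $ j\<bar> \<le> \<rho>"
  shows "norm (f y - f b) \<le> real CARD('n) * B * \<rho>"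
proof -
  \<comment> \<open>The index type is nonempty, so \<open>undefined\<close> is an index.\<close>
  have \<rho>: "\<rho> \<ge> 0" using y[of undefined] by linarith
  have B: "B \<ge> 0" using g[of b undefined] \<rho> norm_ge_zero order_trans by (metis abs_zero diff_self)
  define mix where "mix A = (\<chi> j. if j \<in> A then y $ j else b $ j)" for A
  have "norm (f (mix A) - f b) \<le> real (card A) * (B * \<rho>)" if "finite A" for A
    using that
  proof (induction A)
    case empty
    have "mix {} = b" by (simp add: mix_def vec_eq_iff)
    then show ?case by simp
  next
    case (insert i A)
    define t where "t = y $ i - b $ i"
    have eq: "mix (insert i A) = mix A + t *\<^sub>R axis i 1"
      using insert by (auto simp: mix_def vec_eq_iff t_def axis_def)
    have "norm (f (mix A + t *\<^sub>R axis i 1) - f (mix A) - of_real t * 0) \<le> B * \<bar>t\<bar>"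
    proof (rule mean_value_line[OF f])
      fix s assume s: "s \<in> closed_segment 0 t"
      then have "\<bar>s\<bar> \<le> \<bar>t\<bar>"
        by (auto simp: closed_segment_eq_real_ivl split: if_splits)
      then have "\<bar>s\<bar> \<le> \<rho>" using y[of i] t_def by linarith
      then have "\<bar>(mix A + s *\<^sub>R axis i 1) $ j - b $ j\<bar> \<le> \<rho>" for j
        using insert y[of j] \<rho> by (auto simp: mix_def axis_def)
      then show "norm (g i (mix A + s *\<^sub>R axis i 1) - 0) \<le> B"
        using g by simp
    qed
    also have "\<dots> \<le> B * \<rho>" using y[of i] B t_def by (intro mult_left_mono) auto
    finally have "norm (f (mix (insert i A)) - f (mix A)) \<le> B * \<rho>" by (simp add: eq)
    then have "norm (f (mix (insert i A)) - f b) \<le> B * \<rho> + real (card A) * (B * \<rho>)"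
      using insert norm_triangle_ineq[of "f (mix (insert i A)) - f (mix A)" "f (mix A) - f b"]
          by simp
    then show ?case using insert by (simp add: algebra_simps)
  qed
  from this[of UNIV] have "norm (f (mix UNIV) - f b) \<le> real CARD('n) * (B * \<rho>)" by simp
  moreover have "mix UNIV = y" by (simp add: mix_def vec_eq_iff)
  ultimately show ?thesis by (simp add: mult.assoc)
qed

text \<open>Both mixed derivatives at \<open>x\<close> approximate the same second difference quotient.\<close>

lemma second_difference:
  fixes f :: "real^'n::finite \<Rightarrow> complex"
  assumes "\<And>y. has_partial i f (g y) y" "\<And>y. has_partial j g (h y) y"
    and h: "\<And>z. norm (z - x) \<le> 2 * t \<Longrightarrow> norm (h z - h x) \<le> e" and t: "t \<ge> 0"
  shows "norm (f (x + t *\<^sub>R axis i 1 + t *\<^sub>R axis j 1) - f (x + t *\<^sub>R axis i 1)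
     - f (x + t *\<^sub>R axis j 1) + f x - of_real (t * t) * h x) \<le> e * t * t"
proof -
  let ?v = "t *\<^sub>R axis j 1 :: real^'n"
  let ?F = "\<lambda>y. f (y + ?v) - f y"
  have F: "has_partial i ?F (g (y + ?v) - g y) y" for y
    using has_partial_diff[OF has_partial_dilate[where c = 1 and v
        = ?v] , of i f "g (y + ?v)" y f "g y"] assms(1)
    by simp
  have "norm (?F (x + t *\<^sub>R axis i 1) - ?F x - of_real t * (of_real t * h x)) \<le> e * t * \<bar>t\<bar>"
  proof (rule mean_value_line[OF F])
    fix s assume "s \<in> closed_segment 0 t"
    then have s: "0 \<le> s" "s \<le> t" using t by (auto simp: closed_segment_eq_real_ivl)
    have "norm (g (x + s *\<^sub>R axis i 1 + t *\<^sub>R axis j 1) - g (x + s *\<^sub>R axis i 1) - of_real t * h x)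
        \<le> e * \<bar>t\<bar>"
    proof (rule mean_value_line[OF assms(2)])
      fix r assume "r \<in> closed_segment 0 t"
      then have r: "0 \<le> r" "r \<le> t" using t by (auto simp: closed_segment_eq_real_ivl)
      have "norm (s *\<^sub>R axis i 1 + r *\<^sub>R axis j 1 :: real^'n) \<le> s + r"
        using norm_triangle_ineq[of "s *\<^sub>R axis i 1 :: real^'n" "r *\<^sub>R axis j 1"] s r by simp
      then show "norm (h (x + s *\<^sub>R axis i 1 + r *\<^sub>R axis j 1) - h x) \<le> e"
        using s r by (intro h) (simp add: algebra_simps)
    qed
    then show "norm (g (x + s *\<^sub>R axis i 1 + ?v) - g (x + s *\<^sub>R axis i 1) - of_real t * h x)
        \<le> e * t"
      using t by simp
  qed
  then show ?thesis using t by (simp add: algebra_simps)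
qed

lemma partial_commute:
  fixes f :: "real^'n::finite \<Rightarrow> complex"
  assumes "Ck 2 f"
  shows "partial i (partial j f) = partial j (partial i f)"
proof
  fix x
  let ?a = "\<lambda>i j. partial j (partial i f)"
  have 1: "has_partial i f (partial i f y) y" "has_partial j (partial i f) (?a i j y) y"
     and cont: "continuous_on UNIV (?a i j)" for i j y
    using assms Ck_Suc_has_partial[of 1 f] Ck_Suc_partial[of 1 f] Ck_Suc_has_partial[of 0 "partial i
        f"]
      Ck_Suc_partial[of 0 "partial i f"]
    by (auto simp: numeral_2_eq_2)
  have "norm (?a j i x - ?a i j x) \<le> e" if "e > 0" for e
  proof -
    have "\<exists>d>0. \<forall>z. norm (z - x) \<le> d \<longrightarrow> norm (?a i j z - ?a i j x) \<le> e / 2" for i j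
    proof -
      obtain d where "d > 0" "\<And>z. dist z x < d \<Longrightarrow> dist (?a i j z) (?a i j x) < e / 2"
        using cont[where i = i and j = j, unfolded continuous_on_iff] \<open>e > 0\<close>
            by (metis UNIV_I half_gt_zero)
      then show ?thesis
        by (intro exI[of _ "d / 2"]) (auto simp: dist_norm intro!: less_imp_le)
    qed
    then obtain d1 d2 where d: "d1 > 0" "d2 > 0"
      "\<And>z. norm (z - x) \<le> d1 \<Longrightarrow> norm (?a i j z - ?a i j x) \<le> e / 2"
      "\<And>z. norm (z - x) \<le> d2 \<Longrightarrow> norm (?a j i z - ?a j i x) \<le> e / 2"
      by metis
    \<comment> \<open>\<open>second_difference\<close> looks at points up to distance
      \<open>2 * t\<close> from \<open>x\<close>.\<close>
    define t where "t = min d1 d2 / 2"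
    have t: "t > 0" using d by (simp add: t_def)
    let ?D = "f (x + t *\<^sub>R axis i 1 + t *\<^sub>R axis j 1) - f (x + t *\<^sub>R axis i 1) - f (x + t *\<^sub>R axis j
        1) + f x"
    have "norm (?D - of_real (t * t) * ?a i j x) \<le> e / 2 * t * t"
      using t d by (intro second_difference[OF 1(1) 1(2)]) (auto simp: t_def)
    moreover have "norm (?D - of_real (t * t) * ?a j i x) \<le> e / 2 * t * t"
      using second_difference[OF 1(1) 1(2), where x = x and t = t and e = "e / 2" and i = j and j
          = i] t d by (auto simp: t_def algebra_simps)
    ultimately have "norm (of_real (t * t) * (?a j i x - ?a i j x)) \<le> e * (t * t)"
      using norm_triangle_ineq4[of "?D - of_real (t * t) * ?a i j x" "?D - of_real (t * t) * ?a j i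
          x"]
      by (simp add: algebra_simps)
    then show ?thesis using t by (simp add: norm_mult)
  qed
  then have "norm (?a j i x - ?a i j x) \<le> 0"
    by (rule field_le_epsilon) simp
  then show "partial i (partial j f) x = partial j (partial i f) x" by simp
qed

lemma ipartial_move:
  "Ck (Suc (length xs)) f \<Longrightarrow> ipartial (xs @ [x]) f = ipartial (x # xs) f"
proof (induction xs)
  case (Cons y xs)
  have "ipartial (xs @ [x]) f = ipartial (x # xs) f"
    using Cons by (auto dest: Ck_SucD)
  moreover have "Ck 2 (ipartial xs f)"
    using Cons.prems Ck_ipartial[of 2 xs f] by simp
  ultimately show ?case using partial_commute[of "ipartial xs f" x y] by simp
qed auto

text \<open>The head of \<open>xs\<close> is carried to the front of \<open>ys\<close> past the
  directions before it, and induction handles the tails.\<close>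

lemma ipartial_perm:
  "Ck (length xs) f \<Longrightarrow> mset xs = mset ys \<Longrightarrow> ipartial xs f = ipartial ys f"
proof (induction xs arbitrary: ys)
  case (Cons x xs)
  then have "x \<in> set ys" by (metis list.set_intros(1) mset_eq_setD)
  then obtain as bs where ys: "ys = as @ x # bs" by (meson split_list)
  have len: "length xs = length as + length bs"
    using Cons.prems(2) mset_eq_length[OF Cons.prems(2)] ys by simp
  have "ipartial ys f = ipartial (as @ [x]) (ipartial bs f)"
    by (simp add: ys ipartial_append)
  also have "\<dots> = ipartial (x # as) (ipartial bs f)"
    using Cons.prems len by (intro ipartial_move Ck_ipartial) simp
  also have "\<dots> = partial x (ipartial (as @ bs) f)" by (simp add: ipartial_append)
  also have "ipartial (as @ bs) f = ipartial xs f"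
    using Cons ys by (intro Cons.IH[symmetric]) (auto dest: Ck_SucD)
  finally show ?case by simp
qed auto

section \<open>Multi-indices and lists of directions\<close>

lemma mlen_count_list: "mlen (count_list xs) = length xs"
  by (simp add: mlen_def sum_count_set)

lemma exists_count_list: "\<exists>xs :: 'n::finite list. \<forall>i. count_list xs i = \<nu> i"
proof -
  have "\<exists>xs. \<forall>i. count_list xs i = (if i \<in> A then \<nu> i else 0)" if "finite A" for A
    using that
  proof (induction A)
    case empty
    show ?case by (auto intro: exI[of _ "[]"])
  next
    case (insert a A)
    then obtain xs where xs: "\<forall>i. count_list xs i = (if i \<in> A then \<nu> i else 0)" by blast
    have "count_list (replicate (\<nu> a) a) i = (if i = a then \<nu> a else 0)" for i
      by (simp flip: count_mset)
    then show ?case using xs insert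
      by (intro exI[of _ "replicate (\<nu> a) a @ xs"]) auto
  qed
  from this[of UNIV] show ?thesis by simp
qed

text \<open>The list chosen in \<open>mpartial\<close> depends on the multi-index alone, so one
  \<open>xs\<close> serves all functions at once; linearity in \<open>f\<close> relies on
  this.\<close>

lemma mpartial_ipartial_ex:
  obtains xs where "count_list xs = \<nu>" "length xs = mlen \<nu>" "\<And>f. mpartial \<nu> f = ipartial xs f"
proof
  let ?xs = "SOME l. \<forall>i. count_list l i = \<nu> i"
  have "\<forall>i. count_list ?xs i = \<nu> i"
    using exists_count_list by (rule someI_ex)
  then show "count_list ?xs = \<nu>" by auto
  then show "length ?xs = mlen \<nu>" by (metis mlen_count_list)
qed (simp add: mpartial_def)

lemma ipartial_eq_mpartial:
  assumes "Ck m f" "length xs \<le> m"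
  shows "ipartial xs f = mpartial (count_list xs) f"
proof -
  obtain ys where ys: "count_list ys = count_list xs" "mpartial (count_list xs) f = ipartial ys f"
    using mpartial_ipartial_ex by metis
  have "mset xs = mset ys" using ys by (metis count_mset multiset_eqI)
  then show ?thesis using assms ys ipartial_perm[of xs f ys] Ck_mono by metis
qed

section \<open>Seminorms and completeness\<close>

lemma finite_mlen_le: "finite {\<nu> :: 'n::finite \<Rightarrow> nat. mlen \<nu> \<le> k}"
proof (rule finite_subset)
  show "{\<nu> :: 'n \<Rightarrow> nat. mlen \<nu> \<le> k} \<subseteq> PiE UNIV (\<lambda>_. {..k})"
  proof
    fix \<nu> :: "'n \<Rightarrow> nat" assume "\<nu> \<in> {\<nu>. mlen \<nu> \<le> k}"
    then have "\<nu> i \<le> k" for i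
      using member_le_sum[of i UNIV \<nu>] by (simp add: mlen_def)
    then show "\<nu> \<in> PiE UNIV (\<lambda>_. {..k})" by auto
  qed
qed (auto intro: finite_PiE)

text \<open>\<open>Sup\<close> on the reals is an upper bound only for sets bounded above. Here the
  set is a union over finitely many multi-indices of continuous images of a compact set.\<close>

lemma snorm_bdd:
  assumes "Ck m f" "k \<le> m" "compact K"
  shows "bdd_above (insert 0 {norm (mpartial \<nu> f x) | \<nu> x. x \<in> K \<and> mlen \<nu> \<le> k})"
proof -
  have eq: "{norm (mpartial \<nu> f x) | \<nu> x. x \<in> K \<and> mlen \<nu> \<le> k}
     = (\<Union>\<nu>\<in>{\<nu>. mlen \<nu> \<le> k}. (\<lambda>x. norm (mpartial \<nu> f x)) ` K)" by auto
  have bd: "bdd_above ((\<lambda>x. norm (mpartial \<nu> f x)) ` K)" if "mlen \<nu> \<le> k" for \<nu>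
  proof -
    obtain xs where "length xs = mlen \<nu>" "mpartial \<nu> f = ipartial xs f"
      using mpartial_ipartial_ex by metis
    then have "continuous_on K (mpartial \<nu> f)"
      using assms that by (auto intro: continuous_on_ipartial)
    then show ?thesis
      using assms by (intro bounded_imp_bdd_above compact_imp_bounded compact_continuous_image
          continuous_on_norm)
  qed
  then show ?thesis
    unfolding eq bdd_above_insert bdd_above_UN[OF finite_mlen_le]
    by (intro ballI) (drule CollectD, rule bd)
qed

lemma norm_ipartial_le_snorm:
  assumes "Ck m f" "k \<le> m" "compact K" "length xs \<le> k" "x \<in> K"
  shows "norm (ipartial xs f x) \<le> snorm K k f"
  unfolding snorm_def
  using assms ipartial_eq_mpartial[of m f xs] mlen_count_list[of xs]
  by (intro cSup_upper snorm_bdd) (auto intro!: exI[of _ "count_list xs"] exI[of _ x])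

lemma snorm_nonneg: "Ck m f \<Longrightarrow> k \<le> m \<Longrightarrow> compact K \<Longrightarrow> 0 \<le> snorm K k f"
  unfolding snorm_def by (intro cSup_upper snorm_bdd) auto

lemma snorm_le:
  assumes "\<And>xs x. length xs \<le> k \<Longrightarrow> x \<in> K \<Longrightarrow> norm (ipartial xs f x) \<le> B" "0 \<le> B"
  shows "snorm K k f \<le> B"
proof -
  have "norm (mpartial \<nu> f x) \<le> B" if "mlen \<nu> \<le> k" "x \<in> K" for \<nu> x
    using that assms(1) by (metis mpartial_ipartial_ex)
  then show ?thesis
    unfolding snorm_def using assms(2) by (intro cSup_least) auto
qed

lemma snorm_mono:
  assumes "Ck m f" "k \<le> k'" "k' \<le> m" "compact K'" "K \<subseteq> K'"
  shows "snorm K k f \<le> snorm K' k' f"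
  using assms by (intro snorm_le norm_ipartial_le_snorm snorm_nonneg) auto

lemma snorm_add:
  assumes "Ck m f" "Ck m g" "k \<le> m" "compact K"
  shows "snorm K k (f + g) \<le> snorm K k f + snorm K k g"
  using assms
  by (intro snorm_le add_nonneg_nonneg snorm_nonneg)
    (auto simp: plus_fun_def ipartial_add[of m] intro!: order_trans[OF norm_triangle_ineq]
      add_mono norm_ipartial_le_snorm)

lemma snorm_cmult:
  assumes "Ck m f" "k \<le> m" "compact K"
  shows "snorm K k (\<lambda>x. c * f x) \<le> norm c * snorm K k f"
  using assms
  by (intro snorm_le mult_nonneg_nonneg snorm_nonneg)
    (auto simp: ipartial_cmult[of m] norm_mult intro!: mult_left_mono norm_ipartial_le_snorm)

lemma snorm_zero [simp]: "snorm K k 0 = 0"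
proof -
  have "mpartial \<nu> 0 x = 0" for \<nu> and x
    by (rule mpartial_ipartial_ex[of \<nu>]) (simp add: zero_fun_def ipartial_const)
  then have "insert 0 {norm (mpartial \<nu> 0 x) | \<nu> x. x \<in> K \<and> mlen \<nu> \<le> k} = {0}"
    by auto
  then show ?thesis by (simp only: snorm_def cSup_singleton)
qed

text \<open>Termwise differentiation along the coordinate segment
  \<open>x + t *\<^sub>R axis i 1\<close> with \<open>t\<close> in [-1, 1], a compact set on which
  the derivatives converge uniformly.\<close>

lemma Ck_limit:
  fixes f :: "nat \<Rightarrow> real^'n::finite \<Rightarrow> complex"
  assumes Ck: "\<And>n. Ck m (f n)"
    and lim: "\<And>xs K. length xs \<le> m \<Longrightarrow> compact K \<Longrightarrow>
      uniform_limit K (\<lambda>n. ipartial xs (f n)) (G xs) sequentially"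
  shows "Ck m (G [])" and "length xs \<le> m \<Longrightarrow> ipartial xs (G []) = G xs"
proof -
  have part: "has_partial i (G xs) (G (i # xs) x) x" if "length xs < m" for xs i x
  proof -
    let ?l = "\<lambda>t::real. x + t *\<^sub>R axis i 1"
    let ?S = "cball (0::real) 1"
    have K: "compact (?l ` ?S)"
      by (intro compact_continuous_image continuous_intros) auto
    have l1: "uniform_limit (?l ` ?S) (\<lambda>n. ipartial (i # xs) (f n)) (G (i # xs)) sequentially"
      using that K by (intro lim) auto
    have l0: "(\<lambda>n. ipartial xs (f n) (?l t)) \<longlonglongrightarrow> G xs (?l t)" if "t \<in> ?S" for t
      using that \<open>length xs < m\<close> K by (intro tendsto_uniform_limitI[OF lim[of xs "?l ` ?S"]]) auto
    have "\<exists>g. \<forall>t\<in>?S. (\<lambda>n. ipartial xs (f n) (?l t)) \<longlonglongrightarrow> g t \<and>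
       (g has_derivative (\<lambda>h. h *\<^sub>R G (i # xs) (?l t))) (at t within ?S)"
    proof (rule has_derivative_sequence)
      fix n t
      have "((\<lambda>t. ipartial xs (f n) (?l t)) has_vector_derivative ipartial (i # xs) (f n) (?l t))
          (at t)"
        using that Ck by (intro has_partial_line has_partial_ipartial) auto
      then show "((\<lambda>t. ipartial xs (f n) (?l t)) has_derivative
          (\<lambda>h. h *\<^sub>R ipartial (i # xs) (f n) (?l t))) (at t within ?S)"
        by (auto simp: has_vector_derivative_def intro: has_derivative_at_withinI)
    next
      fix e :: real assume "e > 0"
      from uniform_limitD[OF l1 this]
      show "\<forall>\<^sub>F n in sequentially. \<forall>t\<in>?S. \<forall>h. norm (h *\<^sub>R ipartial (i # xs) (f n) (?l t)
          - h *\<^sub>R G (i # xs) (?l t)) \<le> e * norm h"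
      proof eventually_elim
        case (elim n)
        show ?case
        proof (intro ballI allI)
          fix t h :: real assume "t \<in> ?S"
          then have "dist (ipartial (i # xs) (f n) (?l t)) (G (i # xs) (?l t)) \<le> e"
            using elim by (auto intro: less_imp_le)
          then have "\<bar>h\<bar> * dist (ipartial (i # xs) (f n) (?l t)) (G (i # xs) (?l t)) \<le> \<bar>h\<bar> * e"
            by (intro mult_left_mono) auto
          then show "norm (h *\<^sub>R ipartial (i # xs) (f n) (?l t) - h *\<^sub>R G (i # xs) (?l t))
            \<le> e * norm h"
            by (simp add: dist_norm mult.commute flip: scaleR_diff_right)
        qed
      qed
    next
      show "(\<lambda>n. ipartial xs (f n) (?l 0)) \<longlonglongrightarrow> G xs (?l 0)" by (rule l0) auto
    qed auto
    then obtain g where *: "\<forall>t\<in>?S. (\<lambda>n. ipartial xs (f n) (?l t)) \<longlonglongrightarrow> g t \<and>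
       (g has_derivative (\<lambda>h. h *\<^sub>R G (i # xs) (?l t))) (at t within ?S)" by blast
    have g: "(\<lambda>n. ipartial xs (f n) (?l t)) \<longlonglongrightarrow> g t" if "t \<in> ?S" for t
      using bspec[OF * that] by (rule conjunct1)
    have "(g has_derivative (\<lambda>h. h *\<^sub>R G (i # xs) (?l 0))) (at 0 within ?S)"
      by (rule bspec[OF *, THEN conjunct2]) simp
    note g = g this
    have "g t = G xs (?l t)" if "t \<in> ?S" for t
      using LIMSEQ_unique[OF g(1) l0] that by blast
    then have "((\<lambda>t. G xs (?l t)) has_derivative (\<lambda>h. h *\<^sub>R G (i # xs) (?l 0))) (at 0 within ?S)"
      using g(2) by (auto intro: has_derivative_transform[rotated 2])
    moreover have "at (0::real) within ?S = at 0"
      by (intro at_within_interior) (auto simp: interior_cball)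
    ultimately show ?thesis by (simp add: has_partial_def has_vector_derivative_def)
  qed
  have cont: "continuous_on UNIV (G xs)" if "length xs \<le> m" for xs
  proof -
    have "continuous_on (cball x 1) (G xs)" for x
      using that Ck
      by (intro uniform_limit_theorem[OF _ lim]) (auto intro!: always_eventually
          continuous_on_ipartial)
    then have "isCont (G xs) x" for x
      by (rule continuous_on_interior[where S = "cball x 1"]) (auto simp: interior_cball)
    then show ?thesis by (simp add: continuous_at_imp_continuous_on)
  qed
  show "Ck m (G [])" using part cont by (rule Ck_family)
  show "length xs \<le> m \<Longrightarrow> ipartial xs (G []) = G xs"
    using part by (rule ipartial_eqI) auto
qed

lemma Em_complete:
  fixes f :: "nat \<Rightarrow> real^'n::finite \<Rightarrow> complex"
  assumes "\<And>n. Ck m (f n)"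
    and Cauchy: "\<And>K e. compact K \<Longrightarrow> e > 0 \<Longrightarrow>
      \<exists>N. \<forall>i\<ge>N. \<forall>j\<ge>N. \<forall>xs x. length xs \<le> m \<longrightarrow> x \<in> K \<longrightarrow>
        norm (ipartial xs (f i) x - ipartial xs (f j) x) < e"
  obtains g where "Ck m g" "\<And>xs K. length xs \<le> m \<Longrightarrow> compact K \<Longrightarrow>
      uniform_limit K (\<lambda>n. ipartial xs (f n)) (ipartial xs g) sequentially"
proof -
  define G where "G xs x = lim (\<lambda>n. ipartial xs (f n) x)" for xs x
  have lim: "uniform_limit K (\<lambda>n. ipartial xs (f n)) (G xs) sequentially"
    if "length xs \<le> m" "compact K" for xs K
  proof -
    have "uniformly_Cauchy_on K (\<lambda>n. ipartial xs (f n))"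
      unfolding uniformly_Cauchy_on_def dist_norm using Cauchy that by meson
    then show ?thesis
      unfolding G_def
      using Cauchy_uniformly_convergent uniformly_convergent_uniform_limit_iff by blast
  qed
  show thesis
    using Ck_limit[OF assms(1) lim] lim by (intro that[of "G []"]) auto
qed

section \<open>Taylor polynomials of jets\<close>

definition single :: "'n \<Rightarrow> 'n::finite \<Rightarrow> nat" where
  "single i = (\<lambda>j. if j = i then 1 else 0)"

lemma mlen_add: "mlen (k + l) = mlen k + mlen l"
  by (simp add: mlen_def sum.distrib)

lemma mlen_single [simp]: "mlen (single i) = 1"
  by (simp add: mlen_def single_def)

lemma mlen_zero [simp]: "mlen 0 = 0"
  by (simp add: mlen_def)

lemma mlen_eq_0: "mlen l = 0 \<longleftrightarrow> l = 0"
  by (auto simp: mlen_def fun_eq_iff)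

lemma count_list_Cons: "count_list (i # xs) = count_list xs + single i"
  by (auto simp: single_def fun_eq_iff)

definition monomial :: "('n::finite \<Rightarrow> nat) \<Rightarrow> real^'n \<Rightarrow> real" where
  "monomial l v = (\<Prod>i\<in>UNIV. v $ i ^ l i / fact (l i))"

text \<open>The formal derivative of order \<open>k\<close> of the Taylor polynomial of the jet at
  \<open>a\<close>; \<open>Ck_ipartial_tay\<close> shows that it is the actual one. For
  \<open>mlen k > m\<close> truncated subtraction leaves only the term \<open>l = 0\<close>.\<close>

definition tay :: "nat \<Rightarrow> (('n::finite \<Rightarrow> nat) \<Rightarrow> real^'n \<Rightarrow> complex) \<Rightarrow> real^'n \<Rightarrow> ('n \<Rightarrow> nat)
    \<Rightarrow> real^'n \<Rightarrow> complex" where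
  "tay m F a k y = (\<Sum>l\<in>{l. mlen l \<le> m - mlen k}. of_real (monomial l (y - a)) * F (k + l) a)"

lemma jet_rem_tay: "jet_rem m F x k y = F k y - tay m F x k y"
  by (simp add: jet_rem_def tay_def monomial_def prod_dividef)

text \<open>A range of summation independent of \<open>k\<close> turns differentiation into a shift
  of the index.\<close>

lemma tay_full:
  assumes "\<And>k. mlen k > m \<Longrightarrow> F k a = 0"
  shows "tay m F a k y = (\<Sum>l\<in>{l. mlen l \<le> m}. of_real (monomial l (y - a)) * F (k + l) a)"
  unfolding tay_def
  by (intro sum.mono_neutral_left finite_mlen_le) (auto simp: mlen_add intro!: assms)

lemma has_partial_monomial:
  "has_partial i (\<lambda>y. of_real (monomial l (y - a)))
     (if l i = 0 then 0 else of_real (monomial (l(i := l i - 1)) (y - a))) y"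
proof -
  define R where "R = (\<Prod>j\<in>UNIV - {i}. (y - a) $ j ^ l j / fact (l j))"
  have eq: "monomial (l(i := n)) (y + t *\<^sub>R axis i 1 - a) = (y $ i - a $ i + t) ^ n / fact n * R"
      for t n
  proof -
    have "(\<Prod>j\<in>UNIV - {i}. (y + t *\<^sub>R axis i 1 - a) $ j ^ (l(i := n)) j / fact ((l(i := n)) j)) = R"
      unfolding R_def by (intro prod.cong) (auto simp: axis_def)
    then show ?thesis
      unfolding monomial_def by (subst prod.remove[of _ i]) (auto simp: axis_def algebra_simps)
  qed
  have "((\<lambda>t. (y $ i - a $ i + t) ^ l i / fact (l i) * R) has_real_derivative
      (if l i = 0 then 0 else (y $ i - a $ i) ^ (l i - 1) / fact (l i - 1) * R)) (at 0)"
  proof (cases "l i")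
    case (Suc n)
    have "((\<lambda>t. (y $ i - a $ i + t) ^ Suc n / fact (Suc n) * R) has_real_derivative
        real (Suc n) * (y $ i - a $ i) ^ n / fact (Suc n) * R) (at 0)"
      by (auto intro!: derivative_eq_intros simp del: fact_Suc power_Suc)
    then show ?thesis using Suc by (simp add: field_simps del: of_nat_Suc)
  qed simp
  then have "((\<lambda>t. monomial l (y + t *\<^sub>R axis i 1 - a)) has_real_derivative
      (if l i = 0 then 0 else monomial (l(i := l i - 1)) (y - a))) (at 0)"
    using eq[of "l i"] eq[of "l i - 1" 0] by (simp only: fun_upd_triv scaleR_zero_left add_0_right)
  then have "((\<lambda>t. complex_of_real (monomial l (y + t *\<^sub>R axis i 1 - a))) has_vector_derivative
      of_real (if l i = 0 then 0 else monomial (l(i := l i - 1)) (y - a))) (at 0)"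
    by (intro bounded_linear.has_vector_derivative[OF bounded_linear_of_real])
      (simp add: has_real_derivative_iff_has_vector_derivative)
  then show ?thesis by (cases "l i = 0") (simp_all add: has_partial_def)
qed

text \<open>Differentiation lowers \<open>l\<close> by \<open>single i\<close>, which matches the
  terms with \<open>l i \<noteq> 0\<close> to the multi-indices of length below
  \<open>m\<close>.\<close>

lemma has_partial_tay:
  assumes F: "\<And>k. mlen k > m \<Longrightarrow> F k a = 0"
  shows "has_partial i (tay m F a k) (tay m F a (k + single i) y) y"
proof -
  let ?c = "\<lambda>l. complex_of_real (monomial l (y - a))"
  let ?low = "\<lambda>l. l(i := l i - 1)"
  have "has_partial i (\<lambda>y. \<Sum>l\<in>{l. mlen l \<le> m}. F (k + l) a * of_real (monomial l (y - a)))
     (\<Sum>l\<in>{l. mlen l \<le> m}. F (k + l) a * (if l i = 0 then 0 else ?c (?low l))) y"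
    by (intro has_partial_sum has_partial_cmult has_partial_monomial)
  moreover have "(\<Sum>l\<in>{l. mlen l \<le> m}. F (k + l) a * (if l i = 0 then 0 else ?c (?low l)))
     = (\<Sum>l\<in>{l. mlen l \<le> m \<and> l i \<noteq> 0}. F (k + l) a * ?c (?low l))"
    by (rule sum.mono_neutral_cong_right) (auto simp: finite_mlen_le)
  moreover have "\<dots> = (\<Sum>l\<in>{l. mlen l + 1 \<le> m}. F (k + single i + l) a * ?c l)"
  proof (rule sum.reindex_bij_witness[where j = ?low and i = "\<lambda>l. l + single i"])
    fix l :: "'a \<Rightarrow> nat" assume l: "l \<in> {l. mlen l \<le> m \<and> l i \<noteq> 0}"
    then show inv: "?low l + single i = l" by (auto simp: single_def fun_eq_iff)
    then show "?low l \<in> {l. mlen l + 1 \<le> m}"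
      using l mlen_add[of "?low l" "single i"] by simp
    have "k + single i + ?low l = k + l" by (metis inv add.assoc add.commute)
    then show "F (k + single i + ?low l) a * ?c (?low l) = F (k + l) a * ?c (?low l)" by simp
  next
    fix l :: "'a \<Rightarrow> nat" assume l: "l \<in> {l. mlen l + 1 \<le> m}"
    show "?low (l + single i) = l" by (auto simp: single_def fun_eq_iff)
    show "l + single i \<in> {l. mlen l \<le> m \<and> l i \<noteq> 0}" using l by (simp add: mlen_add)
        (simp add: single_def)
  qed
  \<comment> \<open>The restored terms have \<open>mlen l = m\<close>, where the jet is read beyond
    order \<open>m\<close> and vanishes.\<close>
  moreover have "\<dots> = (\<Sum>l\<in>{l. mlen l \<le> m}. F (k + single i + l) a * ?c l)"
    by (rule sum.mono_neutral_left) (auto simp: finite_mlen_le mlen_add intro!: F)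
  ultimately have "has_partial i (\<lambda>y. \<Sum>l\<in>{l. mlen l \<le> m}. F (k + l) a * of_real (monomial l (y -
      a)))
     (\<Sum>l\<in>{l. mlen l \<le> m}. F (k + single i + l) a * ?c l) y" by simp
  moreover have "tay m F a k = (\<lambda>y. \<Sum>l\<in>{l. mlen l \<le> m}. F (k + l) a * of_real (monomial l (y - a)))"
    for k by (rule ext, subst tay_full) (auto simp: mult.commute intro: F)
  ultimately show ?thesis by simp
qed

lemma continuous_on_monomial [continuous_intros]:
  "continuous_on A f \<Longrightarrow> continuous_on A (\<lambda>y. monomial l (f y))"
  unfolding monomial_def by (intro continuous_intros) auto

lemma Ck_ipartial_tay:
  assumes F: "\<And>k. mlen k > m \<Longrightarrow> F k a = 0"
  shows "Ck n (tay m F a k)" and "ipartial xs (tay m F a k) = tay m F a (k + count_list xs)"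
proof -
  let ?G = "\<lambda>xs. tay m F a (k + count_list xs)"
  have "has_partial i (tay m F a k) (tay m F a (k + single i) x) x" for i k x
    by (rule has_partial_tay) (rule F)
  from this[of _ "k + count_list _"] have part: "has_partial i (?G xs) (?G (i # xs) x) x" for i xs x
    by (simp only: count_list_Cons add.assoc)
  have "count_list [] = (0 :: 'a \<Rightarrow> nat)" by auto
  then have nil: "?G [] = tay m F a k" by simp
  have cont: "continuous_on UNIV (?G xs)" for xs
    unfolding tay_def by (intro continuous_intros)
  show "Ck n (tay m F a k)" using Ck_family[of n ?G, OF part cont] by (simp only: nil)
  show "ipartial xs (tay m F a k) = ?G xs" by (rule ipartial_eqI[OF part nil order_refl])
qed

lemma monomial_zero: "monomial l 0 = (if l = 0 then 1 else 0)"
proof (cases "l = 0")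
  case False
  then obtain i where i: "l i \<noteq> 0" by (auto simp: fun_eq_iff)
  have "monomial l 0 = 0" unfolding monomial_def
    by (rule prod_zero[OF finite bexI[of _ i]]) (use i in auto)
  then show ?thesis using False by simp
qed (simp add: monomial_def)

lemma tay_self: "tay m F a k a = F k a"
proof -
  have "tay m F a k a = (\<Sum>l\<in>{0}. of_real (monomial l (a - a)) * F (k + l) a)"
    unfolding tay_def
    by (intro sum.mono_neutral_right finite_mlen_le) (auto simp: monomial_zero)
  then show ?thesis by (simp add: monomial_zero)
qed

lemma tay_top: "mlen k \<ge> m \<Longrightarrow> tay m F a k y = F k a"
proof -
  assume "mlen k \<ge> m"
  then have "{l :: 'a \<Rightarrow> nat. mlen l \<le> m - mlen k} = {0}" by (auto simp: mlen_eq_0)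
  then show ?thesis by (simp add: tay_def monomial_def)
qed

text \<open>A Taylor type estimate without Taylor's formula: bounds on the derivatives of order \<open>m\<close>
  are transported to the lower orders by the mean value theorem.\<close>

lemma descent:
  fixes Q :: "('n::finite \<Rightarrow> nat) \<Rightarrow> real^'n \<Rightarrow> complex"
  assumes part: "\<And>k i y. mlen k < m \<Longrightarrow> has_partial i (Q k) (Q (k + single i) y) y"
    and centre: "\<And>k. mlen k < m \<Longrightarrow> norm (Q k b) \<le> M * \<rho> ^ (m - mlen k)"
    and top: "\<And>k z. mlen k = m \<Longrightarrow> (\<And>j. \<bar>z $ j - b $ j\<bar> \<le> \<rho>) \<Longrightarrow> norm (Q k z) \<le> M"
    and y: "\<And>j. \<bar>y $ j - b $ j\<bar> \<le> \<rho>" and k: "mlen k \<le> m" and M: "M \<ge> 0"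
  shows "norm (Q k y) \<le> (1 + real CARD('n)) ^ m * M * \<rho> ^ (m - mlen k)"
proof -
  let ?d = "real CARD('n)"
  have \<rho>: "\<rho> \<ge> 0" using y[of undefined] by linarith
  have "norm (Q k y) \<le> (1 + ?d) ^ n * M * \<rho> ^ n"
    if "mlen k + n = m" "\<And>j. \<bar>y $ j - b $ j\<bar> \<le> \<rho>" for n k y
    using that
  proof (induction n arbitrary: k y)
    case 0
    then show ?case using top by simp
  next
    case (Suc n)
    have "norm (Q k y - Q k b) \<le> ?d * ((1 + ?d) ^ n * M * \<rho> ^ n) * \<rho>"
    proof (rule mean_value_cube[where g = "\<lambda>i. Q (k + single i)"])
      show "has_partial i (Q k) (Q (k + single i) y) y" for i y using Suc.prems by (intro part) simp
      show "norm (Q (k + single i) z) \<le> (1 + ?d) ^ n * M * \<rho> ^ n"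
        if "\<And>j. \<bar>z $ j - b $ j\<bar> \<le> \<rho>" for i z
      proof (rule Suc.IH[OF _ that])
        show "mlen (k + single i) + n = m" using Suc.prems by (simp only: mlen_add mlen_single)
      qed
    qed (use Suc.prems in auto)
    moreover have "norm (Q k b) \<le> M * \<rho> ^ Suc n"
      using centre[of k] Suc.prems(1) by (simp flip: Suc.prems(1))
    moreover have "M * \<rho> ^ Suc n \<le> (1 + ?d) ^ n * (M * \<rho> ^ Suc n)"
      using M \<rho> mult_right_mono[of 1 "(1 + ?d) ^ n" "M * \<rho> ^ Suc n"] by simp
    moreover have "norm (Q k y) \<le> norm (Q k y - Q k b) + norm (Q k b)"
      using norm_triangle_ineq[of "Q k y - Q k b" "Q k b"] by simp
    \<comment> \<open>One part of the factor \<open>1 + ?d\<close> pays for the centre, the other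
      for the mean value step.\<close>
    moreover have "(1 + ?d) ^ Suc n * M * \<rho> ^ Suc n
       = (1 + ?d) ^ n * (M * \<rho> ^ Suc n) + ?d * ((1 + ?d) ^ n * M * \<rho> ^ n) * \<rho>"
      by (simp add: algebra_simps)
    ultimately show ?case by linarith
  qed
  then have "norm (Q k y) \<le> (1 + ?d) ^ (m - mlen k) * M * \<rho> ^ (m - mlen k)"
    using k y by simp
  also have "\<dots> \<le> (1 + ?d) ^ m * M * \<rho> ^ (m - mlen k)"
    using M \<rho> by (intro mult_right_mono power_increasing) auto
  finally show ?thesis .
qed

text \<open>The differences form a family closed under differentiation. At \<open>b\<close> they
  equal minus the jet remainder, and in top order both polynomials are constant, so
  \<open>descent\<close> applies.\<close>

lemma tay_diff_bound:
  fixes F :: "('n::finite \<Rightarrow> nat) \<Rightarrow> real^'n \<Rightarrow> complex"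
  assumes F: "\<And>k x. mlen k > m \<Longrightarrow> F k x = 0"
    and rem: "\<And>k. mlen k \<le> m \<Longrightarrow> norm (jet_rem m F a k b) \<le> M * \<rho> ^ (m - mlen k)"
    and y: "\<And>j. \<bar>y $ j - b $ j\<bar> \<le> \<rho>" and k: "mlen k \<le> m" and M: "M \<ge> 0"
  shows "norm (tay m F a k y - tay m F b k y) \<le> (1 + real CARD('n)) ^ m * M * \<rho> ^ (m - mlen k)"
proof (rule descent[where Q = "\<lambda>k y. tay m F a k y - tay m F b k y" and b = b])
  have *: "norm (tay m F a k b - tay m F b k b) \<le> M * \<rho> ^ (m - mlen k)" if "mlen k \<le> m" for k
    using rem[OF that] by (simp add: jet_rem_tay tay_self norm_minus_commute)
  then show "norm (tay m F a k b - tay m F b k b) \<le> M * \<rho> ^ (m - mlen k)" if "mlen k < m" for k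
    using that by simp
  show "norm (tay m F a k z - tay m F b k z) \<le> M" if "mlen k = m" for k z
    using *[of k] that by (simp add: tay_top)
qed (use F y k M in \<open>auto intro: has_partial_diff has_partial_tay\<close>)

section \<open>Jets of differentiable functions\<close>

lemma mpartial_has_partial:
  assumes "Ck m f" "mlen k < m"
  shows "has_partial i (mpartial k f) (mpartial (k + single i) f y) y"
proof -
  obtain xs where xs: "count_list xs = k" "length xs = mlen k" "mpartial k f = ipartial xs f"
    using mpartial_ipartial_ex by metis
  then have "mpartial (k + single i) f = ipartial (i # xs) f"
    using ipartial_eq_mpartial[of m f "i # xs"] assms by (simp add: count_list_Cons del:
        count_list.simps ipartial.simps)
  then show ?thesis using xs assms has_partial_ipartial[of m f xs i y] by simp
qed

text \<open>Subtracting the Taylor polynomial at \<open>x\<close> makes all derivatives up to order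
  \<open>m\<close> vanish at \<open>x\<close>, so only the oscillation of the top derivatives
  remains for \<open>descent\<close>.\<close>

lemma jet_taylor:
  fixes f :: "real^'n::finite \<Rightarrow> complex"
  assumes f: "Ck m f" and x: "x \<in> X" and k: "mlen k \<le> m" and M: "M \<ge> 0"
    and y: "\<And>j. \<bar>y $ j - x $ j\<bar> \<le> \<rho>"
    and osc: "\<And>k z. mlen k = m \<Longrightarrow> (\<And>j. \<bar>z $ j - x $ j\<bar> \<le> \<rho>) \<Longrightarrow>
        norm (mpartial k f z - mpartial k f x) \<le> M"
  shows "norm (mpartial k f y - tay m (Jm X m f) x k y)
       \<le> (1 + real CARD('n)) ^ m * M * \<rho> ^ (m - mlen k)"
proof (rule descent[where Q = "\<lambda>k y. mpartial k f y - tay m (Jm X m f) x k y" and b = x])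
  have \<rho>: "\<rho> \<ge> 0" using y[of undefined] by linarith
  show "norm (mpartial k f x - tay m (Jm X m f) x k x) \<le> M * \<rho> ^ (m - mlen k)" if "mlen k < m" for k
    using that x M \<rho> by (simp add: tay_self Jm_def)
  show "has_partial i (\<lambda>y. mpartial k f y - tay m (Jm X m f) x k y)
    (mpartial (k + single i) f y - tay m (Jm X m f) x (k + single i) y) y" if "mlen k < m" for k i y
    using that f by (intro has_partial_diff mpartial_has_partial has_partial_tay)
        (auto simp: Jm_def)
  show "norm (mpartial k f z - tay m (Jm X m f) x k z) \<le> M"
    if "mlen k = m" "\<And>j. \<bar>z $ j - x $ j\<bar> \<le> \<rho>" for k z
    using that x osc[of k z] by (simp add: tay_top) (simp add: Jm_def)
qed (use y k M in auto)

lemma dist_le_cube: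
  fixes x z :: "real^'n::finite"
  assumes "\<And>j. \<bar>z $ j - x $ j\<bar> \<le> \<rho>"
  shows "dist x z \<le> real CARD('n) * \<rho>"
proof -
  have "norm (z - x) \<le> (\<Sum>j\<in>UNIV. \<bar>(z - x) $ j\<bar>)" by (rule norm_le_l1_cart)
  also have "\<dots> \<le> (\<Sum>j\<in>(UNIV::'n set). \<rho>)" using assms by (intro sum_mono) simp
  finally show ?thesis by (simp add: dist_norm norm_minus_commute)
qed

lemma cube_dist: "\<bar>y $ j - x $ j\<bar> \<le> dist x y"
  using component_le_norm_cart[of "y - x" j] by (simp add: dist_norm norm_minus_commute)

lemma jet_rem_Jm:
  fixes f :: "real^'n::finite \<Rightarrow> complex"
  assumes "Ck m f" "x \<in> X" "y \<in> X" "mlen k \<le> m" "M \<ge> 0"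
    and "\<And>k z. mlen k = m \<Longrightarrow> dist x z \<le> real CARD('n) * dist x y \<Longrightarrow>
        norm (mpartial k f z - mpartial k f x) \<le> M"
  shows "norm (jet_rem m (Jm X m f) x k y) \<le> (1 + real CARD('n)) ^ m * M * dist x y ^ (m - mlen k)"
proof -
  have "norm (mpartial k f y - tay m (Jm X m f) x k y)
       \<le> (1 + real CARD('n)) ^ m * M * dist x y ^ (m - mlen k)"
  proof (rule jet_taylor[OF assms(1,2,4,5) cube_dist])
    fix k :: "'n \<Rightarrow> nat" and z assume "mlen k = m" "\<And>j. \<bar>z $ j - x $ j\<bar> \<le> dist x y"
    then show "norm (mpartial k f z - mpartial k f x) \<le> M" by (intro assms(6) dist_le_cube)
  qed
  then show ?thesis using assms by (simp add: jet_rem_tay Jm_def)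
qed

lemma continuous_on_mpartial: "Ck m f \<Longrightarrow> mlen k \<le> m \<Longrightarrow> continuous_on A (mpartial k f)"
  by (rule mpartial_ipartial_ex[of k]) (auto intro: continuous_on_ipartial)

lemma finite_common_delta:
  assumes "finite A" "\<And>k. k \<in> A \<Longrightarrow> \<exists>d>0. P k d"
    and "\<And>k d d'. P k d \<Longrightarrow> 0 < d' \<Longrightarrow> d' \<le> d \<Longrightarrow> P k d'"
  shows "\<exists>d>0::real. \<forall>k\<in>A. P k d"
  using assms(1,2)
proof (induction A)
  case (insert a A)
  then obtain d1 d2 where "d1 > 0" "P a d1" "d2 > 0" "\<forall>k\<in>A. P k d2" by (metis insertCI)
  then show ?case
    by (intro exI[of _ "min d1 d2"]) (auto intro: assms(3))
qed (auto intro: exI[of _ 1])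

lemma Jm_Whitney:
  fixes f :: "real^'n::finite \<Rightarrow> complex"
  assumes f: "Ck m f" and X: "compact X"
  shows "Jm X m f \<in> Whitney X m"
  unfolding Whitney_def
proof (intro CollectI conjI allI impI)
  let ?d = "real CARD('n)"
  have d: "?d \<ge> 1" by (simp add: Suc_leI)
  show "continuous_on X (Jm X m f k)" if "mlen k \<le> m" for k
    using continuous_on_mpartial[OF f that, of X] that by (simp add: Jm_def cong:
        continuous_on_cong)
  fix k :: "'n \<Rightarrow> nat" and e :: real
  assume k: "mlen k \<le> m" and e: "e > 0"
  obtain r where r: "\<And>x. x \<in> X \<Longrightarrow> norm x \<le> r" using X compact_imp_bounded bounded_iff by metis
  \<comment> \<open>For two points of \<open>X\<close> at distance below 1, the estimate looks at
    points up to \<open>?d\<close> away from \<open>X\<close>; see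
    \<open>dist_le_cube\<close>.\<close>
  let ?K = "cball (0::real^'n) (r + ?d)"
  define M where "M = e / (1 + ?d) ^ m"
  have M: "M > 0" using e d by (simp add: M_def)
  have "\<exists>\<delta>>0. \<forall>k\<in>{k. mlen k \<le> m}. \<forall>x\<in>?K. \<forall>z\<in>?K. dist z x < \<delta> \<longrightarrow> norm (mpartial k f z - mpartial k f
      x) < M"
  proof (rule finite_common_delta[OF finite_mlen_le])
    fix k :: "'n \<Rightarrow> nat" assume "k \<in> {k. mlen k \<le> m}"
    then have "uniformly_continuous_on ?K (mpartial k f)"
      using f by (intro compact_uniformly_continuous continuous_on_mpartial) auto
    then show "\<exists>\<delta>>0. \<forall>x\<in>?K. \<forall>z\<in>?K. dist z x < \<delta> \<longrightarrow> norm (mpartial k f z - mpartial k f x) < M"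
      unfolding uniformly_continuous_on_def dist_norm using M by blast
  qed fastforce
  then obtain \<delta> where \<delta>: "\<delta> > 0" "\<And>k x z. mlen k \<le> m \<Longrightarrow> x \<in> ?K \<Longrightarrow> z \<in> ?K \<Longrightarrow> dist z x < \<delta> \<Longrightarrow>
      norm (mpartial k f z - mpartial k f x) < M" by blast
  show "\<exists>\<delta>>0. \<forall>x\<in>X. \<forall>y\<in>X. dist x y < \<delta> \<longrightarrow>
      norm (jet_rem m (Jm X m f) x k y) \<le> e * dist x y ^ (m - mlen k)"
  \<comment> \<open>The bound 1 keeps the points \<open>z\<close> inside \<open>?K\<close>; the
    bound \<open>\<delta> / ?d\<close> makes them closer than \<open>\<delta>\<close> to
    \<open>x\<close>.\<close>
  proof (intro exI[of _ "min 1 (\<delta> / ?d)"] conjI ballI impI)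
    show "min 1 (\<delta> / ?d) > 0" using \<delta> d by simp
    fix x y assume xy: "x \<in> X" "y \<in> X" "dist x y < min 1 (\<delta> / ?d)"
    have "norm (jet_rem m (Jm X m f) x k y) \<le> (1 + ?d) ^ m * M * dist x y ^ (m - mlen k)"
    proof (rule jet_rem_Jm[OF f xy(1,2) k])
      fix k :: "'n \<Rightarrow> nat" and z
      assume k: "mlen k = m" and z: "dist x z \<le> ?d * dist x y"
      have "?d * dist x y < \<delta>" "?d * dist x y \<le> ?d"
        using xy(3) d by (auto simp: field_simps intro: mult_left_le)
      then have "dist z x < \<delta>" "dist x z \<le> ?d"
        using z dist_commute[of z x] by linarith+
      moreover have "norm x \<le> r" using r xy by blast
      ultimately show "norm (mpartial k f z - mpartial k f x) \<le> M"
        using k d norm_triangle_ineq2[of z x]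
        by (intro less_imp_le[OF \<delta>(2)]) (auto simp: dist_norm norm_minus_commute)
    qed (use M in auto)
    then show "norm (jet_rem m (Jm X m f) x k y) \<le> e * dist x y ^ (m - mlen k)"
      using d by (simp add: M_def)
  qed
qed (auto simp: Jm_def)

section \<open>Whitney functions\<close>

lemma cscale_apply [simp]: "cscale c f x = cscale c (f x)"
  by (simp add: cscale_fun_def)

declare cscale_complex_def [simp]

lemma Whitney_zero: "F \<in> Whitney X m \<Longrightarrow> x \<notin> X \<or> mlen k > m \<Longrightarrow> F k x = 0"
  by (simp add: Whitney_def)

lemma tay_add: "tay m (F + G) x k y = tay m F x k y + tay m G x k y"
  by (simp add: tay_def distrib_left sum.distrib)

lemma tay_cscale: "tay m (cscale c F) x k y = c * tay m F x k y"
  by (simp add: tay_def sum_distrib_left mult.left_commute)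

lemma jet_rem_add: "jet_rem m (F + G) x k y = jet_rem m F x k y + jet_rem m G x k y"
  by (simp add: jet_rem_tay tay_add)

lemma jet_rem_cscale: "jet_rem m (cscale c F) x k y = c * jet_rem m F x k y"
  by (simp add: jet_rem_tay tay_cscale right_diff_distrib)

lemma Whitney_rem:
  assumes "F \<in> Whitney X m" "mlen k \<le> m" "e > 0"
  obtains \<delta> where "\<delta> > 0" "\<And>x y. x \<in> X \<Longrightarrow> y \<in> X \<Longrightarrow> dist x y < \<delta> \<Longrightarrow>
    norm (jet_rem m F x k y) \<le> e * dist x y ^ (m - mlen k)"
proof -
  have "\<forall>k. mlen k \<le> m \<longrightarrow> (\<forall>e>0. \<exists>\<delta>>0. \<forall>x\<in>X. \<forall>y\<in>X. dist x y < \<delta> \<longrightarrow>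
      norm (jet_rem m F x k y) \<le> e * dist x y ^ (m - mlen k))"
    using assms(1) unfolding Whitney_def by (elim CollectE conjE)
  then show thesis using assms(2,3) that by blast
qed

lemma Whitney_add:
  assumes "F \<in> Whitney X m" "G \<in> Whitney X m"
  shows "F + G \<in> Whitney X m"
  unfolding Whitney_def
proof (intro CollectI conjI allI impI)
  show "continuous_on X ((F + G) k)" if "mlen k \<le> m" for k
    using assms that by (simp add: Whitney_def plus_fun_def continuous_on_add)
  fix k :: "'a \<Rightarrow> nat" and e :: real
  assume k: "mlen k \<le> m" and e: "e > 0"
  from e have "e / 2 > 0" by simp
  obtain d1 where d1: "d1 > 0"
    "\<And>x y. x \<in> X \<Longrightarrow> y \<in> X \<Longrightarrow> dist x y < d1 \<Longrightarrow> norm (jet_rem m F x k y)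
        \<le> e / 2 * dist x y ^ (m - mlen k)"
    using Whitney_rem[OF assms(1) k \<open>e / 2 > 0\<close>] by blast
  obtain d2 where d2: "d2 > 0"
    "\<And>x y. x \<in> X \<Longrightarrow> y \<in> X \<Longrightarrow> dist x y < d2 \<Longrightarrow> norm (jet_rem m G x k y)
        \<le> e / 2 * dist x y ^ (m - mlen k)"
    using Whitney_rem[OF assms(2) k \<open>e / 2 > 0\<close>] by blast
  show "\<exists>\<delta>>0. \<forall>x\<in>X. \<forall>y\<in>X. dist x y < \<delta> \<longrightarrow> norm (jet_rem m (F + G) x k y)
      \<le> e * dist x y ^ (m - mlen k)"
  proof (intro exI[of _ "min d1 d2"] conjI ballI impI)
    fix x y assume xy: "x \<in> X" "y \<in> X" "dist x y < min d1 d2"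
    have "norm (jet_rem m (F + G) x k y) \<le> norm (jet_rem m F x k y) + norm (jet_rem m G x k y)"
      unfolding jet_rem_add by (rule norm_triangle_ineq)
    also have "\<dots> \<le> e / 2 * dist x y ^ (m - mlen k) + e / 2 * dist x y ^ (m - mlen k)"
      using xy d1(2) d2(2) by (intro add_mono) auto
    finally show "norm (jet_rem m (F + G) x k y) \<le> e * dist x y ^ (m - mlen k)" by simp
  qed (use d1 d2 in auto)
qed (use assms in \<open>auto simp: Whitney_zero\<close>)

lemma Whitney_cscale:
  assumes "F \<in> Whitney X m"
  shows "cscale c F \<in> Whitney X m"
  unfolding Whitney_def
proof (intro CollectI conjI allI impI)
  show "continuous_on X (cscale c F k)" if "mlen k \<le> m" for k
    using assms that continuous_on_mult_left[of X "F k" c]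
    by (simp add: Whitney_def cscale_fun_def)
  fix k :: "'a \<Rightarrow> nat" and e :: real
  assume k: "mlen k \<le> m" and e: "e > 0"
  define e' where "e' = e / (norm c + 1)"
  have "norm c + 1 > 0" by (simp add: add_nonneg_pos)
  then have e': "e' > 0" "norm c * e' \<le> e"
    using e by (auto simp: e'_def field_simps)
  obtain d where d: "d > 0"
    "\<And>x y. x \<in> X \<Longrightarrow> y \<in> X \<Longrightarrow> dist x y < d \<Longrightarrow> norm (jet_rem m F x k y) \<le> e' * dist x y ^ (m - mlen k)"
    using Whitney_rem[OF assms k e'(1)] by blast
  show "\<exists>\<delta>>0. \<forall>x\<in>X. \<forall>y\<in>X. dist x y < \<delta> \<longrightarrow> norm (jet_rem m (cscale c F) x k y)
      \<le> e * dist x y ^ (m - mlen k)"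
  proof (intro exI[of _ d] conjI ballI impI)
    fix x y assume xy: "x \<in> X" "y \<in> X" "dist x y < d"
    have "norm (jet_rem m (cscale c F) x k y) \<le> norm c * (e' * dist x y ^ (m - mlen k))"
      unfolding jet_rem_cscale norm_mult using xy d by (intro mult_left_mono) auto
    also have "\<dots> \<le> e * dist x y ^ (m - mlen k)"
      using e' by (simp add: mult_right_mono flip: mult.assoc)
    finally show "norm (jet_rem m (cscale c F) x k y) \<le> e * dist x y ^ (m - mlen k)" .
  qed (use d in auto)
qed (use assms in \<open>auto simp: Whitney_zero\<close>)

lemma Whitney_0: "0 \<in> Whitney X m"
  by (auto simp: Whitney_def zero_fun_def jet_rem_def intro: exI[of _ 1])

section \<open>Finiteness and estimates of the Whitney norm\<close>

definition jet_sup1 :: "(real^'n::finite) set \<Rightarrow> nat \<Rightarrow> (('n \<Rightarrow> nat) \<Rightarrow> real^'n \<Rightarrow> complex) \<Rightarrow> real" where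
  "jet_sup1 X m F = Sup (insert 0 {norm (F k x) | k x. x \<in> X \<and> mlen k \<le> m})"

definition jet_sup2 :: "(real^'n::finite) set \<Rightarrow> nat \<Rightarrow> (('n \<Rightarrow> nat) \<Rightarrow> real^'n \<Rightarrow> complex) \<Rightarrow> real" where
  "jet_sup2 X m F = Sup (insert 0 {norm (jet_rem m F x k y) / dist x y ^ (m - mlen k) | k x y.
                      x \<in> X \<and> y \<in> X \<and> x \<noteq> y \<and> mlen k \<le> m})"

lemma Whitney_norm_split: "Whitney_norm X m F = jet_sup1 X m F + jet_sup2 X m F"
  by (simp add: Whitney_norm_def jet_sup1_def jet_sup2_def)

lemma jet_bdd1:
  assumes "F \<in> Whitney X m" "compact X"
  shows "bdd_above (insert 0 {norm (F k x) | k x. x \<in> X \<and> mlen k \<le> m})"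
proof -
  have eq: "{norm (F k x) | k x. x \<in> X \<and> mlen k \<le> m} = (\<Union>k\<in>{k. mlen k \<le> m}. (\<lambda>x. norm (F k x)) ` X)"
    by auto
  have bd: "bdd_above ((\<lambda>x. norm (F k x)) ` X)" if "mlen k \<le> m" for k
    using assms that unfolding Whitney_def
    by (intro bounded_imp_bdd_above compact_imp_bounded compact_continuous_image continuous_on_norm)
        auto
  show ?thesis
    unfolding eq bdd_above_insert bdd_above_UN[OF finite_mlen_le]
    by (intro ballI) (drule CollectD, rule bd)
qed

text \<open>Close to the diagonal the Whitney condition with constant 1 bounds the quotient; away
  from it the remainder is continuous on the compact set \<open>X \<times> X\<close> and the
  denominator is at least \<open>\<delta> ^ (m - mlen k)\<close>.\<close>

lemma jet_bdd2:
  assumes F: "F \<in> Whitney X m" and X: "compact X"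
  shows "bdd_above (insert 0 {norm (jet_rem m F x k y) / dist x y ^ (m - mlen k) | k x y.
                      x \<in> X \<and> y \<in> X \<and> x \<noteq> y \<and> mlen k \<le> m})"
proof -
  let ?q = "\<lambda>k (x, y). norm (jet_rem m F x k y) / dist x y ^ (m - mlen k)"
  let ?P = "{p \<in> X \<times> X. fst p \<noteq> snd p}"
  have eq: "{norm (jet_rem m F x k y) / dist x y ^ (m - mlen k) | k x y.
      x \<in> X \<and> y \<in> X \<and> x \<noteq> y \<and> mlen k \<le> m} = (\<Union>k\<in>{k. mlen k \<le> m}. ?q k ` ?P)"
    by (auto simp: image_iff) blast+
  have bd: "bdd_above (?q k ` ?P)" if k: "mlen k \<le> m" for k
  proof -
    obtain \<delta> where \<delta>: "\<delta> > 0"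
      "\<And>x y. x \<in> X \<Longrightarrow> y \<in> X \<Longrightarrow> dist x y < \<delta> \<Longrightarrow> norm (jet_rem m F x k y) \<le> 1 * dist x y ^ (m - mlen k)"
      by (rule Whitney_rem[OF F k zero_less_one]) (rule that)
    have c: "continuous_on (X \<times> X) (\<lambda>p. F l (g p))"
      if "mlen l \<le> m" "g = fst \<or> g = snd" for l g
    proof (rule continuous_on_compose2[of X "F l" "X \<times> X" g])
      show "continuous_on X (F l)" using F that(1) by (simp add: Whitney_def)
    qed (use that(2) in \<open>auto intro: continuous_on_fst continuous_on_snd continuous_on_id\<close>)
    have "continuous_on (X \<times> X) (\<lambda>p. norm (jet_rem m F (fst p) k (snd p)))"
      unfolding jet_rem_tay tay_def
      using k by (intro continuous_intros c) (auto simp: mlen_add)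
    then have "bounded ((\<lambda>p. norm (jet_rem m F (fst p) k (snd p))) ` (X \<times> X))"
      using X by (intro compact_imp_bounded compact_continuous_image compact_Times)
    then obtain B where B: "\<And>x y. x \<in> X \<Longrightarrow> y \<in> X \<Longrightarrow> norm (jet_rem m F x k y) \<le> B"
      unfolding bounded_iff by fastforce
    have "norm (jet_rem m F x k y) / dist x y ^ (m - mlen k) \<le> max 1 (B / \<delta> ^ (m - mlen k))"
      if xy: "x \<in> X" "y \<in> X" "x \<noteq> y" for x y
    proof (cases "dist x y < \<delta>")
      case True
      then have "norm (jet_rem m F x k y) / dist x y ^ (m - mlen k) \<le> 1"
        using \<delta>(2)[of x y] xy by (simp add: divide_le_eq)
      then show ?thesis by (rule max.coboundedI1)
    next
      case False
      then have "norm (jet_rem m F x k y) / dist x y ^ (m - mlen k) \<le> B / \<delta> ^ (m - mlen k)"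
        using \<delta>(1) B[OF xy(1,2)] order_trans[OF norm_ge_zero B[OF xy(1,2)]]
        by (intro frac_le power_mono) auto
      then show ?thesis by simp
    qed
    then show ?thesis by (intro bdd_aboveI[of _ "max 1 (B / \<delta> ^ (m - mlen k))"]) auto
  qed
  show ?thesis
    unfolding eq bdd_above_insert bdd_above_UN[OF finite_mlen_le]
    by (intro ballI) (drule CollectD, rule bd)
qed

lemma jet_sup1_upper:
  "F \<in> Whitney X m \<Longrightarrow> compact X \<Longrightarrow> x \<in> X \<Longrightarrow> mlen k \<le> m \<Longrightarrow> norm (F k x) \<le> jet_sup1 X m F"
  unfolding jet_sup1_def by (rule cSup_upper[OF _ jet_bdd1]) auto

lemma jet_sup2_upper:
  assumes "F \<in> Whitney X m" "compact X" "x \<in> X" "y \<in> X" "mlen k \<le> m"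
  shows "norm (jet_rem m F x k y) \<le> jet_sup2 X m F * dist x y ^ (m - mlen k)"
proof (cases "x = y")
  case True
  \<comment> \<open>On the diagonal the remainder is 0, but the right-hand side can contain
    \<open>0 ^ 0 = 1\<close>.\<close>
  have "0 \<le> jet_sup2 X m F"
    unfolding jet_sup2_def by (rule cSup_upper[OF _ jet_bdd2[OF assms(1,2)]]) auto
  then show ?thesis using True by (simp add: jet_rem_tay tay_self)
next
  case False
  have "norm (jet_rem m F x k y) / dist x y ^ (m - mlen k) \<le> jet_sup2 X m F"
    unfolding jet_sup2_def by (rule cSup_upper[OF _ jet_bdd2[OF assms(1,2)]]) (use assms False in
        blast)
  then show ?thesis using False by (simp add: divide_le_eq)
qed

lemma jet_sup_nonneg:
  assumes "F \<in> Whitney X m" "compact X"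
  shows "0 \<le> jet_sup1 X m F" "0 \<le> jet_sup2 X m F"
  unfolding jet_sup1_def jet_sup2_def
  using assms by (auto intro!: cSup_upper jet_bdd1 jet_bdd2)

lemma Whitney_norm_upper:
  assumes "F \<in> Whitney X m" "compact X" "mlen k \<le> m"
  shows "x \<in> X \<Longrightarrow> norm (F k x) \<le> Whitney_norm X m F"
    and "x \<in> X \<Longrightarrow> y \<in> X \<Longrightarrow> norm (jet_rem m F x k y) \<le> Whitney_norm X m F * dist x y ^ (m - mlen k)"
proof -
  show "x \<in> X \<Longrightarrow> norm (F k x) \<le> Whitney_norm X m F"
    using jet_sup1_upper[of F X m x k] jet_sup_nonneg[of F X m] assms
    by (simp add: Whitney_norm_split)
  show "norm (jet_rem m F x k y) \<le> Whitney_norm X m F * dist x y ^ (m - mlen k)" if "x \<in> X" "y \<in> X"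
    using jet_sup2_upper[of F X m x y k] jet_sup_nonneg[of F X m] assms that
    by (simp add: Whitney_norm_split distrib_right add_increasing)
qed

lemma Whitney_norm_nonneg: "F \<in> Whitney X m \<Longrightarrow> compact X \<Longrightarrow> 0 \<le> Whitney_norm X m F"
  by (simp add: Whitney_norm_split jet_sup_nonneg)

lemma jet_sup1_least:
  assumes "\<And>k x. x \<in> X \<Longrightarrow> mlen k \<le> m \<Longrightarrow> norm (F k x) \<le> B" "0 \<le> B"
  shows "jet_sup1 X m F \<le> B"
  unfolding jet_sup1_def using assms by (intro cSup_least) auto

lemma jet_sup2_least:
  assumes "\<And>k x y. x \<in> X \<Longrightarrow> y \<in> X \<Longrightarrow> mlen k \<le> m \<Longrightarrow> norm (jet_rem m F x k y)
      \<le> B * dist x y ^ (m - mlen k)"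
    "0 \<le> B"
  shows "jet_sup2 X m F \<le> B"
  unfolding jet_sup2_def using assms by (intro cSup_least) (auto simp: divide_le_eq)

lemma Whitney_norm_0 [simp]: "Whitney_norm X m 0 = 0"
proof -
  have "insert (0::real) {norm ((0 :: ('a \<Rightarrow> nat) \<Rightarrow> real^'a \<Rightarrow> complex) k x) | k x. x \<in> X \<and>
      mlen k \<le> m} = {0}"
    "insert (0::real) {norm (jet_rem m (0 :: ('a \<Rightarrow> nat) \<Rightarrow> real^'a \<Rightarrow> complex) x k y) / dist x y ^ (m
        - mlen k) | k x y.
                      x \<in> X \<and> y \<in> X \<and> x \<noteq> y \<and> mlen k \<le> m} = {0}"
    by (auto simp: jet_rem_def)
  then show ?thesis by (simp only: Whitney_norm_def cSup_singleton)
qed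

lemma Whitney_norm_add:
  assumes "F \<in> Whitney X m" "G \<in> Whitney X m" "compact X"
  shows "Whitney_norm X m (F + G) \<le> Whitney_norm X m F + Whitney_norm X m G"
proof -
  have "jet_sup1 X m (F + G) \<le> jet_sup1 X m F + jet_sup1 X m G"
    using assms by (intro jet_sup1_least add_nonneg_nonneg jet_sup_nonneg)
      (auto intro!: order_trans[OF norm_triangle_ineq] add_mono jet_sup1_upper)
  moreover have "jet_sup2 X m (F + G) \<le> jet_sup2 X m F + jet_sup2 X m G"
    using assms by (intro jet_sup2_least add_nonneg_nonneg jet_sup_nonneg)
      (auto simp: jet_rem_add distrib_right intro!: order_trans[OF norm_triangle_ineq] add_mono
          jet_sup2_upper)
  ultimately show ?thesis by (simp add: Whitney_norm_split)
qed

lemma Jm_bounded: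
  fixes X :: "(real^'n::finite) set"
  assumes X: "compact X"
  obtains K C where "compact K" "C \<ge> 0"
    "\<And>f. Ck m f \<Longrightarrow> Whitney_norm X m (Jm X m f) \<le> C * snorm K m f"
proof -
  let ?d = "real CARD('n)"
  obtain r where r: "\<And>x. x \<in> X \<Longrightarrow> norm x \<le> r" using X compact_imp_bounded bounded_iff by metis
  \<comment> \<open>\<open>2 * r\<close> bounds the diameter of \<open>X\<close>, and the Taylor
    estimate reaches \<open>?d\<close> times as far.\<close>
  let ?K = "cball (0::real^'n) (r + ?d * (2 * r))"
  \<comment> \<open>The 1 is for the values of the jet; the 2 bounds the oscillation of a top
    derivative by twice its supremum.\<close>
  let ?C = "1 + (1 + ?d) ^ m * 2"
  have "Whitney_norm X m (Jm X m f) \<le> ?C * snorm ?K m f" if f: "Ck m f" for f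
  proof -
    have s0: "0 \<le> snorm ?K m f" using f by (intro snorm_nonneg) auto
    have up: "norm (mpartial k f z) \<le> snorm ?K m f" if "mlen k \<le> m" "z \<in> ?K" for k z
      using that f by (metis mpartial_ipartial_ex norm_ipartial_le_snorm order_refl compact_cball)
    have sub: "x \<in> ?K" if "x \<in> X" for x
      using r[OF that] order_trans[OF norm_ge_zero r[OF that]] by (simp add: add_increasing2)
    have "jet_sup1 X m (Jm X m f) \<le> snorm ?K m f"
      using s0 up sub by (intro jet_sup1_least) (auto simp: Jm_def)
    moreover have "jet_sup2 X m (Jm X m f) \<le> (1 + ?d) ^ m * (2 * snorm ?K m f)"
    proof (rule jet_sup2_least)
      fix k :: "'n \<Rightarrow> nat" and x y assume xy: "x \<in> X" "y \<in> X" "mlen k \<le> m"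
      show "norm (jet_rem m (Jm X m f) x k y) \<le> (1 + ?d) ^ m * (2 * snorm ?K m f) * dist x y ^ (m -
          mlen k)"
      proof (rule jet_rem_Jm[OF f xy])
        fix k :: "'n \<Rightarrow> nat" and z assume k: "mlen k = m" and z: "dist x z \<le> ?d * dist x y"
        have "dist x y \<le> 2 * r"
          using norm_triangle_ineq4[of x y] r[OF xy(1)] r[OF xy(2)] by (simp add: dist_norm)
        then have "dist x z \<le> ?d * (2 * r)"
          using z by (meson mult_left_mono of_nat_0_le_iff order_trans)
        then have "z \<in> ?K" using r[OF xy(1)] norm_triangle_ineq2[of z x]
          by (simp add: dist_norm norm_minus_commute)
        then show "norm (mpartial k f z - mpartial k f x) \<le> 2 * snorm ?K m f"
          using up[of k z] up[of k x] sub[OF xy(1)] k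
            norm_triangle_ineq4[of "mpartial k f z" "mpartial k f x"] by simp
      qed (use s0 in auto)
    qed (use s0 in auto)
    ultimately show ?thesis by (simp add: Whitney_norm_split algebra_simps)
  qed
  then show thesis by (intro that[of ?K ?C]) auto
qed

lemma mpartial_add:
  assumes "Ck m f" "Ck m g" "mlen k \<le> m"
  shows "mpartial k (f + g) x = mpartial k f x + mpartial k g x"
proof -
  obtain xs where "length xs = mlen k" "\<And>f. mpartial k f = ipartial xs f"
    using mpartial_ipartial_ex by metis
  then show ?thesis using assms by (simp add: plus_fun_def ipartial_add[of m])
qed

lemma mpartial_cscale:
  assumes "Ck m f" "mlen k \<le> m"
  shows "mpartial k (cscale c f) x = c * mpartial k f x"
proof -
  obtain xs where "length xs = mlen k" "\<And>f. mpartial k f = ipartial xs f"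
    using mpartial_ipartial_ex by metis
  then show ?thesis using assms by (simp add: cscale_fun_def ipartial_cmult[of m])
qed

lemma Jm_add: "Ck m f \<Longrightarrow> Ck m g \<Longrightarrow> Jm X m (f + g) = Jm X m f + Jm X m g"
  by (auto simp: Jm_def fun_eq_iff mpartial_add[of m])

lemma Jm_cscale: "Ck m f \<Longrightarrow> Jm X m (cscale c f) = cscale c (Jm X m f)"
  by (auto simp: Jm_def fun_eq_iff mpartial_cscale[of m])

section \<open>A lattice partition of unity\<close>

text \<open>One-dimensional smoothing: if \<open>G\<close> is an antiderivative of a step function then
  \<open>G t - G (t - 1)\<close> is a step function with one more derivative.\<close>

lemma step_function_aux:
  "\<exists>(D :: nat \<Rightarrow> real \<Rightarrow> real) N. N > 0 \<and> (\<forall>k<m. \<forall>t. (D k has_real_derivative D (Suc k) t) (at t)) \<and>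
     (\<forall>k\<le>m. continuous_on UNIV (D k)) \<and> (\<forall>t\<le>0. D 0 t = 0) \<and> (\<forall>t\<ge>N. D 0 t = 1)"
proof (induction m)
  case 0
  \<comment> \<open>A continuous ramp; for \<open>m = 0\<close> no derivative is claimed.\<close>
  show ?case
    by (intro exI[of _ "\<lambda>k t. max 0 (min 1 t)"] exI[of _ 1]) (auto intro!: continuous_intros)
next
  case (Suc m)
  then obtain D :: "nat \<Rightarrow> real \<Rightarrow> real" and N where N: "N > 0"
    and D: "\<And>k t. k < m \<Longrightarrow> (D k has_real_derivative D (Suc k) t) (at t)"
    and cont: "\<And>k. k \<le> m \<Longrightarrow> continuous_on UNIV (D k)"
    and D0: "\<And>t. t \<le> 0 \<Longrightarrow> D 0 t = 0" and D1: "\<And>t. t \<ge> N \<Longrightarrow> D 0 t = 1" by metis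
  have "\<exists>G. \<forall>x::real. -\<infinity> < ereal x \<longrightarrow> ereal x < \<infinity> \<longrightarrow> (G has_vector_derivative D 0 x) (at x)"
    using cont[of 0] by (intro einterval_antiderivative) (auto simp: continuous_on_eq_continuous_at)
  then obtain G where "\<And>x. (G has_vector_derivative D 0 x) (at x)" by auto
  then have G: "(G has_real_derivative D 0 x) (at x)" for x
    by (simp add: has_real_derivative_iff_has_vector_derivative)
  \<comment> \<open>Only order 0 is new: the first derivative is already a difference of values of
    \<open>D 0\<close>.\<close>
  define E where "E k t = (case k of 0 \<Rightarrow> G t - G (t - 1) | Suc k \<Rightarrow> D k t - D k (t - 1))" for k t
  have shift: "((\<lambda>t. f t - f (t - 1)) has_real_derivative f' t - f' (t - 1)) (at t)"
    if "\<And>t. (f has_real_derivative f' t) (at t)" for f f' :: "real \<Rightarrow> real" and t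
  proof -
    have "((\<lambda>t. f (t - 1)) has_real_derivative f' (t - 1) * 1) (at t)"
      using that by (rule DERIV_chain2) (auto intro!: derivative_eq_intros)
    then show ?thesis using that by (auto intro!: derivative_eq_intros)
  qed
  have "(E k has_real_derivative E (Suc k) t) (at t)" if "k < Suc m" for k t
    using shift[of G "D 0" t, OF G] shift[of "D (k - 1)" "D k" t] D[of "k - 1"] that
    by (cases k) (simp_all add: E_def[abs_def])
  moreover have "continuous_on UNIV (E k)" if "k \<le> Suc m" for k
  proof (cases k)
    case 0
    have "continuous_on UNIV G" using G by (meson DERIV_isCont continuous_at_imp_continuous_on)
    moreover have "continuous_on UNIV (\<lambda>t. G (t - 1))"
      by (rule continuous_on_compose2[OF calculation]) (auto intro!: continuous_intros)
    ultimately show ?thesis using 0 by (simp add: E_def[abs_def] continuous_on_diff)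
  next
    case (Suc l)
    have "continuous_on UNIV (\<lambda>t. D l (t - 1))"
      using cont[of l] Suc that by (intro continuous_on_compose2[OF cont[of l]])
          (auto intro!: continuous_intros)
    then show ?thesis using Suc that cont[of l] by (simp add: E_def[abs_def] continuous_on_diff)
  qed
  \<comment> \<open>\<open>E 0 t\<close> is a value of \<open>D 0\<close> strictly between
    \<open>t - 1\<close> and \<open>t\<close>, so it is 0 to the left of 0 and 1 beyond
    \<open>N + 1\<close>.\<close>
  moreover have mvt: "\<exists>z. t - 1 < z \<and> z < t \<and> E 0 t = D 0 z" for t
    using MVT2[of "t - 1" t G "D 0"] G by (auto simp: E_def)
  have "E 0 t = 0" if "t \<le> 0" for t using mvt[of t] D0 that by auto
  moreover have "E 0 t = 1" if "t \<ge> N + 1" for t using mvt[of t] D1 that by auto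
  ultimately show ?case using N
    by (intro exI[of _ E] exI[of _ "N + 1"]) auto
qed

lemma step_function:
  obtains D :: "nat \<Rightarrow> real \<Rightarrow> real"
  where "\<And>k t. k < m \<Longrightarrow> (D k has_real_derivative D (Suc k) t) (at t)"
    "\<And>k. k \<le> m \<Longrightarrow> continuous_on UNIV (D k)" "\<And>t. t \<le> 0 \<Longrightarrow> D 0 t = 0" "\<And>t. t \<ge> 1 \<Longrightarrow> D 0 t = 1"
proof -
  obtain D :: "nat \<Rightarrow> real \<Rightarrow> real" and N where N: "N > 0"
    and D: "\<And>k t. k < m \<Longrightarrow> (D k has_real_derivative D (Suc k) t) (at t)"
    and cont: "\<And>k. k \<le> m \<Longrightarrow> continuous_on UNIV (D k)"
    and D0: "\<And>t. t \<le> 0 \<Longrightarrow> D 0 t = 0" and D1: "\<And>t. t \<ge> N \<Longrightarrow> D 0 t = 1"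
    using step_function_aux[of m] by metis
  show thesis
  proof (rule that[of "\<lambda>k t. D k (N * t) * N ^ k"])
    show "((\<lambda>t. D k (N * t) * N ^ k) has_real_derivative D (Suc k) (N * t) * N ^ Suc k) (at t)"
      if "k < m" for k t
      by (auto intro!: derivative_eq_intros DERIV_chain2[OF D[OF that]])
    show "continuous_on UNIV (\<lambda>t. D k (N * t) * N ^ k)" if "k \<le> m" for k
      by (intro continuous_intros continuous_on_compose2[OF cont[OF that]]) auto
    show "D 0 (N * t) * N ^ 0 = 0" if "t \<le> 0" for t
      using D0 N that by (simp add: mult_nonneg_nonpos)
    show "D 0 (N * t) * N ^ 0 = 1" if "t \<ge> 1" for t
      using D1 N that by simp
  qed
qed

lemma Ck_coord:
  assumes D: "\<And>k t. k < m \<Longrightarrow> (D k has_real_derivative D (Suc k) t) (at t)"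
    and cont: "\<And>k. k \<le> m \<Longrightarrow> continuous_on UNIV (D k)"
  shows "n + k = m \<Longrightarrow> Ck n (\<lambda>x. of_real (D k (x $ i)))"
proof (induction n arbitrary: k)
  case 0
  then show ?case
    by (auto intro!: continuous_on_of_real continuous_on_compose2[OF cont] continuous_intros)
next
  case (Suc n)
  show ?case
  proof (rule Ck_SucI[where g = "\<lambda>j x. if j = i then of_real (D (Suc k) (x $ i)) else 0"])
    show "continuous_on UNIV (\<lambda>x. complex_of_real (D k (x $ i)))"
      using Suc.prems by (intro continuous_on_of_real continuous_on_compose2[OF cont]
          continuous_intros) auto
    show "Ck n (\<lambda>x. if j = i then complex_of_real (D (Suc k) (x $ i)) else 0)" for j
      using Suc by (cases "j = i") (simp_all add: Ck_const)
    fix j x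
    have "((\<lambda>t. D k (x $ i + t)) has_real_derivative D (Suc k) (x $ i + 0)) (at 0)"
      using Suc.prems by (simp add: DERIV_shift[of "D k", symmetric] add.commute D)
    then have "((\<lambda>t. complex_of_real (D k (x $ i + t))) has_vector_derivative of_real (D (Suc k) (x
        $ i))) (at 0)"
      by (intro bounded_linear.has_vector_derivative[OF bounded_linear_of_real])
        (simp add: has_real_derivative_iff_has_vector_derivative)
    then show "has_partial j (\<lambda>x. complex_of_real (D k (x $ i)))
        (if j = i then of_real (D (Suc k) (x $ i)) else 0) x"
      by (cases "j = i") (simp_all add: has_partial_def axis_def)
  qed
qed

definition lattice :: "('n::finite \<Rightarrow> int) \<Rightarrow> real^'n" where
  "lattice z = (\<chi> i. real_of_int (z i))"

lemma lattice_nth [simp]: "lattice z $ i = real_of_int (z i)"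
  by (simp add: lattice_def)

text \<open>The function \<open>h t = D 0 (t + 1) - D 0 t\<close> is supported in [-1, 1] and its
  integer translates telescope to 1; \<open>\<theta>\<close> is the product over the coordinates.
  The sum is asserted for every finite \<open>Z\<close> containing the nonzero translates, so that
  index sets attached to \<open>X\<close> can be inserted directly.\<close>

lemma lattice_partition_of_unity:
  obtains \<theta> :: "real^'n::finite \<Rightarrow> complex" where "Ck m \<theta>"
    "\<And>x. \<theta> x \<noteq> 0 \<Longrightarrow> norm x \<le> real CARD('n)"
    "\<And>x Z. finite Z \<Longrightarrow> {z. \<theta> (x - lattice z) \<noteq> 0} \<subseteq> Z \<Longrightarrow> (\<Sum>z\<in>Z. \<theta> (x - lattice z)) = 1"
proof -
  obtain D :: "nat \<Rightarrow> real \<Rightarrow> real" where D: "\<And>k t. k < m \<Longrightarrow> (D k has_real_derivative D (Suc k) t) (at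
      t)"
    "\<And>k. k \<le> m \<Longrightarrow> continuous_on UNIV (D k)" "\<And>t. t \<le> 0 \<Longrightarrow> D 0 t = 0" "\<And>t. t \<ge> 1 \<Longrightarrow> D 0 t = 1"
    using step_function[of m] by metis
  define h where "h t = D 0 (t + 1) - D 0 t" for t
  define \<theta> :: "real^'n \<Rightarrow> complex" where "\<theta> x = (\<Prod>i\<in>UNIV. of_real (h (x $ i)))" for x
  have h0: "-1 < t \<and> t < 1" if "h t \<noteq> 0" for t
    using that D(3)[of t] D(3)[of "t + 1"] D(4)[of t] D(4)[of "t + 1"] unfolding h_def
        by (smt (verit))
  have supp: "\<bar>x $ i\<bar> < 1" if "\<theta> x \<noteq> 0" for x i
    using that h0[of "x $ i"] by (auto simp: \<theta>_def)
  have "Ck m \<theta>"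
  proof -
    have c: "Ck m (\<lambda>x. complex_of_real (D 0 (x $ i)))" for i :: 'n
      by (rule Ck_coord[where D = D and k = 0, of m]) (auto intro: D(1,2))
    have "Ck m (\<lambda>x. complex_of_real (h (x $ i)))" for i :: 'n
      using Ck_diff[OF Ck_dilate[OF c[of i], of 1 "axis i 1"] c[of i]] by (simp add: h_def axis_def)
    then show ?thesis unfolding \<theta>_def[abs_def] by (intro Ck_prod)
  qed
  moreover have "norm x \<le> real CARD('n)" if "\<theta> x \<noteq> 0" for x
    using dist_le_cube[of x 0 1] supp[OF that] by (simp add: less_imp_le)
  moreover have "(\<Sum>z\<in>Z. \<theta> (x - lattice z)) = 1"
    if Z: "finite Z" "{z. \<theta> (x - lattice z) \<noteq> 0} \<subseteq> Z" for x Z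
  proof -
    \<comment> \<open>Only translates of \<open>h\<close> by these two integers can be nonzero at
      \<open>x $ i\<close>.\<close>
    let ?B = "\<lambda>i. {\<lfloor>x $ i\<rfloor>, \<lfloor>x $ i\<rfloor> + 1}"
    have "(\<Sum>n\<in>?B i. complex_of_real (h (x $ i - real_of_int n))) = 1" for i
    proof -
      have "D 0 (x $ i - real_of_int \<lfloor>x $ i\<rfloor> + 1) = 1" "D 0 (x $ i - (1 + real_of_int \<lfloor>x $ i\<rfloor>)) = 0"
        by (intro D; linarith)+
      then have "h (x $ i - real_of_int \<lfloor>x $ i\<rfloor>) + h (x $ i - (1 + real_of_int \<lfloor>x $ i\<rfloor>)) = 1"
        by (simp add: h_def algebra_simps)
      then show ?thesis by (simp add: add.commute flip: of_real_add)
    qed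
    then have "1 = (\<Prod>i\<in>UNIV. \<Sum>n\<in>?B i. complex_of_real (h (x $ i - real_of_int n)))" by simp
    also have "\<dots> = (\<Sum>z\<in>PiE UNIV ?B. \<theta> (x - lattice z))"
      unfolding \<theta>_def by (subst prod_sum_PiE) auto
    also have "\<dots> = (\<Sum>z\<in>{z. \<theta> (x - lattice z) \<noteq> 0}. \<theta> (x - lattice z))"
    proof (rule sum.mono_neutral_right)
      show "finite (PiE UNIV ?B)" by (intro finite_PiE) auto
      show "{z. \<theta> (x - lattice z) \<noteq> 0} \<subseteq> PiE UNIV ?B"
      proof
        fix z assume "z \<in> {z. \<theta> (x - lattice z) \<noteq> 0}"
        then have near: "\<bar>x $ i - z i\<bar> < 1" for i using supp[of "x - lattice z" i] by simp
        have "z i \<in> ?B i" for i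
        proof -
          have "real_of_int (\<lfloor>x $ i\<rfloor> - 1) < real_of_int (z i)" "real_of_int (z i) < real_of_int (\<lfloor>x
            $ i\<rfloor> + 2)"
            using near[of i] of_int_floor_le[of "x $ i"] real_of_int_floor_add_one_gt[of "x $ i"]
            unfolding of_int_add of_int_diff of_int_1 of_int_numeral abs_less_iff by linarith+
          then have "\<lfloor>x $ i\<rfloor> - 1 < z i" "z i < \<lfloor>x $ i\<rfloor> + 2"
            by (simp_all only: of_int_less_iff)
          then show ?thesis by force
        qed
        then show "z \<in> PiE UNIV ?B" by auto
      qed
    qed auto
    also have "\<dots> = (\<Sum>z\<in>Z. \<theta> (x - lattice z))"
      using Z by (intro sum.mono_neutral_left) auto
    finally show ?thesis by simp
  qed
  ultimately show thesis by (rule that)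
qed

lemma bounded_ipartial_of_support:
  assumes "Ck m f" "\<And>x. f x \<noteq> 0 \<Longrightarrow> norm x \<le> r"
  obtains B where "B \<ge> 0" "\<And>xs x. length xs \<le> m \<Longrightarrow> norm (ipartial xs f x) \<le> B"
proof
  show B0: "snorm (cball 0 r) m f \<ge> 0" using assms by (intro snorm_nonneg) auto
  fix xs :: "'a list" and x assume xs: "length xs \<le> m"
  show "norm (ipartial xs f x) \<le> snorm (cball 0 r) m f"
  proof (cases "x \<in> cball 0 r")
    case True
    then show ?thesis using assms xs by (intro norm_ipartial_le_snorm) auto
  next
    case False
    have "ipartial xs f x = ipartial xs (\<lambda>x. 0) x"
      using False assms(2) by (intro ipartial_cong_open[of "- cball 0 r"]) auto
    then show ?thesis using B0 by (simp add: ipartial_const)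
  qed
qed

text \<open>\<open>K\<close> does not depend on \<open>x\<close>; after rescaling it bounds, on
  every scale, the number of translates that overlap at a point.\<close>

lemma card_lattice_cube:
  obtains K :: nat where "\<And>x :: real^'n::finite. finite {z. \<forall>i. \<bar>x $ i - real_of_int (z i)\<bar> \<le> c}"
    "\<And>x :: real^'n. card {z. \<forall>i. \<bar>x $ i - real_of_int (z i)\<bar> \<le> c} \<le> K"
proof -
  let ?I = "\<lambda>x :: real^'n. \<lambda>i. {\<lceil>x $ i - c\<rceil>..\<lfloor>x $ i + c\<rfloor>}"
  let ?S = "\<lambda>x :: real^'n. {z. \<forall>i. \<bar>x $ i - real_of_int (z i)\<bar> \<le> c}"
  let ?K = "nat \<lfloor>2 * c + 1\<rfloor>"
  have sub: "?S x \<subseteq> PiE UNIV (?I x)" for x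
  proof
    fix z assume z: "z \<in> ?S x"
    have "\<lceil>x $ i - c\<rceil> \<le> z i" "z i \<le> \<lfloor>x $ i + c\<rfloor>" for i
      using z[simplified, rule_format, of i] by (simp_all add: ceiling_le_iff le_floor_iff
          abs_le_iff)
    then show "z \<in> PiE UNIV (?I x)" by auto
  qed
  have fin: "finite (PiE UNIV (?I x))" for x by (intro finite_PiE) auto
  have "card (?S x) \<le> ?K ^ CARD('n)" for x
  proof -
    have "card (?I x i) \<le> ?K" for i
    proof -
      have "real_of_int (\<lfloor>x $ i + c\<rfloor> - \<lceil>x $ i - c\<rceil> + 1) \<le> 2 * c + 1"
        using of_int_floor_le[of "x $ i + c"] le_of_int_ceiling[of "x $ i - c"]
        unfolding of_int_add of_int_diff of_int_1 by linarith
      then have "\<lfloor>x $ i + c\<rfloor> - \<lceil>x $ i - c\<rceil> + 1 \<le> \<lfloor>2 * c + 1\<rfloor>" by (simp add: le_floor_iff)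
      then show ?thesis by simp
    qed
    then have "(\<Prod>i\<in>UNIV. card (?I x i)) \<le> (\<Prod>i\<in>(UNIV::'n set). ?K)" by (intro prod_mono) auto
    then have "card (PiE UNIV (?I x)) \<le> ?K ^ CARD('n)" by (simp add: card_PiE)
    then show ?thesis using card_mono[OF fin sub, of x] by linarith
  qed
  then show thesis using finite_subset[OF sub fin] by (intro that) auto
qed

section \<open>Multi-scale approximation of a Whitney function\<close>

text \<open>\<open>A\<close> is the size of \<open>f\<close> and \<open>1 / s\<close> its length
  scale: every derivative costs a factor \<open>s\<close>. Products at a common scale keep this
  form, with an extra factor \<open>2 ^ n\<close> in the constant.\<close>

definition derivs_le :: "nat \<Rightarrow> real^'n::finite \<Rightarrow> (real^'n \<Rightarrow> complex) \<Rightarrow> real \<Rightarrow> real \<Rightarrow> bool" where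
  "derivs_le n x f A s \<longleftrightarrow> (\<forall>xs. length xs \<le> n \<longrightarrow> norm (ipartial xs f x) \<le> A * s ^ length xs)"

lemma derivs_le_nonneg: "derivs_le n x f A s \<Longrightarrow> 0 \<le> A"
  unfolding derivs_le_def using norm_ge_zero order_trans
  by (metis le0 list.size(3) mult.right_neutral power_0)

lemma derivs_le_mono:
  assumes "derivs_le n x f A s" "A \<le> A'" "0 \<le> s" "s \<le> s'"
  shows "derivs_le n x f A' s'"
  unfolding derivs_le_def
proof (intro allI impI)
  fix xs :: "'a list" assume "length xs \<le> n"
  then have "norm (ipartial xs f x) \<le> A * s ^ length xs" using assms(1) by (simp add: derivs_le_def)
  also have "\<dots> \<le> A' * s' ^ length xs"
    using assms derivs_le_nonneg[OF assms(1)] by (intro mult_mono power_mono) auto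
  finally show "norm (ipartial xs f x) \<le> A' * s' ^ length xs" .
qed

lemma derivs_le_add:
  assumes "Ck n f" "Ck n g" "derivs_le n x f A s" "derivs_le n x g B s"
  shows "derivs_le n x (\<lambda>x. f x + g x) (A + B) s"
  using assms unfolding derivs_le_def
  by (auto simp: ipartial_add[of n] distrib_right intro!: order_trans[OF norm_triangle_ineq]
      add_mono)

lemma derivs_le_diff:
  assumes "Ck n f" "Ck n g" "derivs_le n x f A s" "derivs_le n x g B s"
  shows "derivs_le n x (\<lambda>x. f x - g x) (A + B) s"
  using assms unfolding derivs_le_def
  by (auto simp: ipartial_diff[of n] distrib_right intro!: order_trans[OF norm_triangle_ineq4]
      add_mono)

lemma ipartial_snoc: "ipartial (xs @ [i]) f = ipartial xs (partial i f)"
  by (simp add: ipartial_append)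

lemma partial_mult:
  assumes "Ck (Suc n) f" "Ck (Suc n) g"
  shows "partial i (\<lambda>x. f x * g x) = (\<lambda>x. partial i f x * g x + f x * partial i g x)"
  using assms by (intro ext has_partial_imp_partial has_partial_mult Ck_Suc_has_partial)

text \<open>Each derivative splits a product into two products of the same shape, with one constant
  multiplied by \<open>s\<close>. Induction from the right peels off the innermost derivative, so
  that the hypothesis applies to \<open>partial i f\<close> and \<open>g\<close>.\<close>

lemma ipartial_mult_le:
  assumes "Ck (length xs) f" "Ck (length xs) g"
    "derivs_le (length xs) x f A s" "derivs_le (length xs) x g B s"
  shows "norm (ipartial xs (\<lambda>x. f x * g x) x) \<le> 2 ^ length xs * A * B * s ^ length xs"
  using assms
proof (induction xs arbitrary: f g A B rule: rev_induct)
  case Nil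
  then have "norm (f x) \<le> A" "norm (g x) \<le> B" by (auto simp: derivs_le_def)
  then show ?case using order_trans[OF norm_ge_zero, of "f x" A]
    by (simp add: norm_mult mult_mono)
next
  case (snoc i xs)
  let ?n = "length xs"
  have Ck: "Ck (Suc ?n) f" "Ck (Suc ?n) g" using snoc.prems by auto
  then have Ck': "Ck ?n f" "Ck ?n g" "Ck ?n (partial i f)" "Ck ?n (partial i g)"
    by (auto intro: Ck_SucD Ck_Suc_partial)
  have p: "derivs_le ?n x (partial i h) (C * s) s" "derivs_le ?n x h C s"
    if "derivs_le (length (xs @ [i])) x h C s" for h C
  proof -
    have *: "norm (ipartial ys h x) \<le> C * s ^ length ys" if "length ys \<le> Suc ?n" for ys
      using \<open>derivs_le (length (xs @ [i])) x h C s\<close> that by (simp add: derivs_le_def)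
    show "derivs_le ?n x (partial i h) (C * s) s"
      unfolding derivs_le_def
    proof (intro allI impI)
      fix ys :: "'a list" assume "length ys \<le> ?n"
      then show "norm (ipartial ys (partial i h) x) \<le> C * s * s ^ length ys"
        using *[of "ys @ [i]"] by (simp add: ipartial_snoc mult_ac)
    qed
    show "derivs_le ?n x h C s" using * by (simp add: derivs_le_def)
  qed
  have "ipartial (xs @ [i]) (\<lambda>x. f x * g x) x
     = ipartial xs (\<lambda>x. partial i f x * g x) x + ipartial xs (\<lambda>x. f x * partial i g x) x"
    using Ck Ck' by (simp add: ipartial_snoc partial_mult ipartial_add[of ?n] Ck_mult)
  moreover have "norm (ipartial xs (\<lambda>x. partial i f x * g x) x) \<le> 2 ^ ?n * (A * s) * B * s ^ ?n"
    using snoc.prems Ck' by (intro snoc.IH p) auto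
  moreover have "norm (ipartial xs (\<lambda>x. f x * partial i g x) x) \<le> 2 ^ ?n * A * (B * s) * s ^ ?n"
    using snoc.prems Ck' by (intro snoc.IH p) auto
  ultimately show ?case
    using norm_triangle_ineq[of "ipartial xs (\<lambda>x. partial i f x * g x) x" "ipartial xs (\<lambda>x. f x *
        partial i g x) x"]
    by (simp add: mult_ac)
qed

lemma derivs_le_mult:
  assumes "Ck n f" "Ck n g" "derivs_le n x f A s" "derivs_le n x g B s" "0 \<le> s"
  shows "derivs_le n x (\<lambda>x. f x * g x) (2 ^ n * A * B) s"
  unfolding derivs_le_def
proof (intro allI impI)
  fix xs :: "'a list" assume xs: "length xs \<le> n"
  have "norm (ipartial xs (\<lambda>x. f x * g x) x) \<le> 2 ^ length xs * A * B * s ^ length xs"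
    using assms xs by (intro ipartial_mult_le) (auto simp: derivs_le_def intro: Ck_mono)
  also have "\<dots> \<le> 2 ^ n * A * B * s ^ length xs"
    using xs assms derivs_le_nonneg[OF assms(3)] derivs_le_nonneg[OF assms(4)]
    by (intro mult_right_mono power_increasing) auto
  finally show "norm (ipartial xs (\<lambda>x. f x * g x) x) \<le> 2 ^ n * A * B * s ^ length xs" .
qed

text \<open>Collects the data produced by \<open>lattice_partition_of_unity\<close>,
  \<open>bounded_ipartial_of_support\<close> and \<open>card_lattice_cube\<close>; the constants
  \<open>B\<close> and \<open>K\<close> belong to scale 0 and are transported to scale
  \<open>j\<close> by dilation.\<close>

locale extension_setup =
  fixes X :: "(real^'n::finite) set" and m :: nat and \<theta> :: "real^'n \<Rightarrow> complex" and B d :: real and K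
      :: nat
  assumes d_def: "d = real CARD('n)" and compact_X: "compact X"
    and Ck_theta: "Ck m \<theta>"
    and theta_support: "\<theta> x \<noteq> 0 \<Longrightarrow> norm x \<le> d"
    and theta_sum: "finite Z \<Longrightarrow> {z. \<theta> (x - lattice z) \<noteq> 0} \<subseteq> Z \<Longrightarrow> (\<Sum>z\<in>Z. \<theta> (x - lattice z)) = 1"
    and theta_bound: "length xs \<le> m \<Longrightarrow> norm (ipartial xs \<theta> x) \<le> B"
    and finite_cube: "finite {z. \<forall>i. \<bar>x $ i - real_of_int (z i)\<bar> \<le> d}"
    and card_cube: "card {z. \<forall>i. \<bar>x $ i - real_of_int (z i)\<bar> \<le> d} \<le> K"
begin

definition s :: "nat \<Rightarrow> real" where "s j = (1 / 4) ^ j"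

definition cell :: "nat \<Rightarrow> ('n \<Rightarrow> int) \<Rightarrow> real^'n" where
  "cell j z = s j *\<^sub>R lattice z"

definition th :: "nat \<Rightarrow> ('n \<Rightarrow> int) \<Rightarrow> real^'n \<Rightarrow> complex" where
  "th j z x = \<theta> (4 ^ j *\<^sub>R x + (- lattice z))"

text \<open>A translate has support radius \<open>d * s j\<close>; with radius
  \<open>2 * d * s j\<close> all translates that are nonzero within \<open>d * s j\<close> of
  \<open>X\<close> are included.\<close>

definition Zs :: "nat \<Rightarrow> ('n \<Rightarrow> int) set" where
  "Zs j = {z. \<exists>a\<in>X. dist (cell j z) a \<le> 2 * d * s j}"

text \<open>Chosen without reference to a jet, which keeps \<open>local_tay\<close> linear in
  \<open>F\<close>; meaningful only for \<open>z \<in> Zs j\<close>.\<close>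

definition pt :: "nat \<Rightarrow> ('n \<Rightarrow> int) \<Rightarrow> real^'n" where
  "pt j z = (SOME a. a \<in> X \<and> dist (cell j z) a \<le> 2 * d * s j)"

definition chi :: "nat \<Rightarrow> real^'n \<Rightarrow> complex" where
  "chi j x = (\<Sum>z\<in>Zs j. th j z x)"

definition local_tay :: "nat \<Rightarrow> (('n \<Rightarrow> nat) \<Rightarrow> real^'n \<Rightarrow> complex) \<Rightarrow> real^'n \<Rightarrow> complex" where
  "local_tay j F x = (\<Sum>z\<in>Zs j. th j z x * tay m F (pt j z) 0 x)"

text \<open>\<open>chi j\<close> is 1 within distance \<open>d * s j\<close> of \<open>X\<close> and vanishes beyond \<open>3 * d * s j\<close>. The ratio 4
  of consecutive scales exceeds 3, so a step changes \<open>ext\<close> only where the previous cutoff is 1.\<close>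

primrec ext :: "nat \<Rightarrow> (('n \<Rightarrow> nat) \<Rightarrow> real^'n \<Rightarrow> complex) \<Rightarrow> real^'n \<Rightarrow> complex" where
  "ext 0 F = local_tay 0 F"
| "ext (Suc j) F = (\<lambda>x. (1 - chi (Suc j) x) * ext j F x + local_tay (Suc j) F x)"

section \<open>Cells and cutoffs at scale \<open>j\<close>\<close>

lemma d_ge1: "1 \<le> d" by (simp add: d_def Suc_leI)

lemma s_pos [simp]: "0 < s j" by (simp add: s_def)

lemma s_nonneg [simp]: "0 \<le> s j" by (simp add: s_def)

lemma s_Suc: "s j = 4 * s (Suc j)" by (simp add: s_def)

lemma s_inverse: "4 ^ j * s j = 1"
  by (simp add: s_def power_one_over)

lemma s_antimono: "i \<le> j \<Longrightarrow> s j \<le> s i"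
  unfolding s_def by (rule power_decreasing) auto

lemma B_nonneg: "0 \<le> B"
  by (rule order_trans[OF norm_ge_zero theta_bound[of "[]" 0]]) simp

lemma dist_cell: "norm (4 ^ j *\<^sub>R x + (- lattice z)) = 4 ^ j * dist x (cell j z)"
proof -
  have "4 ^ j *\<^sub>R x + (- lattice z) = 4 ^ j *\<^sub>R (x - cell j z)"
    by (simp add: cell_def scaleR_diff_right s_inverse)
  then show ?thesis by (simp add: dist_norm)
qed

lemma th_support: "th j z x \<noteq> 0 \<Longrightarrow> dist x (cell j z) \<le> d * s j"
proof -
  assume "th j z x \<noteq> 0"
  then have "4 ^ j * dist x (cell j z) \<le> d"
    using theta_support by (metis th_def dist_cell)
  then have "s j * (4 ^ j * dist x (cell j z)) \<le> s j * d" by (intro mult_left_mono) auto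
  then have "(4 ^ j * s j) * dist x (cell j z) \<le> d * s j" by (simp only: mult_ac)
  then show ?thesis by (simp add: s_inverse)
qed

lemma Zs_pt: "z \<in> Zs j \<Longrightarrow> pt j z \<in> X \<and> dist (cell j z) (pt j z) \<le> 2 * d * s j"
  unfolding Zs_def pt_def by (rule someI_ex) auto

lemma cell_cube:
  assumes "dist x (cell j z) \<le> c * s j"
  shows "\<bar>(4 ^ j *\<^sub>R x) $ i - real_of_int (z i)\<bar> \<le> c"
proof -
  have "\<bar>(4 ^ j *\<^sub>R x + (- lattice z)) $ i\<bar> \<le> 4 ^ j * dist x (cell j z)"
    using component_le_norm_cart[of "4 ^ j *\<^sub>R x + (- lattice z)" i] by (simp only: dist_cell)
  also have "\<dots> \<le> 4 ^ j * (c * s j)" using assms by (intro mult_left_mono) auto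
  finally show ?thesis using s_inverse[of j] by (simp add: mult_ac)
qed

lemma finite_near: "finite {z. dist x (cell j z) \<le> d * s j}"
  and card_near: "card {z. dist x (cell j z) \<le> d * s j} \<le> K"
proof -
  have sub: "{z. dist x (cell j z) \<le> d * s j} \<subseteq> {z. \<forall>i. \<bar>(4 ^ j *\<^sub>R x) $ i - real_of_int (z i)\<bar>
      \<le> d}"
    using cell_cube[of x j _ d] by auto
  show "finite {z. dist x (cell j z) \<le> d * s j}" using sub finite_cube by (rule finite_subset)
  show "card {z. dist x (cell j z) \<le> d * s j} \<le> K"
    using card_mono[OF finite_cube sub] card_cube by (rule order_trans)
qed

lemma finite_Zs: "finite (Zs j)"
proof -
  obtain r where r: "\<And>x. x \<in> X \<Longrightarrow> norm x \<le> r" using compact_X compact_imp_bounded bounded_iff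
      by metis
  obtain N :: nat where N: "r + 2 * d * s j \<le> real N * s j"
    using real_archimedian_rdiv_eq_0 reals_Archimedean3[OF s_pos[of j]] less_imp_le by metis
  have "Zs j \<subseteq> PiE UNIV (\<lambda>_. {- int N..int N})"
  proof
    fix z assume z: "z \<in> Zs j"
    have "dist 0 (cell j z) \<le> norm (pt j z) + dist (cell j z) (pt j z)"
      using norm_triangle_ineq2[of "cell j z" "pt j z"] by (simp add: dist_norm)
    also have "\<dots> \<le> real N * s j" using Zs_pt[OF z] r N by fastforce
    finally have "\<bar>real_of_int (z i)\<bar> \<le> real N" for i using cell_cube[of 0 j z "real N" i] by simp
    then have "z i \<in> {- int N..int N}" for i by (smt (verit, best) atLeastAtMost_iff of_int_le_iff
        of_int_of_nat_eq of_int_minus)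
    then show "z \<in> PiE UNIV (\<lambda>_. {- int N..int N})" by auto
  qed
  then show ?thesis by (rule finite_subset) (auto intro: finite_PiE)
qed

lemma Ck_th: "Ck m (th j z)"
  unfolding th_def[abs_def] by (intro Ck_dilate Ck_theta)

lemma derivs_le_th: "derivs_le m x (th j z) B (4 ^ j)"
  unfolding derivs_le_def th_def[abs_def]
proof (intro allI impI)
  fix xs :: "'n list" assume xs: "length xs \<le> m"
  have "norm (ipartial xs (\<lambda>x. \<theta> (4 ^ j *\<^sub>R x + (- lattice z))) x)
     = (4 ^ j) ^ length xs * norm (ipartial xs \<theta> (4 ^ j *\<^sub>R x + (- lattice z)))"
    unfolding ipartial_dilate[OF Ck_theta xs] by (simp add: norm_mult norm_power)
  also have "\<dots> \<le> (4 ^ j) ^ length xs * B" using theta_bound[OF xs] by (intro mult_left_mono) auto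
  finally show "norm (ipartial xs (\<lambda>x. \<theta> (4 ^ j *\<^sub>R x + (- lattice z))) x)
      \<le> B * (4 ^ j) ^ length xs"
    by (simp add: mult.commute)
qed

lemma th_far:
  assumes "dist x (cell j z) > d * s j"
  shows "ipartial xs (\<lambda>x. th j z x * g x) x = 0"
proof -
  have "ipartial xs (\<lambda>x. th j z x * g x) x = ipartial xs (\<lambda>x. 0) x"
  proof (rule ipartial_cong_open)
    show "open {x. d * s j < dist x (cell j z)}"
      by (intro open_Collect_less continuous_intros)
  qed (use assms th_support in force)+
  then show ?thesis by (simp add: ipartial_const)
qed

text \<open>Derivatives at \<open>x\<close> see only the translates whose cell lies within
  \<open>d * s j\<close> (\<open>th_far\<close>), at most \<open>K\<close> many, and the product
  rule bounds each. The constant does not depend on the scale.\<close>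

lemma derivs_le_local_sum:
  assumes Ck: "\<And>z. Ck m (g z)" and A: "0 \<le> A"
    and g: "\<And>z. z \<in> Zs j \<Longrightarrow> dist x (cell j z) \<le> d * s j \<Longrightarrow> derivs_le m x (g z) A (4 ^ j)"
  shows "derivs_le m x (\<lambda>x. \<Sum>z\<in>Zs j. th j z x * g z x) (real K * (2 ^ m * B * A)) (4 ^ j)"
  unfolding derivs_le_def
proof (intro allI impI)
  fix xs :: "'n list" assume xs: "length xs \<le> m"
  let ?N = "{z. dist x (cell j z) \<le> d * s j}" and ?b = "2 ^ m * B * A * (4 ^ j) ^ length xs"
  have b: "?b \<ge> 0" using A B_nonneg by simp
  have "ipartial xs (\<lambda>x. \<Sum>z\<in>Zs j. th j z x * g z x) x = (\<Sum>z\<in>Zs j. ipartial xs (\<lambda>x. th j z x * g z x)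
      x)"
    using xs Ck by (subst ipartial_sum[where n = m]) (auto intro: Ck_mult Ck_th)
  also have "\<dots> = (\<Sum>z\<in>Zs j \<inter> ?N. ipartial xs (\<lambda>x. th j z x * g z x) x)"
    by (rule sum.mono_neutral_right) (auto simp: finite_Zs intro: th_far)
  also have "norm \<dots> \<le> (\<Sum>z\<in>Zs j \<inter> ?N. norm (ipartial xs (\<lambda>x. th j z x * g z x) x))"
    by (rule norm_sum)
  also have "\<dots> \<le> (\<Sum>z\<in>Zs j \<inter> ?N. ?b)"
  proof (rule sum_mono)
    fix z assume "z \<in> Zs j \<inter> ?N"
    then have "derivs_le m x (\<lambda>x. th j z x * g z x) (2 ^ m * B * A) (4 ^ j)"
      using Ck g by (intro derivs_le_mult Ck_th derivs_le_th) auto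
    then show "norm (ipartial xs (\<lambda>x. th j z x * g z x) x) \<le> ?b"
      using xs by (simp add: derivs_le_def)
  qed
  also have "\<dots> = real (card (Zs j \<inter> ?N)) * ?b" by simp
  also have "\<dots> \<le> real K * ?b"
  proof -
    have "card (Zs j \<inter> ?N) \<le> K"
      using card_mono[OF finite_near[of x j], of "Zs j \<inter> ?N"] card_near[of x j] by auto
    then show ?thesis using b by (intro mult_right_mono) auto
  qed
  finally show "norm (ipartial xs (\<lambda>x. \<Sum>z\<in>Zs j. th j z x * g z x) x)
      \<le> real K * (2 ^ m * B * A) * (4 ^ j) ^ length xs"
    by (simp add: mult.assoc)
qed

text \<open>The constant of \<open>derivs_le_local_sum\<close> for \<open>A = 1\<close>; it bounds
  the cutoff \<open>chi j\<close>.\<close>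

definition C\<chi> :: real where "C\<chi> = real K * (2 ^ m * B)"

lemma C\<chi>_nonneg: "C\<chi> \<ge> 0" using B_nonneg by (simp add: C\<chi>_def)

lemma Ck_chi: "Ck m (chi j)"
  unfolding chi_def[abs_def] by (intro Ck_sum Ck_th)

lemma derivs_le_const: "norm c \<le> A \<Longrightarrow> t \<ge> 0 \<Longrightarrow> derivs_le n x (\<lambda>x. c) A t"
  using norm_ge_zero[of c] by (auto simp: derivs_le_def ipartial_const simp del: norm_ge_zero)

lemma derivs_le_chi: "derivs_le m x (chi j) C\<chi> (4 ^ j)"
  using derivs_le_local_sum[of "\<lambda>z x. 1" 1 j x]
  by (simp add: chi_def[abs_def] C\<chi>_def Ck_const derivs_le_const)

lemma chi_one:
  assumes "b \<in> X" "dist x b \<le> d * s j"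
  shows "chi j x = 1"
proof -
  have "{z. \<theta> (4 ^ j *\<^sub>R x - lattice z) \<noteq> 0} \<subseteq> Zs j"
  proof
    fix z assume "z \<in> {z. \<theta> (4 ^ j *\<^sub>R x - lattice z) \<noteq> 0}"
    then have "dist x (cell j z) \<le> d * s j" by (intro th_support) (simp add: th_def)
    then have "dist (cell j z) b \<le> 2 * d * s j"
      using assms(2) dist_triangle[of "cell j z" b x] by (simp add: dist_commute)
    then show "z \<in> Zs j" using assms(1) by (auto simp: Zs_def)
  qed
  from theta_sum[OF finite_Zs this] show ?thesis by (simp add: chi_def th_def)
qed

text \<open>Separates the two uses of a Whitney function: \<open>M\<close> may be the Whitney norm
  with any \<open>t\<close>, or as small as desired if \<open>t\<close> is small. Vanishing beyond
  order \<open>m\<close> is what the differentiation of \<open>tay\<close> uses.\<close>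

definition modulus :: "(('n \<Rightarrow> nat) \<Rightarrow> real^'n \<Rightarrow> complex) \<Rightarrow> real \<Rightarrow> real \<Rightarrow> bool" where
  "modulus F M t \<longleftrightarrow> M \<ge> 0 \<and> (\<forall>k x. mlen k > m \<longrightarrow> F k x = 0) \<and>
     (\<forall>a\<in>X. \<forall>b\<in>X. \<forall>k. dist a b \<le> t \<longrightarrow> mlen k \<le> m \<longrightarrow> norm (jet_rem m F a k b)
         \<le> M * dist a b ^ (m - mlen k))"

lemma modulus_mono: "modulus F M t \<Longrightarrow> t' \<le> t \<Longrightarrow> modulus F M t'"
  unfolding modulus_def by (meson order_trans)

text \<open>\<open>C\<chi>\<close> sums over the cells, \<open>(1 + d) ^ m\<close> comes from
  \<open>descent\<close>, and \<open>(7 * d) ^ m\<close> from the radius \<open>7 * d * s j\<close>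
  of the cube.\<close>

definition C1 :: real where "C1 = C\<chi> * ((1 + d) ^ m * (7 * d) ^ m)"

lemma C1_nonneg: "C1 \<ge> 0" using C\<chi>_nonneg d_ge1 by (simp add: C1_def)

text \<open>\<open>tay_diff_bound\<close> gives \<open>s j ^ (m - k)\<close> for order
  \<open>k\<close>; since \<open>4 ^ j * s j = 1\<close> this is \<open>s j ^ m\<close> with a loss
  of \<open>4 ^ j\<close> per derivative, the form in which a cutoff of scale \<open>j\<close> can
  be multiplied on.\<close>

lemma derivs_le_tay_diff:
  assumes F: "modulus F M (7 * d * s j)" and ab: "a \<in> X" "b \<in> X" "dist a b \<le> 7 * d * s j"
    and x: "dist x b \<le> 4 * d * s j"
  shows "derivs_le m x (\<lambda>x. tay m F a 0 x - tay m F b 0 x) ((1 + d) ^ m * (7 * d) ^ m * M * s j ^ m)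
      (4 ^ j)"
  unfolding derivs_le_def
proof (intro allI impI)
  fix xs :: "'n list" assume xs: "length xs \<le> m"
  have M: "M \<ge> 0" and F0: "\<And>k x. mlen k > m \<Longrightarrow> F k x = 0" using F by (auto simp: modulus_def)
  let ?k = "count_list xs" and ?\<rho> = "7 * d * s j"
  have len: "mlen ?k = length xs" by (rule mlen_count_list)
  have "ipartial xs (\<lambda>x. tay m F a 0 x - tay m F b 0 x) x = tay m F a ?k x - tay m F b ?k x"
    using xs Ck_ipartial_tay(1)[of m F a m 0] Ck_ipartial_tay(1)[of m F b m 0]
      Ck_ipartial_tay(2)[of m F a xs 0] Ck_ipartial_tay(2)[of m F b xs 0] F0
    by (simp add: ipartial_diff[of m])
  also have "norm \<dots> \<le> (1 + d) ^ m * M * ?\<rho> ^ (m - mlen ?k)"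
  proof (rule tay_diff_bound[where ?'n = 'n, folded d_def])
    fix k :: "'n \<Rightarrow> nat" assume k: "mlen k \<le> m"
    have "norm (jet_rem m F a k b) \<le> M * dist a b ^ (m - mlen k)"
      using F ab k by (simp add: modulus_def)
    also have "\<dots> \<le> M * ?\<rho> ^ (m - mlen k)" using ab M by (intro mult_left_mono power_mono) auto
    finally show "norm (jet_rem m F a k b) \<le> M * ?\<rho> ^ (m - mlen k)" .
  next
    fix i
    have "\<bar>x $ i - b $ i\<bar> \<le> dist b x" by (rule cube_dist)
    also have "\<dots> \<le> 4 * d * s j" using x by (simp add: dist_commute)
    also have "\<dots> \<le> ?\<rho>" using d_ge1 by (intro mult_right_mono) auto
    finally show "\<bar>x $ i - b $ i\<bar> \<le> ?\<rho>" .
  qed (use F0 M xs len in auto)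
  also have "\<dots> \<le> (1 + d) ^ m * M * ((7 * d) ^ m * (s j ^ m * (4 ^ j) ^ length xs))"
  proof -
    have "?\<rho> ^ (m - mlen ?k) = (7 * d) ^ (m - length xs) * (s j ^ (m - length xs))"
      by (simp add: power_mult_distrib len)
    also have "s j ^ (m - length xs) = s j ^ m * (4 ^ j) ^ length xs"
    proof -
      have "s j ^ m * (4 ^ j) ^ length xs = s j ^ (m - length xs) * (s j ^ length xs * (4 ^ j) ^
          length xs)"
        using xs by (simp flip: power_add mult.assoc)
      also have "s j ^ length xs * (4 ^ j) ^ length xs = 1"
        using s_inverse[of j] by (simp add: mult.commute flip: power_mult_distrib)
      finally show ?thesis by simp
    qed
    also have "(7 * d) ^ (m - length xs) * (s j ^ m * (4 ^ j) ^ length xs)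
        \<le> (7 * d) ^ m * (s j ^ m * (4 ^ j) ^ length xs)"
      using d_ge1 by (intro mult_right_mono power_increasing) auto
    finally show ?thesis using M d_ge1 by (intro mult_left_mono) auto
  qed
  finally show "norm (ipartial xs (\<lambda>x. tay m F a 0 x - tay m F b 0 x) x)
      \<le> (1 + d) ^ m * (7 * d) ^ m * M * s j ^ m * (4 ^ j) ^ length xs"
    by (simp add: mult_ac)
qed

lemma modulus_zero: "modulus F M t \<Longrightarrow> mlen k > m \<Longrightarrow> F k x = 0"
  by (simp add: modulus_def)

lemma Ck_tay: "modulus F M t \<Longrightarrow> Ck n (tay m F a k)"
  by (rule Ck_ipartial_tay(1)) (rule modulus_zero)

text \<open>The expression is the sum of \<open>th j z\<close> times the difference of the Taylor
  polynomials at \<open>pt j z\<close> and \<open>b\<close>. The radius \<open>4 * d * s j\<close>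
  allows \<open>b\<close> to be a point chosen for the previous, coarser scale.\<close>

lemma derivs_le_local_tay:
  assumes F: "modulus F M (7 * d * s j)" and b: "b \<in> X" "dist x b \<le> 4 * d * s j"
  shows "derivs_le m x (\<lambda>x. local_tay j F x - chi j x * tay m F b 0 x) (C1 * M * s j ^ m) (4 ^ j)"
proof -
  let ?A = "(1 + d) ^ m * (7 * d) ^ m * M * s j ^ m"
  have M: "M \<ge> 0" using F by (simp add: modulus_def)
  have "derivs_le m x (\<lambda>x. \<Sum>z\<in>Zs j. th j z x * (tay m F (pt j z) 0 x - tay m F b 0 x))
      (real K * (2 ^ m * B * ?A)) (4 ^ j)"
  proof (rule derivs_le_local_sum)
    fix z assume z: "z \<in> Zs j" "dist x (cell j z) \<le> d * s j"
    \<comment> \<open>The three distances are at most \<open>2 * d * s j\<close>,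
      \<open>d * s j\<close> and \<open>4 * d * s j\<close>; hence the 7.\<close>
    have "dist (pt j z) b \<le> dist (cell j z) (pt j z) + dist x (cell j z) + dist x b"
      using dist_triangle[of "pt j z" b "cell j z"] dist_triangle[of "cell j z" b x]
      by (simp add: dist_commute)
    also have "\<dots> \<le> 7 * d * s j" using Zs_pt[OF z(1)] z(2) b(2) by linarith
    finally show "derivs_le m x (\<lambda>x. tay m F (pt j z) 0 x - tay m F b 0 x) ?A (4 ^ j)"
      using Zs_pt[OF z(1)] b by (intro derivs_le_tay_diff[OF F]) auto
  qed (use M d_ge1 in \<open>auto intro!: Ck_diff Ck_tay[OF F]\<close>)
  moreover have "(\<lambda>x. \<Sum>z\<in>Zs j. th j z x * (tay m F (pt j z) 0 x - tay m F b 0 x))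
      = (\<lambda>x. local_tay j F x - chi j x * tay m F b 0 x)"
    by (simp add: local_tay_def chi_def right_diff_distrib sum_subtractf sum_distrib_right)
  ultimately show ?thesis by (simp add: C1_def C\<chi>_def mult_ac)
qed

lemma Ck_local_tay: "modulus F M t \<Longrightarrow> Ck m (local_tay j F)"
  unfolding local_tay_def[abs_def] by (intro Ck_sum Ck_mult Ck_th Ck_tay)

lemma Ck_ext: "modulus F M t \<Longrightarrow> Ck m (ext j F)"
  by (induction j) (auto intro!: Ck_add Ck_mult Ck_diff Ck_const Ck_chi Ck_local_tay)

lemma ext_near:
  assumes "b \<in> X" "dist x b \<le> d * s j"
  shows "ext j F x = local_tay j F x"
  using chi_one[OF assms] by (cases j) auto

text \<open>Points changed at scale \<open>Suc j\<close> lie within \<open>3 * d * s (Suc j)\<close>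
  of \<open>X\<close>. The open ball of radius \<open>d * s (Suc j)\<close> about \<open>x\<close>
  reaches none of them, because \<open>4 * d * s (Suc j) = d * s j\<close>.\<close>

lemma ext_far:
  assumes far: "\<And>b. b \<in> X \<Longrightarrow> d * s j \<le> dist x b"
  shows "ipartial xs (ext (Suc j) F) x = ipartial xs (ext j F) x"
proof (rule ipartial_cong_open)
  show "open (ball x (d * s (Suc j)))" by simp
  show "x \<in> ball x (d * s (Suc j))" using d_ge1 by simp
  fix y assume y: "y \<in> ball x (d * s (Suc j))"
  have "th (Suc j) z y = 0" if z: "z \<in> Zs (Suc j)" for z
  proof (rule ccontr)
    assume "th (Suc j) z y \<noteq> 0"
    then have "dist y (cell (Suc j) z) \<le> d * s (Suc j)" by (rule th_support)
    moreover have "dist (cell (Suc j) z) (pt (Suc j) z) \<le> 2 * d * s (Suc j)" using Zs_pt[OF z]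
        by blast
    moreover have "dist x y < d * s (Suc j)" using y by simp
    moreover have "dist x (pt (Suc j) z) \<le> dist x y + dist y (cell (Suc j) z) + dist (cell (Suc j)
        z) (pt (Suc j) z)"
      using dist_triangle[of x "pt (Suc j) z" y] dist_triangle[of y "pt (Suc j) z" "cell (Suc j) z"]
          by simp
    moreover have "d * s j = 4 * (d * s (Suc j))" using s_Suc[of j] by simp
    moreover have "d * s j \<le> dist x (pt (Suc j) z)" using far Zs_pt[OF z] by blast
    ultimately show False by linarith
  qed
  then have "chi (Suc j) y = 0" "local_tay (Suc j) F y = 0" by (simp_all add: chi_def local_tay_def)
  then show "ext (Suc j) F y = ext j F y" by simp
qed

text \<open>The strict inequality provides an open ball about \<open>b\<close> that contains
  \<open>x\<close> and on which the cutoff is 1; there \<open>ext j\<close> forgets all earlier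
  scales.\<close>

lemma derivs_le_ext:
  assumes F: "modulus F M (7 * d * s j)" and b: "b \<in> X" "dist x b < d * s j"
  shows "derivs_le m x (\<lambda>x. ext j F x - tay m F b 0 x) (C1 * M * s j ^ m) (4 ^ j)"
proof -
  have "d * s j \<le> 4 * d * s j" using d_ge1 mult_right_mono[of d "4 * d" "s j"] by simp
  then have "dist x b \<le> 4 * d * s j" using b by linarith
  moreover have "ipartial xs (\<lambda>x. ext j F x - tay m F b 0 x) x
     = ipartial xs (\<lambda>x. local_tay j F x - chi j x * tay m F b 0 x) x" for xs
  proof (rule ipartial_cong_open)
    show "open (ball b (d * s j))" by simp
    show "x \<in> ball b (d * s j)" using b by (simp add: dist_commute)
    fix y assume "y \<in> ball b (d * s j)"
    then have "dist y b \<le> d * s j" by (simp add: dist_commute)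
    then show "ext j F y - tay m F b 0 y = local_tay j F y - chi j y * tay m F b 0 y"
      using ext_near[OF b(1)] chi_one[OF b(1)] by simp
  qed
  ultimately show ?thesis using derivs_le_local_tay[OF F b(1)] by (simp add: derivs_le_def)
qed

text \<open>\<open>1 + C\<chi>\<close> bounds \<open>1 - chi (Suc j)\<close> and
  \<open>2 ^ m\<close> is the product rule; the separate \<open>C1\<close> is the new local sum, and
  \<open>4 ^ m\<close> arises because \<open>s j ^ m\<close> meets derivatives at scale
  \<open>4 ^ Suc j\<close>.\<close>

definition C2 :: real where "C2 = (2 ^ m * (1 + C\<chi>) * C1 + C1) * 4 ^ m"

lemma C2_nonneg: "C2 \<ge> 0" using C1_nonneg C\<chi>_nonneg by (simp add: C2_def)

lemma scale_le: "n \<le> m \<Longrightarrow> s j ^ m * (4 ^ j) ^ n \<le> 1"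
proof -
  assume "n \<le> m"
  have "s j ^ m * (4 ^ j) ^ n \<le> s j ^ m * (4 ^ j) ^ m"
    using \<open>n \<le> m\<close> by (intro mult_left_mono power_increasing) auto
  also have "\<dots> = 1" using s_inverse[of j] by (simp add: mult.commute flip: power_mult_distrib)
  finally show ?thesis .
qed

text \<open>One step of the interpolation: with the polynomial at \<open>b\<close> subtracted, both
  ingredients are small, and two consecutive scales are compared with the same polynomial.\<close>

lemma ext_tay_bound:
  assumes F: "modulus F M (7 * d * s j)" and b: "b \<in> X" "dist x b < d * s j" and xs: "length xs \<le> m"
  shows "norm (ipartial xs (\<lambda>x. ext j F x - tay m F b 0 x) x) \<le> C2 * M"
    and "norm (ipartial xs (\<lambda>x. ext (Suc j) F x - tay m F b 0 x) x) \<le> C2 * M"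
proof -
  have M: "M \<ge> 0" using F by (simp add: modulus_def)
  let ?E = "2 ^ m * (1 + C\<chi>) * (C1 * M * s j ^ m) + C1 * M * s j ^ m"
  have E: "?E = (2 ^ m * (1 + C\<chi>) * C1 + C1) * M * s j ^ m" by (simp add: algebra_simps)
  have b': "dist x b \<le> 4 * d * s (Suc j)" using b s_Suc[of j] by simp
  have F': "modulus F M (7 * d * s (Suc j))" using d_ge1 by (intro modulus_mono[OF F] mult_left_mono
      s_antimono) auto
  have 1: "derivs_le m x (\<lambda>x. ext j F x - tay m F b 0 x) (C1 * M * s j ^ m) (4 ^ Suc j)"
    by (rule derivs_le_mono[OF derivs_le_ext[OF F b]]) auto
  have 2: "derivs_le m x (\<lambda>x. local_tay (Suc j) F x - chi (Suc j) x * tay m F b 0 x) (C1 * M * s j ^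
      m) (4 ^ Suc j)"
    using M C1_nonneg
    by (intro derivs_le_mono[OF derivs_le_local_tay[OF F' b(1) b']] mult_left_mono power_mono
        s_antimono) auto
  have 3: "derivs_le m x (\<lambda>x. 1 - chi (Suc j) x) (1 + C\<chi>) (4 ^ Suc j)"
    by (intro derivs_le_diff Ck_const Ck_chi derivs_le_const derivs_le_chi) auto
  have "derivs_le m x (\<lambda>x. (1 - chi (Suc j) x) * (ext j F x - tay m F b 0 x)
      + (local_tay (Suc j) F x - chi (Suc j) x * tay m F b 0 x)) ?E (4 ^ Suc j)"
    by (intro derivs_le_add derivs_le_mult 1 2 3 Ck_mult Ck_diff Ck_const Ck_chi
        Ck_ext[OF F] Ck_tay[OF F] Ck_local_tay[OF F]) auto
  \<comment> \<open>The weights \<open>1 - chi (Suc j) x\<close> and \<open>chi (Suc j) x\<close> on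
    the subtracted polynomial add up to 1.\<close>
  moreover have "(\<lambda>x. (1 - chi (Suc j) x) * (ext j F x - tay m F b 0 x)
      + (local_tay (Suc j) F x - chi (Suc j) x * tay m F b 0 x))
      = (\<lambda>x. ext (Suc j) F x - tay m F b 0 x)"
    by (simp add: algebra_simps)
  ultimately have 4: "derivs_le m x (\<lambda>x. ext (Suc j) F x - tay m F b 0 x) ?E (4 ^ Suc j)" by simp
  have "C1 * M * s j ^ m \<le> ?E"
    using M C1_nonneg C\<chi>_nonneg by simp
  then have 5: "derivs_le m x (\<lambda>x. ext j F x - tay m F b 0 x) ?E (4 ^ Suc j)"
    by (intro derivs_le_mono[OF 1]) auto
  have "?E * (4 ^ Suc j) ^ length xs \<le> C2 * M"
  proof -
    have "s j ^ m * (4 ^ Suc j) ^ length xs = 4 ^ length xs * (s j ^ m * (4 ^ j) ^ length xs)"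
      by (simp add: power_mult_distrib)
    also have "\<dots> \<le> 4 ^ m * 1"
      using xs scale_le[OF xs, of j] by (intro mult_mono power_increasing) auto
    finally have "(2 ^ m * (1 + C\<chi>) * C1 + C1) * M * (s j ^ m * (4 ^ Suc j) ^ length xs)
        \<le> (2 ^ m * (1 + C\<chi>) * C1 + C1) * M * (4 ^ m * 1)"
      using M C1_nonneg C\<chi>_nonneg by (intro mult_left_mono) auto
    then show ?thesis unfolding E C2_def by (simp only: mult_ac mult_1_right)
  qed
  then show "norm (ipartial xs (\<lambda>x. ext j F x - tay m F b 0 x) x) \<le> C2 * M"
    "norm (ipartial xs (\<lambda>x. ext (Suc j) F x - tay m F b 0 x) x) \<le> C2 * M"
    using 4 5 xs unfolding derivs_le_def by (meson order_trans)+
qed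

lemma ext_stable:
  assumes "\<And>b. b \<in> X \<Longrightarrow> d * s i \<le> dist x b" "i \<le> j"
  shows "ipartial xs (ext j F) x = ipartial xs (ext i F) x"
  using assms(2)
proof (induction j rule: dec_induct)
  case (step n)
  have "s n \<le> s i" using step by (intro s_antimono) auto
  then have "d * s n \<le> d * s i" using d_ge1 by (intro mult_left_mono) auto
  then have "ipartial xs (ext (Suc n) F) x = ipartial xs (ext n F) x"
    using assms(1) by (intro ext_far) (meson order_trans)
  then show ?case using step by simp
qed simp

text \<open>The bound must not grow with the number of steps. At \<open>x\<close> both functions are
  compared with one Taylor polynomial, at a point \<open>b\<close> chosen for the last scale
  \<open>p \<le> j\<close> at which \<open>x\<close> is still near \<open>X\<close>.\<close>

lemma ext_Cauchy:
  assumes F: "modulus F M (7 * d * s i)" and ij: "i \<le> j" and xs: "length xs \<le> m"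
  shows "norm (ipartial xs (ext j F) x - ipartial xs (ext i F) x) \<le> 2 * C2 * M"
proof (cases "\<exists>b\<in>X. dist x b < d * s i")
  case False
  then have "ipartial xs (ext j F) x = ipartial xs (ext i F) x"
    using ij by (intro ext_stable) (auto simp: not_less)
  moreover have "M \<ge> 0" using F by (simp add: modulus_def)
  ultimately show ?thesis using C2_nonneg by simp
next
  case True
  define P where "P p \<longleftrightarrow> p \<le> j \<and> (\<exists>b\<in>X. dist x b < d * s p)" for p
  define p where "p = (GREATEST p. P p)"
  have "P i" using True ij by (simp add: P_def)
  moreover have Pj: "\<forall>q. P q \<longrightarrow> q \<le> j" by (simp add: P_def)
  ultimately have p: "P p" and ip: "i \<le> p"
    unfolding p_def using GreatestI_nat[of P i j] Greatest_le_nat[of P i j] by blast+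
  from p obtain b where b: "b \<in> X" "dist x b < d * s p" by (auto simp: P_def)
  have "s p \<le> s i" using ip by (rule s_antimono)
  then have sp: "d * s p \<le> d * s i" "7 * d * s p \<le> 7 * d * s i" using d_ge1
      by (auto intro: mult_left_mono)
  have Fp: "modulus F M (7 * d * s p)" using modulus_mono[OF F sp(2)] .
  have "norm (ipartial xs (\<lambda>x. ext j F x - tay m F b 0 x) x) \<le> C2 * M"
  proof (cases "p = j")
    case True
    then show ?thesis using ext_tay_bound(1)[OF Fp b xs] by simp
  next
    case False
    then have pj: "Suc p \<le> j" using p by (simp add: P_def)
    \<comment> \<open>Maximality of \<open>p\<close>: from scale \<open>Suc p\<close> up to
      \<open>j\<close> the derivatives at \<open>x\<close> no longer change.\<close>
    have "\<not> P (Suc p)"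
      using Greatest_le_nat[of P "Suc p" j] by (auto simp: p_def[symmetric] P_def)
    then have "ipartial xs (ext j F) x = ipartial xs (ext (Suc p) F) x"
      using pj by (intro ext_stable) (auto simp: P_def not_less)
    then show ?thesis using ext_tay_bound(2)[OF Fp b xs]
      using ipartial_diff[OF Ck_ext[OF F] Ck_tay[OF F] xs, of _ b 0] by (simp del: ext.simps)
  qed
  moreover have "norm (ipartial xs (\<lambda>x. ext i F x - tay m F b 0 x) x) \<le> C2 * M"
    using b sp by (intro ext_tay_bound(1)[OF F _ _ xs]) auto
  ultimately show ?thesis
    using norm_triangle_ineq4[of "ipartial xs (ext j F) x - ipartial xs (tay m F b 0) x"
        "ipartial xs (ext i F) x - ipartial xs (tay m F b 0) x"]
    by (simp add: ipartial_diff[OF Ck_ext[OF F] Ck_tay[OF F] xs])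
qed

end

section \<open>The Whitney extension operator\<close>

context extension_setup
begin

lemma Whitney_modulus:
  assumes "F \<in> Whitney X m"
  shows "modulus F (Whitney_norm X m F) t"
  using assms compact_X unfolding modulus_def
  by (auto intro: Whitney_norm_nonneg Whitney_norm_upper(2) Whitney_zero)

lemma Whitney_small_modulus:
  assumes F: "F \<in> Whitney X m" and M: "M > 0"
  shows "\<exists>i. modulus F M (7 * d * s i)"
proof -
  let ?P = "\<lambda>k \<delta>. \<forall>a\<in>X. \<forall>b\<in>X. dist a b < \<delta> \<longrightarrow> norm (jet_rem m F a k b) \<le> M * dist a b ^ (m - mlen k)"
  have "\<exists>\<delta>>0. \<forall>k\<in>{k. mlen k \<le> m}. ?P k \<delta>"
  proof (rule finite_common_delta[OF finite_mlen_le])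
    fix k :: "'n \<Rightarrow> nat" assume "k \<in> {k. mlen k \<le> m}"
    then have k: "mlen k \<le> m" by simp
    obtain \<delta> where "\<delta> > 0" "\<And>a b. a \<in> X \<Longrightarrow> b \<in> X \<Longrightarrow> dist a b < \<delta> \<Longrightarrow>
        norm (jet_rem m F a k b) \<le> M * dist a b ^ (m - mlen k)"
      using Whitney_rem[OF F k M] by blast
    then show "\<exists>\<delta>>0. ?P k \<delta>" by blast
  qed (meson order_less_le_trans)
  then obtain \<delta> where \<delta>: "\<delta> > 0" "\<And>k. mlen k \<le> m \<Longrightarrow> ?P k \<delta>" by blast
  have "7 * d > 0" using d_ge1 by simp
  then have "\<delta> / (7 * d) > 0" using \<delta> by simp
  then obtain i where "(1 / 4 :: real) ^ i < \<delta> / (7 * d)" using real_arch_pow_inv[of _ "1 / 4"]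
      by force
  then have "7 * d * s i < \<delta>" using \<open>7 * d > 0\<close> by (simp add: s_def field_simps)
  then have "modulus F M (7 * d * s i)"
    unfolding modulus_def using M \<delta>(2) Whitney_zero[OF F] by (meson less_imp_le order_le_less_trans)
  then show ?thesis by blast
qed

definition W :: "(('n \<Rightarrow> nat) \<Rightarrow> real^'n \<Rightarrow> complex) \<Rightarrow> real^'n \<Rightarrow> complex" where
  "W F x = lim (\<lambda>j. ext j F x)"

lemma W_limit:
  assumes F: "F \<in> Whitney X m"
  shows "Ck m (W F)"
    and "length xs \<le> m \<Longrightarrow> (\<lambda>j. ipartial xs (ext j F) x) \<longlonglongrightarrow> ipartial xs (W F) x"
proof -
  have ck: "Ck m (ext j F)" for j using Ck_ext[OF Whitney_modulus[OF F, of 0]] .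
  obtain g where g: "Ck m g" "\<And>xs K. length xs \<le> m \<Longrightarrow> compact K \<Longrightarrow>
      uniform_limit K (\<lambda>j. ipartial xs (ext j F)) (ipartial xs g) sequentially"
  proof (rule Em_complete[of m "\<lambda>j. ext j F"])
    show "Ck m (ext j F)" for j by (rule ck)
    fix K :: "(real^'n) set" and e :: real assume e: "e > 0"
    \<comment> \<open>Two comparisons with \<open>ext i\<close> cost \<open>2 * C2 * M\<close> each;
      the 1 avoids division by 0.\<close>
    define M where "M = e / (4 * C2 + 1)"
    have C2: "4 * C2 + 1 > 0" using C2_nonneg by linarith
    then have "M > 0" "(4 * C2 + 1) * M = e" using e by (auto simp: M_def)
    then have M: "M > 0" "4 * C2 * M < e" by (auto simp: distrib_right)
    obtain i where i: "modulus F M (7 * d * s i)" using Whitney_small_modulus[OF F M(1)] by blast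
    show "\<exists>N. \<forall>i\<ge>N. \<forall>j\<ge>N. \<forall>xs x. length xs \<le> m \<longrightarrow> x \<in> K \<longrightarrow>
        norm (ipartial xs (ext i F) x - ipartial xs (ext j F) x) < e"
    proof (intro exI[of _ i] allI impI)
      fix j k xs x assume "i \<le> j" "i \<le> k" "length (xs :: 'n list) \<le> m"
      then have "norm (ipartial xs (ext j F) x - ipartial xs (ext i F) x) \<le> 2 * C2 * M"
        "norm (ipartial xs (ext k F) x - ipartial xs (ext i F) x) \<le> 2 * C2 * M"
        by (intro ext_Cauchy[OF i]; simp)+
      then show "norm (ipartial xs (ext j F) x - ipartial xs (ext k F) x) < e"
        using norm_triangle_ineq4[of "ipartial xs (ext j F) x - ipartial xs (ext i F) x"
            "ipartial xs (ext k F) x - ipartial xs (ext i F) x"] M(2) by simp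
    qed
  qed blast
  have lim: "(\<lambda>j. ipartial xs (ext j F) x) \<longlonglongrightarrow> ipartial xs g x" if "length xs \<le> m" for xs x
    by (rule tendsto_uniform_limitI[OF g(2)[OF that, of "{x}"]]) auto
  have "W F = g"
    using lim[of "[]"] by (auto simp: W_def fun_eq_iff intro: limI)
  then show "Ck m (W F)" "length xs \<le> m \<Longrightarrow> (\<lambda>j. ipartial xs (ext j F) x) \<longlonglongrightarrow> ipartial xs (W F) x"
    using g(1) lim by auto
qed

lemma W_in_Em: "F \<in> Whitney X m \<Longrightarrow> W F \<in> Em m"
  by (simp add: Em_def W_limit)

text \<open>On \<open>X\<close> the point \<open>b = x\<close> is allowed at every scale, and its
  Taylor polynomial has exactly the values of the jet as derivatives at \<open>x\<close>.\<close>

lemma ext_jet: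
  assumes F: "F \<in> Whitney X m" and x: "x \<in> X" and xs: "length xs \<le> m"
  shows "(\<lambda>j. ipartial xs (ext j F) x) \<longlonglongrightarrow> F (count_list xs) x"
proof (rule LIMSEQ_I)
  fix e :: real assume e: "e > 0"
  define M where "M = e / (C2 + 1)"
  have "C2 + 1 > 0" using C2_nonneg by linarith
  then have "M > 0" "(C2 + 1) * M = e" using e by (auto simp: M_def)
  then have M: "M > 0" "C2 * M < e" by (auto simp: distrib_right)
  obtain i where i: "modulus F M (7 * d * s i)" using Whitney_small_modulus[OF F M(1)] by blast
  have "norm (ipartial xs (ext j F) x - F (count_list xs) x) < e" if "j \<ge> i" for j
  proof -
    have j: "modulus F M (7 * d * s j)"
      using d_ge1 by (intro modulus_mono[OF i] mult_left_mono s_antimono that) auto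
    have "norm (ipartial xs (\<lambda>y. ext j F y - tay m F x 0 y) x) \<le> C2 * M"
      using x xs d_ge1 by (intro ext_tay_bound(1)[OF j]) auto
    moreover have "ipartial xs (\<lambda>y. ext j F y - tay m F x 0 y) x
        = ipartial xs (ext j F) x - F (count_list xs) x"
    proof -
      have "ipartial xs (tay m F x 0) x = F (count_list xs) x"
        using Ck_ipartial_tay(2)[of m F x xs 0] modulus_zero[OF i] by (simp add: tay_self)
      then show ?thesis by (simp add: ipartial_diff[OF Ck_ext[OF i] Ck_tay[OF i] xs])
    qed
    ultimately show ?thesis using M(2) by simp
  qed
  then show "\<exists>n0. \<forall>j\<ge>n0. norm (ipartial xs (ext j F) x - F (count_list xs) x) < e" by blast
qed

lemma Jm_W:
  assumes F: "F \<in> Whitney X m"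
  shows "Jm X m (W F) = F"
proof (intro HOL.ext)
  fix k :: "'n \<Rightarrow> nat" and x :: "real^'n"
  show "Jm X m (W F) k x = F k x"
  proof (cases "x \<in> X \<and> mlen k \<le> m")
    case True
    obtain xs where xs: "count_list xs = k" "length xs = mlen k" "mpartial k (W F)
        = ipartial xs (W F)"
      using mpartial_ipartial_ex by metis
    then have "mpartial k (W F) x = F k x"
      using LIMSEQ_unique[OF W_limit(2)[OF F] ext_jet[OF F]] True by simp
    then show ?thesis using True by (simp add: Jm_def)
  next
    case False
    then show ?thesis using Whitney_zero[OF F] by (auto simp: Jm_def)
  qed
qed

section \<open>Linearity and boundedness of the extension operator\<close>

lemma local_tay_add: "local_tay j (F + G) x = local_tay j F x + local_tay j G x"
  by (simp add: local_tay_def tay_add distrib_left sum.distrib)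

lemma local_tay_cscale: "local_tay j (cscale c F) x = c * local_tay j F x"
  by (simp add: local_tay_def tay_cscale sum_distrib_left mult.left_commute)

lemma ext_add: "ext j (F + G) x = ext j F x + ext j G x"
  by (induction j) (simp_all only: ext.simps local_tay_add distrib_left add_ac)

lemma ext_cscale: "ext j (cscale c F) x = c * ext j F x"
  by (induction j) (simp_all only: ext.simps local_tay_cscale distrib_left mult_ac)

lemma ext_tendsto: "F \<in> Whitney X m \<Longrightarrow> (\<lambda>j. ext j F x) \<longlonglongrightarrow> W F x"
  using W_limit(2)[of F "[]" x] by simp

lemma lin_W: "lin_on (Whitney X m) W"
  unfolding lin_on_def
proof (intro conjI ballI allI)
  fix F G assume FG: "F \<in> Whitney X m" "G \<in> Whitney X m"
  show "W (F + G) = W F + W G"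
  proof
    fix x
    have "(\<lambda>j. ext j F x + ext j G x) \<longlonglongrightarrow> W F x + W G x"
      using FG by (intro tendsto_add ext_tendsto)
    then show "W (F + G) x = (W F + W G) x"
      using ext_tendsto[OF Whitney_add[OF FG], of x] by (simp add: ext_add LIMSEQ_unique)
  qed
next
  fix F c assume F: "F \<in> Whitney X m"
  show "W (cscale c F) = cscale c (W F)"
  proof
    fix x
    have "(\<lambda>j. c * ext j F x) \<longlonglongrightarrow> c * W F x"
      using F by (intro tendsto_mult_left ext_tendsto)
    then show "W (cscale c F) x = cscale c (W F) x"
      using ext_tendsto[OF Whitney_cscale[OF F, of c], of x] by (simp add: ext_cscale LIMSEQ_unique)
  qed
qed

lemma monomial_bound:
  assumes "norm v \<le> R" "mlen l \<le> m"
  shows "\<bar>monomial l v\<bar> \<le> (1 + R) ^ m"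
proof -
  have R: "R \<ge> 0" using assms(1) order_trans[OF norm_ge_zero] by blast
  have "\<bar>monomial l v\<bar> = (\<Prod>i\<in>UNIV. \<bar>v $ i\<bar> ^ l i / fact (l i))"
    by (simp add: monomial_def abs_prod power_abs)
  also have "\<dots> \<le> (\<Prod>i\<in>UNIV. (1 + R) ^ l i)"
  proof (intro prod_mono conjI)
    fix i
    have "\<bar>v $ i\<bar> \<le> 1 + R" using component_le_norm_cart[of v i] assms(1) by simp
    then have "\<bar>v $ i\<bar> ^ l i \<le> (1 + R) ^ l i" by (intro power_mono) auto
    moreover have "\<bar>v $ i\<bar> ^ l i / fact (l i) \<le> \<bar>v $ i\<bar> ^ l i / 1"
      by (intro divide_left_mono) auto
    ultimately show "\<bar>v $ i\<bar> ^ l i / fact (l i) \<le> (1 + R) ^ l i" by simp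
  qed simp
  also have "\<dots> = (1 + R) ^ mlen l" by (simp add: mlen_def power_sum)
  also have "\<dots> \<le> (1 + R) ^ m" using R assms(2) by (intro power_increasing) auto
  finally show ?thesis .
qed

lemma tay_bound:
  assumes F: "F \<in> Whitney X m" and a: "a \<in> X" "norm (x - a) \<le> R"
  shows "norm (tay m F a k x) \<le> real (card {l :: 'n \<Rightarrow> nat. mlen l
      \<le> m}) * ((1 + R) ^ m * Whitney_norm X m F)"
proof -
  have R: "R \<ge> 0" using a(2) order_trans[OF norm_ge_zero] by blast
  have N: "0 \<le> Whitney_norm X m F" using Whitney_norm_nonneg[OF F compact_X] .
  have "norm (F k' a) \<le> Whitney_norm X m F" for k'
    using Whitney_norm_upper(1)[OF F compact_X, of k' a] a Whitney_zero[OF F, of a k'] N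
    by (cases "mlen k' \<le> m") auto
  then have "norm (of_real (monomial l (x - a)) * F (k + l) a) \<le> (1 + R) ^ m * Whitney_norm X m F"
    if "mlen l \<le> m" for l
    unfolding norm_mult using R monomial_bound[OF a(2) that] by (intro mult_mono) auto
  then have "norm (\<Sum>l\<in>{l. mlen l \<le> m}. of_real (monomial l (x - a)) * F (k + l) a)
      \<le> (\<Sum>l\<in>{l :: 'n \<Rightarrow> nat. mlen l \<le> m}. (1 + R) ^ m * Whitney_norm X m F)"
    by (intro sum_norm_le) auto
  then show ?thesis using tay_full[of m F a k x] Whitney_zero[OF F] by simp
qed

text \<open>At scale 0 the sum of Taylor polynomials is bounded directly on \<open>Y\<close>; all
  later scales differ from it by at most \<open>2 * C2\<close> times the norm, by
  \<open>ext_Cauchy\<close> with the Whitney norm as modulus.\<close>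

lemma W_bounded:
  assumes K: "compact Y"
  shows "\<exists>C\<ge>0. \<forall>F\<in>Whitney X m. \<forall>xs. \<forall>x\<in>Y. length xs \<le> m \<longrightarrow>
    norm (ipartial xs (W F) x) \<le> C * Whitney_norm X m F"
proof -
  obtain r where r: "\<And>x. x \<in> X \<Longrightarrow> norm x \<le> r" using compact_X compact_imp_bounded bounded_iff
      by metis
  obtain r' where r': "\<And>x. x \<in> Y \<Longrightarrow> norm x \<le> r'" using K compact_imp_bounded bounded_iff by metis
  \<comment> \<open>The absolute value covers empty sets, for which \<open>r\<close> and
    \<open>r'\<close> are arbitrary.\<close>
  let ?T = "real (card {l :: 'n \<Rightarrow> nat. mlen l \<le> m}) * (1 + \<bar>r + r'\<bar>) ^ m"
  let ?C = "2 * C2 + C\<chi> * ?T"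
  have "norm (ipartial xs (W F) x) \<le> ?C * Whitney_norm X m F"
    if F: "F \<in> Whitney X m" and x: "x \<in> Y" and xs: "length xs \<le> m" for F xs x
  proof -
    let ?N = "Whitney_norm X m F"
    have N: "0 \<le> ?N" using Whitney_norm_nonneg[OF F compact_X] .
    have "derivs_le m x (\<lambda>x. \<Sum>z\<in>Zs 0. th 0 z x * tay m F (pt 0 z) 0 x) (real K * (2 ^ m * B * (?T *
        ?N))) (4 ^ 0)"
    proof (rule derivs_le_local_sum)
      show "Ck m (tay m F (pt 0 z) 0)" for z by (rule Ck_tay[OF Whitney_modulus[OF F, of 0]])
      show "0 \<le> ?T * ?N" using N by simp
      fix z assume z: "z \<in> Zs 0"
      then have p: "pt 0 z \<in> X" using Zs_pt by blast
      have "norm (x - pt 0 z) \<le> \<bar>r + r'\<bar>"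
        using norm_triangle_ineq4[of x "pt 0 z"] r[OF p] r'[OF x] by linarith
      then have *: "norm (tay m F (pt 0 z) k x) \<le> ?T * ?N" for k
        using tay_bound[OF F p, of x "\<bar>r + r'\<bar>" k] by (simp add: mult.assoc)
      show "derivs_le m x (tay m F (pt 0 z) 0) (?T * ?N) (4 ^ 0)"
        unfolding derivs_le_def
      proof (intro allI impI)
        fix ys :: "'n list"
        have "ipartial ys (tay m F (pt 0 z) 0) = tay m F (pt 0 z) (0 + count_list ys)"
          using Whitney_zero[OF F] by (intro Ck_ipartial_tay(2)) auto
        then show "norm (ipartial ys (tay m F (pt 0 z) 0) x) \<le> ?T * ?N * (4 ^ 0) ^ length ys"
          using * by simp
      qed
    qed
    moreover have "ext 0 F = (\<lambda>x. \<Sum>z\<in>Zs 0. th 0 z x * tay m F (pt 0 z) 0 x)"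
      by (simp add: fun_eq_iff local_tay_def)
    ultimately have "norm (ipartial xs (ext 0 F) x) \<le> C\<chi> * ?T * ?N"
      using xs by (simp add: derivs_le_def C\<chi>_def mult_ac)
    then have "norm (ipartial xs (ext j F) x) \<le> ?C * ?N" for j
      using ext_Cauchy[OF Whitney_modulus[OF F] le0 xs, of j x]
        norm_triangle_ineq[of "ipartial xs (ext j F) x - ipartial xs (ext 0 F) x" "ipartial xs (ext
            0 F) x"]
      by (simp add: distrib_right)
    then show ?thesis
      by (intro LIMSEQ_le_const2[OF tendsto_norm[OF W_limit(2)[OF F xs]]]) auto
  qed
  moreover have "?C \<ge> 0" using C2_nonneg C\<chi>_nonneg by simp
  ultimately show ?thesis by blast
qed

end

theorem Whitney_extension:
  fixes X :: "(real^'n::finite) set"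
  assumes "compact X"
  obtains W where "\<And>F. F \<in> Whitney X m \<Longrightarrow> W F \<in> Em m" "lin_on (Whitney X m) W"
    "\<And>F. F \<in> Whitney X m \<Longrightarrow> Jm X m (W F) = F"
    "\<And>Y. compact Y \<Longrightarrow> \<exists>C\<ge>0. \<forall>F\<in>Whitney X m. snorm Y m (W F) \<le> C * Whitney_norm X m F"
proof -
  obtain \<theta> :: "real^'n \<Rightarrow> complex" where \<theta>: "Ck m \<theta>"
    "\<And>x. \<theta> x \<noteq> 0 \<Longrightarrow> norm x \<le> real CARD('n)"
    "\<And>x Z. finite Z \<Longrightarrow> {z. \<theta> (x - lattice z) \<noteq> 0} \<subseteq> Z \<Longrightarrow> (\<Sum>z\<in>Z. \<theta> (x - lattice z)) = 1"
    using lattice_partition_of_unity by blast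
  obtain B where B: "\<And>xs x. length xs \<le> m \<Longrightarrow> norm (ipartial xs \<theta> x) \<le> B"
    using bounded_ipartial_of_support[OF \<theta>(1,2)] by blast
  obtain K :: nat where K: "\<And>x :: real^'n. finite {z. \<forall>i. \<bar>x $ i - real_of_int (z i)\<bar>
      \<le> real CARD('n)}"
    "\<And>x :: real^'n. card {z. \<forall>i. \<bar>x $ i - real_of_int (z i)\<bar> \<le> real CARD('n)} \<le> K"
    using card_lattice_cube by blast
  interpret extension_setup X m \<theta> B "real CARD('n)" K
    by unfold_locales (use assms \<theta> B K in auto)
  show thesis
  proof (rule that[of W])
    fix Y :: "(real^'n) set" assume "compact Y"
    from W_bounded[OF this] obtain C where C: "C \<ge> 0" "\<And>F xs x. F \<in> Whitney X m \<Longrightarrow> x \<in> Y \<Longrightarrow>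
      length xs \<le> m \<Longrightarrow> norm (ipartial xs (W F) x) \<le> C * Whitney_norm X m F" by blast
    then have "snorm Y m (W F) \<le> C * Whitney_norm X m F" if "F \<in> Whitney X m" for F
      using that Whitney_norm_nonneg[OF that compact_X] by (intro snorm_le) auto
    then show "\<exists>C\<ge>0. \<forall>F\<in>Whitney X m. snorm Y m (W F) \<le> C * Whitney_norm X m F" using C(1) by blast
  qed (simp_all add: W_in_Em lin_W Jm_W)
qed

section \<open>Topologies generated by seminorms\<close>

text \<open>\<open>cscale\<close> has no laws of its own. These two yield subtraction and the value
  at 0 for \<open>lin_on\<close>, and they pass to function types, hence to jets and
  functionals.\<close>

class cvector = ab_group_add + cscale +
  assumes cscale_minus1: "cscale (- 1) x = - x" and cscale_zero_left: "cscale 0 x = 0"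

instance complex :: cvector
  by standard simp_all

instance "fun" :: (type, cvector) cvector
  by standard (simp_all add: fun_eq_iff cscale_minus1 cscale_zero_left)

lemma lin_on_add: "lin_on S u \<Longrightarrow> f \<in> S \<Longrightarrow> g \<in> S \<Longrightarrow> u (f + g) = u f + u g"
  and lin_on_cscale: "lin_on S u \<Longrightarrow> f \<in> S \<Longrightarrow> u (cscale c f) = cscale c (u f)"
  by (simp_all add: lin_on_def)

definition csubspace :: "'a::cvector set \<Rightarrow> bool" where
  "csubspace S \<longleftrightarrow> 0 \<in> S \<and> (\<forall>f\<in>S. \<forall>g\<in>S. f + g \<in> S) \<and> (\<forall>c. \<forall>f\<in>S. cscale c f \<in> S)"

lemma csubspaceD:
  assumes "csubspace S"
  shows "0 \<in> S" "f \<in> S \<Longrightarrow> g \<in> S \<Longrightarrow> f + g \<in> S" "f \<in> S \<Longrightarrow> cscale c f \<in> S"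
    "f \<in> S \<Longrightarrow> - f \<in> S" "f \<in> S \<Longrightarrow> g \<in> S \<Longrightarrow> f - g \<in> S"
proof -
  show *: "0 \<in> S" "f \<in> S \<Longrightarrow> g \<in> S \<Longrightarrow> f + g \<in> S" "f \<in> S \<Longrightarrow> cscale c f \<in> S" for f g c
    using assms by (auto simp: csubspace_def)
  show **: "f \<in> S \<Longrightarrow> - f \<in> S" for f using *(3)[of f "- 1"] by (simp add: cscale_minus1)
  show "f \<in> S \<Longrightarrow> g \<in> S \<Longrightarrow> f - g \<in> S" using *(2)[of f "- g"] **[of g] by simp
qed

lemma lin_on_0:
  fixes u :: "'a::cvector \<Rightarrow> 'b::cvector"
  assumes "lin_on S u" "csubspace S"
  shows "u 0 = 0"
  using lin_on_cscale[OF assms(1) csubspaceD(1)[OF assms(2)], of 0] by (simp add: cscale_zero_left)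

lemma lin_on_diff:
  fixes u :: "'a::cvector \<Rightarrow> 'b::cvector"
  assumes "lin_on S u" "csubspace S" "f \<in> S" "g \<in> S"
  shows "u (f - g) = u f - u g"
  using lin_on_add[OF assms(1,3) csubspaceD(4)[OF assms(2,4)]] lin_on_cscale[OF assms(1,4), of "-
      1"]
  by (simp add: cscale_minus1)

text \<open>The laws are required on \<open>S\<close> only, since a seminorm given by a real
  \<open>Sup\<close> is controlled only there. A nonempty \<open>P\<close> makes the generated
  topology have \<open>S\<close> as its space.\<close>

definition seminorm_space :: "'a::cvector set \<Rightarrow> ('a \<Rightarrow> real) set \<Rightarrow> bool" where
  "seminorm_space S P \<longleftrightarrow> csubspace S \<and> P \<noteq> {} \<and>
     (\<forall>p\<in>P. p 0 = 0 \<and> (\<forall>f\<in>S. \<forall>g\<in>S. p (f + g) \<le> p f + p g))"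

lemma seminorm_space_zero: "seminorm_space S P \<Longrightarrow> p \<in> P \<Longrightarrow> p 0 = 0"
  by (auto simp: seminorm_space_def)

lemma topspace_seminorm_topology:
  assumes "seminorm_space S P"
  shows "topspace (seminorm_topology S P) = S"
proof -
  obtain p where "p \<in> P" using assms by (auto simp: seminorm_space_def)
  have "f \<in> \<Union> {{g\<in>S. p (g - f) < e} | f p e. f \<in> S \<and> p \<in> P \<and> e > 0}" if "f \<in> S" for f
  proof (rule UnionI)
    show "{g\<in>S. p (g - f) < 1} \<in> {{g\<in>S. p (g - f) < e} | f p e. f \<in> S \<and> p \<in> P \<and> e > 0}"
      by (rule CollectI, rule exI[of _ f], rule exI[of _ p], rule exI[of _ 1])
        (use that \<open>p \<in> P\<close> in auto)
    show "f \<in> {g\<in>S. p (g - f) < 1}" using that \<open>p \<in> P\<close> assms by (simp add: seminorm_space_zero)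
  qed
  then show ?thesis
    unfolding seminorm_topology_def topology_generated_by_topspace by blast
qed

lemma openin_seminorm_ball:
  "f \<in> S \<Longrightarrow> p \<in> P \<Longrightarrow> e > 0 \<Longrightarrow> openin (seminorm_topology S P) {g\<in>S. p (g - f) < e}"
  unfolding seminorm_topology_def by (rule topology_generated_by_Basis) blast

lemma seminorm_triangle:
  assumes "seminorm_space S P" "p \<in> P" "f \<in> S" "g \<in> S" "h \<in> S"
  shows "p (f - h) \<le> p (f - g) + p (g - h)"
proof -
  have "f - g \<in> S" "g - h \<in> S" using assms by (auto simp: seminorm_space_def intro: csubspaceD)
  then have "p ((f - g) + (g - h)) \<le> p (f - g) + p (g - h)"
    using assms unfolding seminorm_space_def by blast
  then show ?thesis by simp
qed

lemma continuous_map_seminorm_topologyI: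
  assumes S: "seminorm_space S P" and u: "\<And>x. x \<in> topspace T \<Longrightarrow> u x \<in> S"
    and nbhd: "\<And>p x e. p \<in> P \<Longrightarrow> x \<in> topspace T \<Longrightarrow> e > 0 \<Longrightarrow>
      \<exists>U. openin T U \<and> x \<in> U \<and> (\<forall>y\<in>U. p (u y - u x) < e)"
  shows "continuous_map T (seminorm_topology S P) u"
  unfolding seminorm_topology_def
proof (rule continuous_on_generated_topo)
  fix V assume "V \<in> {{g\<in>S. p (g - f) < e} | f p e. f \<in> S \<and> p \<in> P \<and> e > 0}"
  then obtain f p e where V: "V = {g\<in>S. p (g - f) < e}" "f \<in> S" "p \<in> P" "e > 0" by blast
  show "openin T (u -` V \<inter> topspace T)"
  proof (subst openin_subopen, intro ballI)
    fix x assume x: "x \<in> u -` V \<inter> topspace T"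
    then have xt: "x \<in> topspace T" and pos: "e - p (u x - f) > 0" by (simp_all add: V)
    obtain U where U: "openin T U" "x \<in> U" "\<forall>y\<in>U. p (u y - u x) < e - p (u x - f)"
      using nbhd[OF V(3) xt pos] by (elim exE conjE)
    have "U \<subseteq> u -` V \<inter> topspace T"
    proof
      fix y assume y: "y \<in> U"
      then have yt: "y \<in> topspace T" using openin_subset[OF U(1)] by blast
      have "p (u y - f) \<le> p (u y - u x) + p (u x - f)"
        using x yt u V by (intro seminorm_triangle[OF S]) auto
      then have "p (u y - f) < e" using bspec[OF U(3) y] by linarith
      then show "y \<in> u -` V \<inter> topspace T" using yt u by (simp add: V)
    qed
    then show "\<exists>U. openin T U \<and> x \<in> U \<and> U \<subseteq> u -` V \<inter> topspace T" using U by blast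
  qed
next
  show "u ` topspace T \<subseteq> \<Union> {{g\<in>S. p (g - f) < e} | f p e. f \<in> S \<and> p \<in> P \<and> e > 0}"
    using u topspace_seminorm_topology[OF S]
    unfolding seminorm_topology_def topology_generated_by_topspace by blast
qed

lemma continuous_map_seminorm_bounded:
  assumes S: "seminorm_space S P" and S': "seminorm_space S' P'"
    and u: "\<And>x. x \<in> S \<Longrightarrow> u x \<in> S'" "lin_on S u"
    and bound: "\<And>p'. p' \<in> P' \<Longrightarrow> \<exists>p\<in>P. \<exists>C\<ge>0. \<forall>f\<in>S. p' (u f) \<le> C * p f"
  shows "continuous_map (seminorm_topology S P) (seminorm_topology S' P') u"
proof (rule continuous_map_seminorm_topologyI[OF S'], unfold topspace_seminorm_topology[OF S])
  have cs: "csubspace S" using S by (simp add: seminorm_space_def)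
  fix p' x and e :: real assume p': "p' \<in> P'" and x: "x \<in> S" and e: "e > 0"
  obtain p C where p: "p \<in> P" "C \<ge> 0" and pC: "\<forall>f\<in>S. p' (u f) \<le> C * p f"
    using bound[OF p'] by (elim bexE exE conjE)
  \<comment> \<open>\<open>C + 1\<close> in place of \<open>C\<close>, which may be 0.\<close>
  let ?U = "{y\<in>S. p (y - x) < e / (C + 1)}"
  have C: "C + 1 > 0" using p by linarith
  have "p' (u y - u x) < e" if y: "y \<in> ?U" for y
  proof -
    have "p' (u y - u x) \<le> C * p (y - x)"
      using bspec[OF pC, of "y - x"] y x csubspaceD(5)[OF cs] lin_on_diff[OF u(2) cs] by auto
    also have "\<dots> \<le> C * (e / (C + 1))" using y p(2) by (intro mult_left_mono) auto
    also have "\<dots> < e" using C e by (simp add: field_simps)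
    finally show ?thesis .
  qed
  moreover have "openin (seminorm_topology S P) ?U"
    using x p e C by (intro openin_seminorm_ball) auto
  moreover have "x \<in> ?U" using x e C S p(1) by (simp add: seminorm_space_zero)
  ultimately show "\<exists>U. openin (seminorm_topology S P) U \<and> x \<in> U \<and> (\<forall>y\<in>U. p' (u y - u x) < e)"
    by blast
qed (use u in auto)

text \<open>The subbasic balls containing \<open>x\<close> may have other centres; the triangle
  inequality recentres each at \<open>x\<close>, and a finite intersection collects finitely many
  seminorms and the smallest radius.\<close>

lemma seminorm_nbhd:
  assumes S: "seminorm_space S P" and "openin (seminorm_topology S P) U" "x \<in> U"
  shows "\<exists>Q e. finite Q \<and> Q \<subseteq> P \<and> e > 0 \<and> {y\<in>S. \<forall>p\<in>Q. p (y - x) < e} \<subseteq> U"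
proof -
  have "generate_topology_on {{g\<in>S. p (g - f) < e} | f p e. f \<in> S \<and> p \<in> P \<and> e > 0} U"
    using assms(2) unfolding seminorm_topology_def by (rule openin_topology_generated_by)
  then show ?thesis using assms(3)
  proof (induction rule: generate_topology_on.induct)
    case (Int U V)
    have x: "x \<in> U" "x \<in> V" using Int.prems by auto
    obtain Q e where Q: "finite Q" "Q \<subseteq> P" "e > 0" "{y\<in>S. \<forall>p\<in>Q. p (y - x) < e} \<subseteq> U"
      using Int.IH(1)[OF x(1)] by (elim exE conjE)
    obtain Q' e' where Q': "finite Q'" "Q' \<subseteq> P" "e' > 0" "{y\<in>S. \<forall>p\<in>Q'. p (y - x) < e'} \<subseteq> V"
      using Int.IH(2)[OF x(2)] by (elim exE conjE)
    have "{y\<in>S. \<forall>p\<in>Q \<union> Q'. p (y - x) < min e e'} \<subseteq> U \<inter> V"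
      by (rule subsetI, rule IntI, rule subsetD[OF Q(4)], simp, rule subsetD[OF Q'(4)], simp)
    then show ?case using Q Q' by (intro exI[of _ "Q \<union> Q'"] exI[of _ "min e e'"]) auto
  next
    case (UN \<U>)
    then obtain V where V: "V \<in> \<U>" "x \<in> V" by blast
    obtain Q e where Q: "finite Q" "Q \<subseteq> P" "e > 0" "{y\<in>S. \<forall>p\<in>Q. p (y - x) < e} \<subseteq> V"
      using UN.IH[OF V] by (elim exE conjE)
    then show ?case using V(1) by (intro exI[of _ Q] exI[of _ e]) auto
  next
    case (Basis V)
    then obtain f p e where V: "V = {g\<in>S. p (g - f) < e}" "f \<in> S" "p \<in> P" "e > 0" by blast
    have "p (y - f) < e" if "y \<in> S" "p (y - x) < e - p (x - f)" for y
      using seminorm_triangle[OF S V(3) that(1), of x f] that V Basis.prems by auto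
    then show ?case using V Basis.prems
      by (intro exI[of _ "{p}"] exI[of _ "e - p (x - f)"]) auto
  qed auto
qed

section \<open>The Frechet space of functions of class C^m\<close>

lemma Em_csubspace: "csubspace (Em m)"
  unfolding csubspace_def Em_def
  by (auto simp: plus_fun_def zero_fun_def cscale_fun_def intro: Ck_add Ck_cmult Ck_const)

lemma Em_diff: "f \<in> Em m \<Longrightarrow> g \<in> Em m \<Longrightarrow> f - g \<in> Em m"
  by (rule csubspaceD(5)[OF Em_csubspace])

text \<open>Homogeneity follows from the one-sided estimate, applied to \<open>c\<close> and to
  \<open>inverse c\<close>.\<close>

lemma snorm_cscale:
  assumes "f \<in> Em m" "k \<le> m" "compact K"
  shows "snorm K k (cscale c f) = norm c * snorm K k f"
proof (cases "c = 0")
  case True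
  then show ?thesis by (simp add: cscale_zero_left)
next
  case False
  have le: "snorm K k (cscale c g) \<le> norm c * snorm K k g" if "g \<in> Em m" for g c
    using that assms by (simp add: Em_def cscale_fun_def snorm_cmult)
  have "cscale (inverse c) (cscale c f) = f" using False by (simp add: fun_eq_iff)
  then have "snorm K k f \<le> norm (inverse c) * snorm K k (cscale c f)"
    using le[of "cscale c f" "inverse c"] assms csubspaceD(3)[OF Em_csubspace] by metis
  then have "norm c * snorm K k f \<le> norm c * (norm (inverse c) * snorm K k (cscale c f))"
    by (intro mult_left_mono) auto
  also have "\<dots> = snorm K k (cscale c f)"
    using False by (simp only: norm_inverse mult.assoc[symmetric]) simp
  finally have "norm c * snorm K k f \<le> snorm K k (cscale c f)" .
  then show ?thesis using le[OF assms(1), of c] by linarith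
qed

lemma snorm_minus_commute:
  assumes "f \<in> Em m" "g \<in> Em m" "k \<le> m" "compact K"
  shows "snorm K k (f - g) = snorm K k (g - f)"
proof -
  have "f - g = cscale (- 1) (g - f)" by (simp add: fun_eq_iff)
  then show ?thesis using snorm_cscale[OF Em_diff[OF assms(2,1)] assms(3,4), of "- 1"] by simp
qed

lemma snorm_triangle:
  assumes "f \<in> Em m" "g \<in> Em m" "k \<le> m" "compact K"
  shows "snorm K k (f + g) \<le> snorm K k f + snorm K k g" "snorm K k (f - g)
      \<le> snorm K k f + snorm K k g"
proof -
  have 1: "snorm K k (f + g) \<le> snorm K k f + snorm K k g" if "g \<in> Em m" for g
    using assms that by (intro snorm_add[where m = m]) (auto simp: Em_def)
  show "snorm K k (f + g) \<le> snorm K k f + snorm K k g" by (rule 1[OF assms(2)])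
  have eq: "f - g = f + cscale (- 1) g" by (simp add: fun_eq_iff)
  show "snorm K k (f - g) \<le> snorm K k f + snorm K k g"
    unfolding eq using 1[of "cscale (- 1) g"] snorm_cscale[OF assms(2-4), of "- 1"] assms(2)
      csubspaceD(3)[OF Em_csubspace assms(2), of "- 1"] by simp
qed

lemma Em_seminorm_space:
  "seminorm_space (Em m :: (real^'n::finite \<Rightarrow> complex) set) {snorm K k | K k. compact K \<and> k \<le> m}"
  unfolding seminorm_space_def
  by (auto simp: Em_csubspace intro!: snorm_triangle exI[of _ "{}"])

text \<open>An increasing sequence that dominates every \<open>snorm K k\<close>
  (\<open>snorm_le_exhaustion\<close>), so that completeness and the category argument can be
  handled with sequences.\<close>

abbreviation exhaustion :: "nat \<Rightarrow> nat \<Rightarrow> (real^'n::finite \<Rightarrow> complex) \<Rightarrow> real" where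
  "exhaustion m n \<equiv> snorm (cball 0 (real n)) m"

lemma exhaustion_mono: "f \<in> Em m \<Longrightarrow> n \<le> k \<Longrightarrow> exhaustion m n f \<le> exhaustion m k f"
  by (intro snorm_mono[where m = m]) (auto simp: Em_def)

lemma exhaustion_nonneg: "f \<in> Em m \<Longrightarrow> 0 \<le> exhaustion m n f"
  by (intro snorm_nonneg) (auto simp: Em_def)

lemma snorm_le_exhaustion:
  assumes "compact K"
  obtains n where "\<And>f k. f \<in> Em m \<Longrightarrow> k \<le> m \<Longrightarrow> snorm K k f \<le> exhaustion m n f"
proof -
  obtain r where "\<And>x. x \<in> K \<Longrightarrow> norm x \<le> r" using assms compact_imp_bounded bounded_iff by metis
  moreover obtain n where "r \<le> real n" using real_arch_simple by blast
  ultimately have "K \<subseteq> cball 0 (real n)" by fastforce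
  then have "snorm K k f \<le> exhaustion m n f" if "f \<in> Em m" "k \<le> m" for f k
    using that by (intro snorm_mono[where m = m]) (auto simp: Em_def)
  then show thesis by (rule that)
qed

definition Em_tendsto :: "nat \<Rightarrow> (nat \<Rightarrow> real^'n::finite \<Rightarrow> complex) \<Rightarrow> (real^'n \<Rightarrow> complex) \<Rightarrow> bool"
    where
  "Em_tendsto m F f \<longleftrightarrow> (\<forall>n. (\<lambda>i. exhaustion m n (F i - f)) \<longlonglongrightarrow> 0)"

lemma Em_sequentially_complete:
  fixes F :: "nat \<Rightarrow> real^'n::finite \<Rightarrow> complex"
  assumes F: "\<And>i. F i \<in> Em m"
    and Cauchy: "\<And>n e. e > 0 \<Longrightarrow> \<exists>N. \<forall>i\<ge>N. \<forall>j\<ge>N. exhaustion m n (F i - F j) < e"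
  obtains f where "f \<in> Em m" "Em_tendsto m F f"
proof -
  have ck: "Ck m (F i)" for i using F by (simp add: Em_def)
  have le: "norm (ipartial xs (F i) x - ipartial xs (F j) x) \<le> exhaustion m n (F i - F j)"
    if "length xs \<le> m" "x \<in> cball 0 (real n)" for xs x i j n
    using norm_ipartial_le_snorm[of m "F i - F j" m "cball 0 (real n)" xs x] Em_diff[OF F F, of i j]
        that
    by (simp add: Em_def fun_diff_def ipartial_diff[OF ck ck])
  obtain f where f: "Ck m f" "\<And>xs K. length xs \<le> m \<Longrightarrow> compact K \<Longrightarrow>
      uniform_limit K (\<lambda>i. ipartial xs (F i)) (ipartial xs f) sequentially"
  proof (rule Em_complete[OF ck])
    fix K :: "(real^'n) set" and e :: real assume K: "compact K" and e: "e > 0"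
    obtain r where "\<And>x. x \<in> K \<Longrightarrow> norm x \<le> r" using K compact_imp_bounded bounded_iff by metis
    moreover obtain n where "r \<le> real n" using real_arch_simple by blast
    ultimately have Kn: "x \<in> cball 0 (real n)" if "x \<in> K" for x using that by fastforce
    obtain N where "\<forall>i\<ge>N. \<forall>j\<ge>N. exhaustion m n (F i - F j) < e" using Cauchy[OF e] by blast
    then show "\<exists>N. \<forall>i\<ge>N. \<forall>j\<ge>N. \<forall>xs x. length xs \<le> m \<longrightarrow> x \<in> K \<longrightarrow>
        norm (ipartial xs (F i) x - ipartial xs (F j) x) < e"
      using le Kn by (meson order_le_less_trans)
  qed blast
  have "(\<lambda>i. exhaustion m n (F i - f)) \<longlonglongrightarrow> 0" for n
  proof (rule LIMSEQ_I)
    fix e :: real assume e: "e > 0"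
    then obtain N where N: "\<And>i j. i \<ge> N \<Longrightarrow> j \<ge> N \<Longrightarrow> exhaustion m n (F i - F j) < e / 2"
      using Cauchy[of "e / 2" n] by auto
    have "norm (exhaustion m n (F i - f) - 0) < e" if i: "i \<ge> N" for i
    proof -
      \<comment> \<open>Let \<open>j\<close> tend to infinity in the Cauchy estimate, for each
        derivative and point.\<close>
      have "exhaustion m n (F i - f) \<le> e / 2"
      proof (rule snorm_le)
        fix xs :: "'n list" and x assume xs: "length xs \<le> m" and x: "x \<in> cball (0::real^'n) (real
            n)"
        have "(\<lambda>j. ipartial xs (F j) x) \<longlonglongrightarrow> ipartial xs f x"
          by (rule tendsto_uniform_limitI[OF f(2)[OF xs, of "{x}"]]) auto
        then have "(\<lambda>j. norm (ipartial xs (F i) x - ipartial xs (F j) x))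
            \<longlonglongrightarrow> norm (ipartial xs (F i) x - ipartial xs f x)"
          by (intro tendsto_intros)
        then have "norm (ipartial xs (F i) x - ipartial xs f x) \<le> e / 2"
        proof (rule LIMSEQ_le_const2, intro exI[of _ N] allI impI)
          fix j assume "N \<le> j"
          then show "norm (ipartial xs (F i) x - ipartial xs (F j) x) \<le> e / 2"
            using le[OF xs x, of i j] N[OF i, of j] by linarith
        qed
        then show "norm (ipartial xs (F i - f) x) \<le> e / 2"
          by (simp add: fun_diff_def ipartial_diff[OF ck f(1) xs])
      qed (use e in auto)
      moreover have "0 \<le> exhaustion m n (F i - f)"
        using f(1) by (intro exhaustion_nonneg Em_diff F) (simp add: Em_def)
      ultimately show ?thesis using e by simp
    qed
    then show "\<exists>N. \<forall>i\<ge>N. norm (exhaustion m n (F i - f) - 0) < e" by blast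
  qed
  then show thesis using f(1) that by (auto simp: Em_def Em_tendsto_def)
qed

section \<open>A closed graph theorem\<close>

text \<open>Source and target are the same space, so one sequence of seminorms serves both; in the
  application \<open>P\<close> is the projection onto the ideal along a complement.\<close>

locale closed_graph_projection =
  fixes m :: nat and P :: "(real^'n::finite \<Rightarrow> complex) \<Rightarrow> (real^'n \<Rightarrow> complex)"
  assumes P_Em: "f \<in> Em m \<Longrightarrow> P f \<in> Em m" and lin_P: "lin_on (Em m) P"
    and closed_graph: "(\<And>i. F i \<in> Em m) \<Longrightarrow> f \<in> Em m \<Longrightarrow> g \<in> Em m \<Longrightarrow> Em_tendsto m F f \<Longrightarrow>
      Em_tendsto m (\<lambda>i. P (F i)) g \<Longrightarrow> P f = g"
begin

abbreviation q :: "nat \<Rightarrow> (real^'n \<Rightarrow> complex) \<Rightarrow> real" where "q \<equiv> exhaustion m"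

lemma q_add: "f \<in> Em m \<Longrightarrow> g \<in> Em m \<Longrightarrow> q n (f + g) \<le> q n f + q n g"
  and q_diff: "f \<in> Em m \<Longrightarrow> g \<in> Em m \<Longrightarrow> q n (f - g) \<le> q n f + q n g"
  and q_cscale: "f \<in> Em m \<Longrightarrow> q n (cscale c f) = norm c * q n f"
  and q_commute: "f \<in> Em m \<Longrightarrow> g \<in> Em m \<Longrightarrow> q n (f - g) = q n (g - f)"
  by (auto intro: snorm_triangle snorm_cscale snorm_minus_commute)

lemma q_triangle:
  assumes "f \<in> Em m" "g \<in> Em m" "h \<in> Em m"
  shows "q n (f - h) \<le> q n (f - g) + q n (g - h)"
  using q_add[OF Em_diff[OF assms(1,2)] Em_diff[OF assms(2,3)], of n] by simp

lemma Em_cscale: "f \<in> Em m \<Longrightarrow> cscale c f \<in> Em m"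
  by (rule csubspaceD(3)[OF Em_csubspace])

lemma P_diff: "f \<in> Em m \<Longrightarrow> g \<in> Em m \<Longrightarrow> P (f - g) = P f - P g"
  by (rule lin_on_diff[OF lin_P Em_csubspace])

lemma P_cscale: "f \<in> Em m \<Longrightarrow> P (cscale c f) = cscale c (P f)"
  by (rule lin_on_cscale[OF lin_P])

text \<open>Membership in the closure of the preimage under \<open>P\<close> of the
  \<open>q n\<close>-ball of radius \<open>t\<close>. Because the seminorms increase, testing one
  \<open>q k\<close> at a time describes the closure.\<close>

definition in_closure :: "nat \<Rightarrow> real \<Rightarrow> (real^'n \<Rightarrow> complex) \<Rightarrow> bool" where
  "in_closure n t f \<longleftrightarrow> (\<forall>k. \<forall>e>0. \<exists>g\<in>Em m. q n (P g) \<le> t \<and> q k (f - g) < e)"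

text \<open>Balls are triples of centre, seminorm index and radius. Halved steps and radii nest
  them, and the growing index brings in every seminorm.\<close>

definition nested :: "(real^'n \<Rightarrow> complex) \<times> nat \<times> real \<Rightarrow> (real^'n \<Rightarrow> complex) \<times> nat \<times> real \<Rightarrow> bool"
    where
  "nested = (\<lambda>(f, k, \<delta>) (f', k', \<delta>'). q k (f' - f) \<le> \<delta> / 2 \<and> k < k' \<and> \<delta>' \<le> \<delta> / 2)"

text \<open>Baire category: the closures for \<open>N = 0, 1, 2, ...\<close> cover the space, so one
  has interior. Otherwise nested balls can be chosen that avoid one preimage after the other, and
  their common point \<open>g\<close> would satisfy \<open>q n (P g) > i\<close> for all
  \<open>i\<close>.\<close>

lemma closure_contains_ball:
  "\<exists>N f0 k \<delta>. \<delta> > 0 \<and> f0 \<in> Em m \<and> (\<forall>f\<in>Em m. q k (f - f0) \<le> \<delta> \<longrightarrow> in_closure n (real N) f)"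
proof (rule ccontr)
  assume "\<not> ?thesis"
  then have neg: "\<exists>f\<in>Em m. q k (f - f0) \<le> \<delta> \<and> \<not> in_closure n (real N) f"
    if "\<delta> > 0" "f0 \<in> Em m" for N f0 k \<delta> using that by blast
  define good where "good i = (\<lambda>(f :: real^'n \<Rightarrow> complex, k :: nat, \<delta>). f \<in> Em m \<and> \<delta> > 0 \<and> i \<le> k \<and>
      \<delta> \<le> (1 / 2 :: real) ^ i)" for i :: nat
  define avoid where "avoid i = (\<lambda>(f, k, \<delta>). \<forall>g\<in>Em m. q k (g - f) \<le> \<delta> \<longrightarrow>
      real i < q n (P g))" for i :: nat
  have "\<exists>X. \<forall>i. good i (X i) \<and> (nested (X i) (X (Suc i)) \<and> avoid i (X (Suc i)))"
  proof (rule dependent_nat_choice)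
    show "\<exists>x. good 0 x"
      by (rule exI[of _ "(0, 0, 1)"]) (simp add: good_def csubspaceD(1)[OF Em_csubspace])
  next
    fix x i assume "good i x"
    obtain f k \<delta> where x: "x = (f, k, \<delta>)" by (cases x)
    have f: "f \<in> Em m" "\<delta> > 0" "i \<le> k" "\<delta> \<le> (1 / 2) ^ i" using \<open>good i x\<close> by (auto simp: good_def x)
    have "\<delta> / 2 > 0" using f by simp
    obtain f' where f': "f' \<in> Em m" "q k (f' - f) \<le> \<delta> / 2" "\<not> in_closure n (real i) f'"
      using neg[OF \<open>\<delta> / 2 > 0\<close> f(1)] by blast
    then obtain k' e where e: "e > 0" "\<And>g. g \<in> Em m \<Longrightarrow> q n (P g) \<le> real i \<Longrightarrow> e \<le> q k' (f' - g)"
      unfolding in_closure_def by (meson not_less)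
    \<comment> \<open>The new index exceeds \<open>k\<close>, and \<open>q k'\<close> sees the
      distance \<open>e\<close>; the closed ball of radius at most \<open>e / 2\<close> then misses
      the preimage.\<close>
    let ?y = "(f', max (Suc k) k', min (\<delta> / 2) (e / 2))"
    have "good (Suc i) ?y" using f f' e by (auto simp: good_def)
    moreover have "nested x ?y" using f'(2) by (auto simp: nested_def x)
    moreover have "avoid i ?y"
      unfolding avoid_def prod.case
    proof (intro ballI impI)
      fix g assume g: "g \<in> Em m" "q (max (Suc k) k') (g - f') \<le> min (\<delta> / 2) (e / 2)"
      have "q k' (f' - g) = q k' (g - f')" using f' g by (intro q_commute) auto
      also have "\<dots> \<le> q (max (Suc k) k') (g - f')" using f' g by (intro exhaustion_mono Em_diff) auto
      also have "\<dots> < e" using g e by linarith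
      finally show "real i < q n (P g)" using e(2)[OF g(1)] by (meson not_less)
    qed
    ultimately show "\<exists>y. good (Suc i) y \<and> (nested x y \<and> avoid i y)" by blast
  qed
  then obtain X where X: "\<And>i. good i (X i)" "\<And>i. nested (X i) (X (Suc i))" "\<And>i. avoid i (X (Suc i))"
      by blast
  define f k \<delta> where "f i = fst (X i)" and "k i = fst (snd (X i))" and "\<delta> i = snd (snd (X i))" for i
  have X_eq: "X i = (f i, k i, \<delta> i)" for i by (simp add: f_def k_def \<delta>_def)
  have f: "f i \<in> Em m" "\<delta> i > 0" "i \<le> k i" "\<delta> i \<le> (1 / 2) ^ i" for i
    using X(1)[of i] by (auto simp: good_def X_eq)
  have step: "q (k i) (f (Suc i) - f i) \<le> \<delta> i / 2" "k i < k (Suc i)" "\<delta> (Suc i) \<le> \<delta> i / 2" for i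
    using X(2)[of i] by (auto simp: nested_def X_eq)
  have k_mono: "k i \<le> k j" if "i \<le> j" for i j
    using that by (rule lift_Suc_mono_le[rotated]) (use step(2) less_imp_le in blast)
  \<comment> \<open>The subtracted \<open>\<delta> j\<close> makes the induction telescope: a step
    at \<open>j\<close> costs at most \<open>\<delta> j / 2\<close>, which is at most
    \<open>\<delta> j - \<delta> (Suc j)\<close>.\<close>
  have ball: "q (k i) (f j - f i) \<le> \<delta> i - \<delta> j" if "i \<le> j" for i j
    using that
  proof (induction j rule: dec_induct)
    case base
    have "f i - f i = 0" by simp
    then show ?case by (simp only: snorm_zero)
  next
    case (step j)
    have "q (k i) (f (Suc j) - f i) \<le> q (k i) (f (Suc j) - f j) + q (k i) (f j - f i)"
      using f by (intro q_triangle) auto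
    also have "q (k i) (f (Suc j) - f j) \<le> q (k j) (f (Suc j) - f j)"
      using f k_mono[OF step(1)] by (intro exhaustion_mono Em_diff) auto
    also have "q (k j) (f (Suc j) - f j) \<le> \<delta> j - \<delta> (Suc j)"
      using \<open>\<And>i. q (k i) (f (Suc i) - f i) \<le> \<delta> i / 2\<close>[of j] \<open>\<And>i. \<delta> (Suc i)
          \<le> \<delta> i / 2\<close>[of j] by linarith
    finally show ?case using step.IH by linarith
  qed
  obtain g where g: "g \<in> Em m" "Em_tendsto m f g"
  proof (rule Em_sequentially_complete[of f m])
    fix l and e :: real assume e: "e > 0"
    obtain N0 where N0: "(1 / 2 :: real) ^ N0 < e / 2" using real_arch_pow_inv[of "e / 2" "1 / 2"] e
        by auto
    define N where "N = max N0 l"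
    have N: "(1 / 2 :: real) ^ N \<le> (1 / 2) ^ N0" unfolding N_def by (intro power_decreasing) auto
    have d: "q l (f i - f N) \<le> (1 / 2) ^ N" if "N \<le> i" for i
    proof -
      have "l \<le> k N" using f(3)[of N] by (simp add: N_def)
      then have "q l (f i - f N) \<le> q (k N) (f i - f N)" using f
          by (intro exhaustion_mono Em_diff) auto
      also have "\<dots> \<le> (1 / 2) ^ N" using ball[OF that] f(2)[of i] f(4)[of N] by linarith
      finally show ?thesis .
    qed
    show "\<exists>N. \<forall>i\<ge>N. \<forall>j\<ge>N. q l (f i - f j) < e"
    proof (intro exI[of _ N] allI impI)
      fix i j assume ij: "N \<le> i" "N \<le> j"
      have "q l (f i - f j) \<le> q l (f i - f N) + q l (f N - f j)" using f by (intro q_triangle) auto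
      also have "q l (f N - f j) = q l (f j - f N)" using f by (intro q_commute) auto
      finally show "q l (f i - f j) < e" using d[OF ij(1)] d[OF ij(2)] N N0 by linarith
    qed
  qed (use f in auto)
  have "q (k i) (g - f i) \<le> \<delta> i" for i
  proof -
    have lim: "(\<lambda>j. q (k i) (f j - g) + \<delta> i) \<longlonglongrightarrow> 0 + \<delta> i"
      using g(2) by (intro tendsto_intros) (simp add: Em_tendsto_def)
    have "q (k i) (g - f i) \<le> q (k i) (f j - g) + \<delta> i" if "j \<ge> i" for j
    proof -
      have "q (k i) (g - f i) \<le> q (k i) (g - f j) + q (k i) (f j - f i)"
        using f g by (intro q_triangle) auto
      also have "q (k i) (g - f j) = q (k i) (f j - g)" using f g by (intro q_commute) auto
      finally show ?thesis using ball[OF that] f(2)[of j] by linarith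
    qed
    then have "q (k i) (g - f i) \<le> 0 + \<delta> i" by (intro LIMSEQ_le_const[OF lim]) blast
    then show ?thesis by simp
  qed
  then have "real i < q n (P g)" for i
    using X(3)[of i] g(1) by (simp add: avoid_def X_eq)
  then show False using reals_Archimedean2[of "q n (P g)"] by (meson less_asym)
qed

lemma in_closure_cscale:
  assumes "in_closure n t f" "c > 0" "f \<in> Em m"
  shows "in_closure n (c * t) (cscale (of_real c) f)"
  unfolding in_closure_def
proof (intro allI impI)
  fix k and e :: real assume "e > 0"
  then have "e / c > 0" using assms by simp
  then obtain g where g: "g \<in> Em m" "q n (P g) \<le> t" "q k (f - g) < e / c"
    using assms(1) unfolding in_closure_def by blast
  have "q n (P (cscale (of_real c) g)) \<le> c * t"
    using g assms by (simp add: P_cscale q_cscale P_Em)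
  moreover have "cscale (of_real c) f - cscale (of_real c) g = cscale (of_real c) (f - g)"
    by (simp add: fun_eq_iff right_diff_distrib)
  then have "q k (cscale (of_real c) f - cscale (of_real c) g) < e"
    using g assms q_cscale[OF Em_diff[OF assms(3) g(1)], of k "of_real c"]
        by (simp add: field_simps)
  ultimately show "\<exists>g\<in>Em m. q n (P g) \<le> c * t \<and> q k (cscale (of_real c) f - g) < e"
    using Em_cscale[OF g(1)] by blast
qed

lemma in_closure_diff:
  assumes "in_closure n t f" "in_closure n t' f'" "f \<in> Em m" "f' \<in> Em m"
  shows "in_closure n (t + t') (f - f')"
  unfolding in_closure_def
proof (intro allI impI)
  fix k and e :: real assume "e > 0"
  then have "e / 2 > 0" by simp
  then obtain g g' where g: "g \<in> Em m" "q n (P g) \<le> t" "q k (f - g) < e / 2"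
    and g': "g' \<in> Em m" "q n (P g') \<le> t'" "q k (f' - g') < e / 2"
    using assms(1,2) unfolding in_closure_def by meson
  have "q n (P (g - g')) \<le> q n (P g) + q n (P g')" using g g' by (simp add: P_diff q_diff P_Em)
  moreover have eq: "(f - f') - (g - g') = (f - g) - (f' - g')" by simp
  have "q k ((f - f') - (g - g')) \<le> q k (f - g) + q k (f' - g')"
    unfolding eq by (rule q_diff[OF Em_diff[OF assms(3) g(1)] Em_diff[OF assms(4) g'(1)]])
  ultimately show "\<exists>g\<in>Em m. q n (P g) \<le> t + t' \<and> q k (f - f' - g) < e"
    using g g' by (intro bexI[of _ "g - g'"] Em_diff) auto
qed

text \<open>The ball is moved to the origin by writing \<open>f = (f0 + f) - f0\<close>, which
  doubles the bound; homogeneity then gives all \<open>t\<close> at once.\<close>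

lemma almost_open:
  "\<exists>k \<delta>. \<delta> > 0 \<and> (\<forall>t>0. \<forall>f\<in>Em m. q k f \<le> t * \<delta> \<longrightarrow> in_closure n t f)"
proof -
  obtain N f0 k \<delta> where *: "\<delta> > 0" "f0 \<in> Em m"
    "\<And>f. f \<in> Em m \<Longrightarrow> q k (f - f0) \<le> \<delta> \<Longrightarrow> in_closure n (real N) f" using closure_contains_ball[of n]
        by blast
  \<comment> \<open>Positive even for \<open>N = 0\<close>, since \<open>\<delta>\<close> is divided
    by it below.\<close>
  define M where "M = 2 * real N + 1"
  have M: "M > 0" by (simp add: M_def add_nonneg_pos)
  have ball: "in_closure n M f" if f: "f \<in> Em m" "q k f \<le> \<delta>" for f
  proof -
    have "in_closure n (real N) (f0 + f)"
      using f * csubspaceD(2)[OF Em_csubspace *(2) f(1)] by (intro *(3)) auto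
    moreover have "f0 - f0 = 0" by simp
    then have "in_closure n (real N) f0" using *(1,2) by (intro *(3))
        (simp_all only: snorm_zero less_imp_le)
    ultimately have "in_closure n (real N + real N) ((f0 + f) - f0)"
      using f * csubspaceD(2)[OF Em_csubspace *(2) f(1)] by (intro in_closure_diff) auto
    then have "in_closure n (real N + real N) f" by simp
    then show ?thesis unfolding in_closure_def M_def by (smt (verit, best))
  qed
  have "in_closure n t f" if t: "t > 0" and f: "f \<in> Em m" "q k f \<le> t * (\<delta> / M)" for t f
  proof -
    have "q k (cscale (of_real (M / t)) f) = M / t * q k f"
      using q_cscale[OF f(1), of k "of_real (M / t)"] M t by (simp only: norm_of_real) simp
    also have "\<dots> \<le> \<delta>" using f t M by (simp add: field_simps)
    finally have "in_closure n M (cscale (of_real (M / t)) f)" using f by (intro ball Em_cscale)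
    then have "in_closure n (t / M * M) (cscale (of_real (t / M)) (cscale (of_real (M / t)) f))"
      using f t M by (intro in_closure_cscale Em_cscale) auto
    moreover have "cscale (of_real (t / M)) (cscale (of_real (M / t)) f) = f"
      using M t by (simp add: fun_eq_iff)
    ultimately show ?thesis using M by simp
  qed
  then show ?thesis using *(1) M by (intro exI[of _ k] exI[of _ "\<delta> / M"]) auto
qed

text \<open>Successive approximation: peel off from the remainder \<open>r i\<close> a piece whose
  image is at most \<open>(1 / 2) ^ i\<close> in \<open>q (n + i)\<close>, leaving a remainder small
  enough for the next step. The images sum to a limit \<open>g\<close>, the pieces sum to
  \<open>f\<close>, and the closed graph gives \<open>P f = g\<close>.\<close>

lemma small_implies_bounded:
  "\<exists>k \<delta>. \<delta> > 0 \<and> (\<forall>f\<in>Em m. q k f \<le> \<delta> \<longrightarrow> q n (P f) \<le> 2)"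
proof -
  obtain k \<delta> where k\<delta>: "\<And>n. \<delta> n > 0" "\<And>n t f. t > 0 \<Longrightarrow> f \<in> Em m \<Longrightarrow> q (k n) f \<le> t * \<delta> n \<Longrightarrow>
      in_closure n t f"
    using almost_open by metis
  let ?t = "\<lambda>i. (1 / 2 :: real) ^ i"
  have "q n (P f) \<le> 2" if f: "f \<in> Em m" "q (k n) f \<le> \<delta> n" for f
  proof -
    define small where "small i r \<longleftrightarrow> r \<in> Em m \<and> q (k (n + i)) r \<le> ?t i * \<delta> (n + i) \<and> (i = 0 \<longrightarrow>
        r = f)" for i r
    have "\<exists>r. \<forall>i. small i (r i) \<and> (q (n + i) (P (r i - r (Suc i))) \<le> ?t i \<and> q i (r (Suc i)) \<le> ?t i)"
    proof (rule dependent_nat_choice)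
      show "\<exists>r. small 0 r" using f by (auto simp: small_def)
    next
      fix r i assume r: "small i r"
      then have rE: "r \<in> Em m" by (simp add: small_def)
      have "in_closure (n + i) (?t i) r" using r by (intro k\<delta>) (auto simp: small_def)
      moreover have "min (?t i) (?t (Suc i) * \<delta> (n + Suc i)) > 0" using k\<delta>(1) by simp
      \<comment> \<open>The index \<open>max i (k (n + Suc i))\<close> serves both demands on the
        remainder: tending to 0, and being small in the seminorm of the next step.\<close>
      ultimately obtain g where g: "g \<in> Em m" "q (n + i) (P g) \<le> ?t i"
        "q (max i (k (n + Suc i))) (r - g) < min (?t i) (?t (Suc i) * \<delta> (n + Suc i))"
        unfolding in_closure_def by blast
      have "q i (r - g) \<le> q (max i (k (n + Suc i))) (r - g)"
        "q (k (n + Suc i)) (r - g) \<le> q (max i (k (n + Suc i))) (r - g)"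
        using rE g by (auto intro!: exhaustion_mono Em_diff)
      moreover have "r - (r - g) = g" by simp
      ultimately show "\<exists>r'. small (Suc i) r' \<and> (q (n + i) (P (r - r')) \<le> ?t i \<and> q i r' \<le> ?t i)"
        using g rE by (intro exI[of _ "r - g"]) (simp add: small_def Em_diff)
    qed
    then obtain r where r: "\<And>i. small i (r i)" "\<And>i. q (n + i) (P (r i - r (Suc i))) \<le> ?t i"
      "\<And>i. q i (r (Suc i)) \<le> ?t i" by blast
    have rE: "r i \<in> Em m" for i using r(1)[of i] by (simp add: small_def)
    have r0: "r 0 = f" using r(1)[of 0] by (simp add: small_def)
    define S where "S i = P (f - r i)" for i
    have SE: "S i \<in> Em m" for i unfolding S_def using f rE by (intro P_Em Em_diff)
    have half: "(\<lambda>i. ?t i) \<longlonglongrightarrow> 0" by (rule LIMSEQ_power_zero) simp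
    \<comment> \<open>Geometric sum of the images of the pieces; \<open>q l\<close> is dominated
      once \<open>l \<le> n + i\<close>.\<close>
    have tail: "q l (S j - S i) \<le> 2 * ?t i - 2 * ?t j" if "i \<le> j" "l \<le> n + i" for i j l
      using that(1)
    proof (induction j rule: dec_induct)
      case base
      have "S i - S i = 0" by simp
      then show ?case by (simp only: snorm_zero)
    next
      case (step j)
      have "(f - r (Suc j)) - (f - r j) = r j - r (Suc j)" by simp
      then have "S (Suc j) - S j = P (r j - r (Suc j))"
        unfolding S_def using P_diff[OF Em_diff[OF f(1) rE[of "Suc j"]] Em_diff[OF f(1) rE[of j]]]
            by simp
      then have "q l (S (Suc j) - S j) \<le> q (n + j) (P (r j - r (Suc j)))"
        using that step rE by (simp only:) (intro exhaustion_mono P_Em Em_diff, auto)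
      moreover have "q l (S (Suc j) - S i) \<le> q l (S (Suc j) - S j) + q l (S j - S i)"
        using SE by (intro q_triangle)
      ultimately show ?case using step r(2)[of j] by (simp add: fun_diff_def)
    qed
    obtain g where g: "g \<in> Em m" "Em_tendsto m S g"
    proof (rule Em_sequentially_complete[of S m])
      fix l and e :: real assume e: "e > 0"
      obtain N0 where N0: "?t N0 < e / 4" using real_arch_pow_inv[of "e / 4" "1 / 2"] e by auto
      define N where "N = max N0 l"
      have N: "?t N \<le> ?t N0" unfolding N_def by (intro power_decreasing) auto
      have "l \<le> n + N" by (simp add: N_def)
      have d: "q l (S i - S N) \<le> 2 * ?t N" if "N \<le> i" for i
        using tail[OF that \<open>l \<le> n + N\<close>] zero_le_power[of "1 / 2 :: real" i] by linarith
      show "\<exists>N. \<forall>i\<ge>N. \<forall>j\<ge>N. q l (S i - S j) < e"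
      proof (intro exI[of _ N] allI impI)
        fix i j assume ij: "N \<le> i" "N \<le> j"
        have "q l (S i - S j) \<le> q l (S i - S N) + q l (S N - S j)" using SE by (intro q_triangle)
        also have "q l (S N - S j) = q l (S j - S N)" using SE by (intro q_commute)
        finally show "q l (S i - S j) < e" using d[OF ij(1)] d[OF ij(2)] N N0 by linarith
      qed
    qed (use SE in auto)
    have "Em_tendsto m (\<lambda>i. f - r i) f"
      unfolding Em_tendsto_def
    proof
      fix l
      show "(\<lambda>i. q l (f - r i - f)) \<longlonglongrightarrow> 0"
      proof (rule LIMSEQ_offset[of _ "Suc l"], rule Lim_null_comparison)
        show "(\<lambda>i. ?t (i + l)) \<longlonglongrightarrow> 0" using half by (rule LIMSEQ_ignore_initial_segment)
        show "\<forall>\<^sub>F i in sequentially. norm (q l (f - r (i + Suc l) - f)) \<le> ?t (i + l)"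
        proof (intro always_eventually allI)
          fix i
          have "q l (f - r (i + Suc l) - f) = q l (r (i + Suc l))"
          proof -
            have "f - r (i + Suc l) - f = cscale (- 1) (r (i + Suc l))" by (simp add: fun_eq_iff)
            then show ?thesis using q_cscale[OF rE, of l "- 1" "i + Suc l"] by simp
          qed
          also have "\<dots> \<le> q (i + l) (r (i + Suc l))" using rE by (intro exhaustion_mono) auto
          also have "\<dots> \<le> ?t (i + l)" using r(3)[of "i + l"] by simp
          finally show "norm (q l (f - r (i + Suc l) - f)) \<le> ?t (i + l)"
            using exhaustion_nonneg[OF Em_diff[OF Em_diff[OF f(1) rE] f(1)], of l "i + Suc l"]
            by simp
        qed
      qed
    qed
    then have "P f = g"
      using g f rE by (intro closed_graph[of "\<lambda>i. f - r i"] Em_diff) (auto simp: S_def[abs_def])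
    have "S 0 = 0"
      unfolding S_def r0 using lin_on_0[OF lin_P Em_csubspace] by simp
    then have "S i - S 0 = S i" for i by simp
    then have "q n (S i) \<le> 2 - 2 * ?t i" for i using tail[of 0 i n] by simp
    moreover have "?t i \<ge> 0" for i by simp
    ultimately have S2: "q n (S i) \<le> 2" for i by (smt (verit, best))
    have "q n g \<le> q n (S i - g) + 2" for i
    proof -
      have "q n (S i - (S i - g)) \<le> q n (S i) + q n (S i - g)" using SE g by (intro q_diff Em_diff)
      moreover have "S i - (S i - g) = g" by simp
      ultimately show ?thesis using S2[of i] by simp
    qed
    moreover have "(\<lambda>i. q n (S i - g) + 2) \<longlonglongrightarrow> 0 + 2"
      using g(2) by (intro tendsto_intros) (simp add: Em_tendsto_def)
    ultimately have "q n g \<le> 0 + 2" by (intro LIMSEQ_le_const) auto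
    then show ?thesis by (simp add: \<open>P f = g\<close>)
  qed
  then show ?thesis using k\<delta>(1) by blast
qed

theorem projection_bounded:
  "\<exists>k C. C \<ge> 0 \<and> (\<forall>f\<in>Em m. q n (P f) \<le> C * q k f)"
proof -
  obtain k \<delta> where k: "\<delta> > 0" "\<And>f. f \<in> Em m \<Longrightarrow> q k f \<le> \<delta> \<Longrightarrow> q n (P f) \<le> 2"
    using small_implies_bounded[of n] by blast
  have "q n (P f) \<le> 2 / \<delta> * q k f" if f: "f \<in> Em m" for f
  proof (rule field_le_epsilon)
    fix e :: real assume e: "e > 0"
    have q0: "q k f \<ge> 0" using f by (rule exhaustion_nonneg)
    \<comment> \<open>The term with \<open>e\<close> keeps \<open>a\<close> positive when
      \<open>q k f = 0\<close>, so that \<open>f\<close> can be rescaled.\<close>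
    define a where "a = q k f + e * \<delta> / 2"
    have a: "a > 0" "q k f \<le> a" using q0 e k by (simp_all add: a_def add_nonneg_pos)
    let ?c = "complex_of_real (\<delta> / a)"
    have c: "norm ?c = \<delta> / a" using a k by (simp only: norm_of_real) simp
    have "q k (cscale ?c f) \<le> \<delta>" unfolding q_cscale[OF f] c using a k by (simp add: field_simps)
    then have "q n (P (cscale ?c f)) \<le> 2" using f by (intro k Em_cscale)
    then have "\<delta> / a * q n (P f) \<le> 2" unfolding P_cscale[OF f] q_cscale[OF P_Em[OF f]] c .
    then have "q n (P f) \<le> 2 / \<delta> * a" using a k by (simp add: field_simps)
    also have "\<dots> = 2 / \<delta> * q k f + e" using k by (simp add: a_def field_simps)
    finally show "q n (P f) \<le> 2 / \<delta> * q k f + e" .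
  qed
  then show ?thesis using k(1) by (intro exI[of _ k] exI[of _ "2 / \<delta>"]) auto
qed

end

section \<open>Complements and sections\<close>

lemma topspace_Em_top [simp]: "topspace (Em_top m) = Em m"
  unfolding Em_top_def by (rule topspace_seminorm_topology[OF Em_seminorm_space])

lemma Whitney_csubspace: "csubspace (Whitney X m)"
  unfolding csubspace_def using Whitney_0 Whitney_add Whitney_cscale by blast

lemma Whitney_seminorm_space:
  assumes "compact X"
  shows "seminorm_space (Whitney X m) {Whitney_norm X m}"
  unfolding seminorm_space_def
  using assms by (auto simp: Whitney_csubspace intro: Whitney_norm_add)

lemma dual_csubspace: "csubspace (dual S tp)"
  unfolding csubspace_def dual_def lin_on_def
  by (auto simp: continuous_map_atin algebra_simps plus_fun_def zero_fun_def cscale_fun_def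
      intro: tendsto_add tendsto_mult_left)

lemma weak_star_seminorm_space:
  "S \<noteq> {} \<Longrightarrow> seminorm_space (dual S tp) ((\<lambda>f \<psi>. norm (\<psi> f)) ` S)"
  unfolding seminorm_space_def by (auto simp: dual_csubspace intro: norm_triangle_ineq)

lemma topspace_weak_star: "S \<noteq> {} \<Longrightarrow> topspace (weak_star S tp) = dual S tp"
  unfolding weak_star_def by (rule topspace_seminorm_topology[OF weak_star_seminorm_space])

lemma continuous_map_complexI:
  fixes \<phi> :: "'a \<Rightarrow> complex"
  assumes "\<And>x e. x \<in> topspace T \<Longrightarrow> e > 0 \<Longrightarrow> \<exists>U. openin T U \<and> x \<in> U \<and> (\<forall>y\<in>U. norm (\<phi> y - \<phi> x) < e)"
  shows "continuous_map T euclidean \<phi>"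
  unfolding continuous_map_atin limitin_canonical_iff tendsto_iff dist_norm
proof (intro ballI allI impI)
  fix x and e :: real assume "x \<in> topspace T" "e > 0"
  then obtain U where "openin T U" "x \<in> U" "\<forall>y\<in>U. norm (\<phi> y - \<phi> x) < e" using assms by meson
  then show "\<forall>\<^sub>F y in atin T x. norm (\<phi> y - \<phi> x) < e"
    unfolding eventually_atin by blast
qed

lemma Em_apply_le: "f \<in> Em m \<Longrightarrow> norm (f x) \<le> snorm {x} 0 f"
  using norm_ipartial_le_snorm[of m f 0 "{x}" "[]" x] by (simp add: Em_def)

lemma continuous_map_eval:
  fixes x :: "real^'n::finite"
  shows "continuous_map (Em_top m) euclidean (\<lambda>f. f x)"
proof (rule continuous_map_complexI, unfold topspace_Em_top)
  fix f :: "real^'n \<Rightarrow> complex" and e :: real assume f: "f \<in> Em m" and e: "e > 0"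
  let ?U = "{g\<in>Em m. snorm {x} 0 (g - f) < e}"
  have "openin (Em_top m) ?U"
    unfolding Em_top_def using f e by (intro openin_seminorm_ball) (auto intro!: exI[of _ "{x}"])
  moreover have "norm (g x - f x) < e" if "g \<in> ?U" for g
    using Em_apply_le[OF Em_diff, of g m f x] f that by simp
  moreover have "f \<in> ?U" using f e by simp
  ultimately show "\<exists>U. openin (Em_top m) U \<and> f \<in> U \<and> (\<forall>g\<in>U. norm (g x - f x) < e)" by blast
qed

lemma closedin_Em_tendsto:
  assumes D: "closedin (Em_top m) D" and F: "\<And>i. F i \<in> D" and f: "f \<in> Em m" and lim: "Em_tendsto m F
      f"
  shows "f \<in> D"
proof (rule ccontr)
  assume "f \<notin> D"
  have DE: "D \<subseteq> Em m" using closedin_subset[OF D] by simp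
  have "openin (Em_top m) (Em m - D)" using D by (simp add: closedin_def)
  moreover have "f \<in> Em m - D" using f \<open>f \<notin> D\<close> by simp
  ultimately obtain Q e where Q: "finite Q" "Q \<subseteq> {snorm K k | K k. compact K \<and> k \<le> m}" "e > 0"
    "{y\<in>Em m. \<forall>p\<in>Q. p (y - f) < e} \<subseteq> Em m - D"
    using seminorm_nbhd[OF Em_seminorm_space, of m "Em m - D" f] unfolding Em_top_def by blast
  have "\<forall>\<^sub>F i in sequentially. p (F i - f) < e" if p: "p \<in> Q" for p
  proof -
    obtain K k where K: "p = snorm K k" "compact K" "k \<le> m" using Q(2) p by blast
    obtain n where n: "\<And>f k. f \<in> Em m \<Longrightarrow> k \<le> m \<Longrightarrow> snorm K k f \<le> exhaustion m n f"
      using snorm_le_exhaustion[OF K(2)] by blast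
    have "\<forall>\<^sub>F i in sequentially. exhaustion m n (F i - f) < e"
      using lim Q(3) unfolding Em_tendsto_def by (intro order_tendstoD(2)) auto
    then show ?thesis
    proof eventually_elim
      case (elim i)
      have "F i - f \<in> Em m" using DE F f by (intro Em_diff) auto
      then show ?case using n[OF _ K(3), of "F i - f"] elim K(1) by simp
    qed
  qed
  then have "\<forall>\<^sub>F i in sequentially. \<forall>p\<in>Q. p (F i - f) < e"
    using Q(1) by (intro eventually_ball_finite) auto
  then have "\<exists>i. \<forall>p\<in>Q. p (F i - f) < e" by (rule eventually_happens'[OF sequentially_bot])
  then obtain i where i: "\<forall>p\<in>Q. p (F i - f) < e" by (elim exE)
  have "F i \<in> {y\<in>Em m. \<forall>p\<in>Q. p (y - f) < e}" using subsetD[OF DE F] i by (intro CollectI conjI)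
  then show False using subsetD[OF Q(4)] F[of i] by blast
qed

section \<open>The ideal and the continuity of the jet map\<close>

lemma Ideal_iff: "f \<in> Ideal X m \<longleftrightarrow> f \<in> Em m \<and> Jm X m f = 0"
  by (auto simp: Ideal_def Jm_def fun_eq_iff)

lemma Jm_0: "Jm X m 0 = 0"
  using Jm_cscale[of m 0 X 0] Ck_const[of m 0] by (simp add: cscale_zero_left
      zero_fun_def[symmetric])

lemma lin_Jm: "lin_on (Em m) (Jm X m)"
  by (simp add: lin_on_def Em_def Jm_add Jm_cscale)

lemma Ideal_csubspace:
  fixes X :: "(real^'n::finite) set"
  shows "csubspace (Ideal X m)"
proof -
  have "cscale c (0 :: ('n \<Rightarrow> nat) \<Rightarrow> real^'n \<Rightarrow> complex) = 0" for c by (simp add: fun_eq_iff)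
  then show ?thesis
    unfolding csubspace_def
    using csubspaceD[OF Em_csubspace[of m, where ?'a = 'n]] lin_on_add[OF lin_Jm[of m X]]
      lin_on_cscale[OF lin_Jm[of m X]] Jm_0[of X m]
    by (auto simp: Ideal_iff)
qed

lemma Ideal_subset: "Ideal X m \<subseteq> Em m"
  by (auto simp: Ideal_def)

lemma topspace_Ideal_top [simp]: "topspace (Ideal_top X m) = Ideal X m"
  using Ideal_subset by (auto simp: Ideal_top_def)

lemma Ideal_Em_tendsto:
  fixes X :: "(real^'n::finite) set"
  assumes F: "\<And>i. F i \<in> Ideal X m" and f: "f \<in> Em m" and lim: "Em_tendsto m F f"
  shows "f \<in> Ideal X m"
  unfolding Ideal_def
proof (intro CollectI conjI f allI impI)
  fix \<nu> :: "'n \<Rightarrow> nat" and x assume \<nu>: "mlen \<nu> \<le> m \<and> x \<in> X"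
  obtain xs where xs: "length xs = mlen \<nu>" "\<And>f. mpartial \<nu> f = ipartial xs f"
    using mpartial_ipartial_ex by metis
  obtain n where n: "norm x \<le> real n" using real_arch_simple by blast
  have "norm (mpartial \<nu> f x) \<le> exhaustion m n (F i - f)" for i
  proof -
    have FE: "F i \<in> Em m" using F Ideal_subset by blast
    have "mpartial \<nu> (F i) x = 0" using F[of i] \<nu> by (simp add: Ideal_def)
    then have "mpartial \<nu> (F i - f) x = - mpartial \<nu> f x"
      using FE f \<nu> xs by (simp add: Em_def fun_diff_def ipartial_diff[of m])
    moreover have "norm (ipartial xs (F i - f) x) \<le> exhaustion m n (F i - f)"
      using \<nu> xs n Em_diff[OF FE f] by (intro norm_ipartial_le_snorm[where m
          = m]) (auto simp: Em_def)
    ultimately show ?thesis using xs by simp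
  qed
  moreover have "(\<lambda>i. exhaustion m n (F i - f)) \<longlonglongrightarrow> 0" using lim by (simp add: Em_tendsto_def)
  ultimately have "norm (mpartial \<nu> f x) \<le> 0" by (intro LIMSEQ_le_const) auto
  then show "mpartial \<nu> f x = 0" by simp
qed

lemma continuous_map_Jm:
  assumes "compact X"
  shows "continuous_map (Em_top m) (Whitney_top X m) (Jm X m)"
  unfolding Em_top_def Whitney_top_def
proof (rule continuous_map_seminorm_bounded[OF Em_seminorm_space Whitney_seminorm_space[OF assms]])
  show "Jm X m f \<in> Whitney X m" if "f \<in> Em m" for f
    using that assms by (auto simp: Em_def intro: Jm_Whitney)
  fix p' assume "p' \<in> {Whitney_norm X m}"
  obtain K C where K: "compact K" "C \<ge> 0" "\<And>f. Ck m f \<Longrightarrow> Whitney_norm X m (Jm X m f)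
      \<le> C * snorm K m f"
    using Jm_bounded[OF assms] by blast
  show "\<exists>p\<in>{snorm K k |K k. compact K \<and> k \<le> m}. \<exists>C\<ge>0. \<forall>f\<in>Em m. p' (Jm X m f) \<le> C * p f"
  proof (rule bexI[of _ "snorm K m"])
    show "\<exists>C\<ge>0. \<forall>f\<in>Em m. p' (Jm X m f) \<le> C * snorm K m f"
      using K(2,3) \<open>p' \<in> _\<close> by (auto simp: Em_def)
  qed (use K in auto)
qed (rule lin_Jm)

context
  fixes X :: "(real^'n::finite) set" and m :: nat
  assumes X: "compact X"
begin

lemma section_facts:
  assumes T: "T \<in> jet_sections X m"
  shows "F \<in> Whitney X m \<Longrightarrow> T F \<in> Em m" "F \<in> Whitney X m \<Longrightarrow> Jm X m (T F) = F"
    "lin_on (Whitney X m) T" "continuous_map (Whitney_top X m) (Em_top m) T"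
    "f \<in> Em m \<Longrightarrow> T (Jm X m f) \<in> Em m" "f \<in> Em m \<Longrightarrow> f - T (Jm X m f) \<in> Ideal X m"
proof -
  show *: "F \<in> Whitney X m \<Longrightarrow> T F \<in> Em m" "F \<in> Whitney X m \<Longrightarrow> Jm X m (T F) = F"
    "lin_on (Whitney X m) T" "continuous_map (Whitney_top X m) (Em_top m) T" for F
    using T by (auto simp: jet_sections_def)
  assume f: "f \<in> Em m"
  then have J: "Jm X m f \<in> Whitney X m" using Jm_Whitney X by (auto simp: Em_def)
  then show TJ: "T (Jm X m f) \<in> Em m" by (rule *)
  have "Jm X m (f - T (Jm X m f)) = 0"
    using lin_on_diff[OF lin_Jm Em_csubspace f TJ] *(2)[OF J] by simp
  then show "f - T (Jm X m f) \<in> Ideal X m" using Em_diff[OF f TJ] by (simp add: Ideal_iff)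
qed

lemma section_Jm_continuous:
  assumes T: "T \<in> jet_sections X m"
  shows "continuous_map (Em_top m) (Em_top m) (\<lambda>f. T (Jm X m f))"
  using continuous_map_compose[OF continuous_map_Jm[OF X] section_facts(4)[OF T]]
      by (simp add: o_def)

lemma section_range_complement:
  assumes T: "T \<in> jet_sections X m"
  shows "T ` Whitney X m \<in> complements X m"
proof -
  note TF = section_facts[OF T]
  have J: "Jm X m f \<in> Whitney X m" if "f \<in> Em m" for f
    using that Jm_Whitney X by (auto simp: Em_def)
  have range: "T ` Whitney X m = {f \<in> Em m. T (Jm X m f) = f}"
    using TF(1,2) J by (force simp: image_iff)
  \<comment> \<open>The range is the fixed set of \<open>T\<close> composed with the jet map.
    Comparing values at each point makes it an intersection of equalizers of continuous complex
    functionals, so the Hausdorff property is used for \<open>complex\<close> only.\<close>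
  have "T ` Whitney X m = (\<Inter>x. {f \<in> topspace (Em_top m). T (Jm X m f) x = f x})"
    unfolding range by (auto simp: fun_eq_iff)
  moreover have "closedin (Em_top m) \<dots>"
    using continuous_map_compose[OF section_Jm_continuous[OF T] continuous_map_eval]
    by (intro closedin_INT closedin_continuous_maps_eq[of euclidean] continuous_map_eval)
        (auto simp: o_def)
  ultimately have "closedin (Em_top m) (T ` Whitney X m)" by simp
  moreover have "0 \<in> T ` Whitney X m"
    using lin_on_0[OF TF(3) Whitney_csubspace] Whitney_0 by (metis image_eqI)
  moreover have "\<forall>f\<in>T ` Whitney X m. \<forall>g\<in>T ` Whitney X m. f + g \<in> T ` Whitney X m"
  proof (clarify)
    fix F G assume FG: "F \<in> Whitney X m" "G \<in> Whitney X m"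
    show "T F + T G \<in> T ` Whitney X m"
      using lin_on_add[OF TF(3) FG] Whitney_add[OF FG] by (rule image_eqI[OF sym])
  qed
  moreover have "\<forall>c. \<forall>f\<in>T ` Whitney X m. cscale c f \<in> T ` Whitney X m"
  proof (clarify)
    fix c F assume F: "F \<in> Whitney X m"
    show "cscale c (T F) \<in> T ` Whitney X m"
      using lin_on_cscale[OF TF(3) F] Whitney_cscale[OF F] by (rule image_eqI[OF sym])
  qed
  moreover have "Ideal X m \<inter> T ` Whitney X m = {0}"
  proof -
    have "T F = 0" if "F \<in> Whitney X m" "T F \<in> Ideal X m" for F
      using that TF(2)[OF that(1)] lin_on_0[OF TF(3) Whitney_csubspace] by (simp add: Ideal_iff)
    then show ?thesis using \<open>0 \<in> T ` Whitney X m\<close> csubspaceD(1)[OF Ideal_csubspace, of X m] by auto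
  qed
  moreover have "\<exists>g\<in>Ideal X m. \<exists>h\<in>T ` Whitney X m. f = g + h" if "f \<in> Em m" for f
    using TF(6)[OF that] J[OF that] by (intro bexI[of _ "f - T (Jm X m f)"] bexI[of _ "T (Jm X m
        f)"]) auto
  moreover have "T ` Whitney X m \<subseteq> Em m" using TF(1) by auto
  ultimately show ?thesis unfolding complements_def by blast
qed

text \<open>\<open>Jm X m\<close> recovers the argument from a value of a section, so equal values
  in a common range have equal arguments.\<close>

lemma section_range_inj: "inj_on (\<lambda>T. T ` Whitney X m) (jet_sections X m)"
proof (rule inj_onI)
  fix T1 T2 assume T: "T1 \<in> jet_sections X m" "T2 \<in> jet_sections X m"
    and eq: "T1 ` Whitney X m = T2 ` Whitney X m"
  show "T1 = T2"
  proof (rule extensionalityI)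
    show "T1 \<in> extensional (Whitney X m)" "T2 \<in> extensional (Whitney X m)"
      using T by (auto simp: jet_sections_def)
    fix F assume F: "F \<in> Whitney X m"
    then obtain G where G: "G \<in> Whitney X m" "T1 F = T2 G" using eq by blast
    then have "F = G"
      using section_facts(2)[OF T(1) F] section_facts(2)[OF T(2) G(1)] by simp
    then show "T1 F = T2 F" using G(2) by simp
  qed
qed

lemma complement_is_section_range:
  assumes D: "D \<in> complements X m"
  shows "\<exists>T\<in>jet_sections X m. T ` Whitney X m = D"
proof -
  have DE: "D \<subseteq> Em m" and Dcl: "closedin (Em_top m) D" and D0: "Ideal X m \<inter> D = {0}"
    and dec: "\<And>f. f \<in> Em m \<Longrightarrow> \<exists>g\<in>Ideal X m. \<exists>h\<in>D. f = g + h" and Dsub: "csubspace D"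
    using D by (auto simp: complements_def csubspace_def)
  have "\<exists>g. g \<in> Ideal X m \<and> f - g \<in> D" if f: "f \<in> Em m" for f
  proof -
    obtain g h where "g \<in> Ideal X m" "h \<in> D" "f = g + h" using dec[OF f] by blast
    then show ?thesis by (intro exI[of _ g]) simp
  qed
  then obtain \<pi> where \<pi>: "\<And>f. f \<in> Em m \<Longrightarrow> \<pi> f \<in> Ideal X m \<and> f - \<pi> f \<in> D" by metis
  have uniq: "\<pi> f = g" if f: "f \<in> Em m" and g: "g \<in> Ideal X m" "f - g \<in> D" for f g
  proof -
    have "(f - g) - (f - \<pi> f) \<in> D" by (rule csubspaceD(5)[OF Dsub g(2) conjunct2[OF \<pi>[OF f]]])
    then have "\<pi> f - g \<in> D" by simp
    moreover have "\<pi> f - g \<in> Ideal X m" using \<pi>[OF f] g by (intro csubspaceD(5)[OF Ideal_csubspace])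
        auto
    ultimately have "\<pi> f - g = 0" using D0 by blast
    then show ?thesis by simp
  qed
  have \<pi>E: "\<pi> f \<in> Em m" if "f \<in> Em m" for f using \<pi>[OF that] Ideal_subset by blast
  have lin: "lin_on (Em m) \<pi>"
    unfolding lin_on_def
  proof (intro conjI ballI allI)
    fix f g :: "real^'n \<Rightarrow> complex" assume fg: "f \<in> Em m" "g \<in> Em m"
    have eq: "f + g - (\<pi> f + \<pi> g) = (f - \<pi> f) + (g - \<pi> g)" by simp
    have "(f - \<pi> f) + (g - \<pi> g) \<in> D" using \<pi> fg by (intro csubspaceD(2)[OF Dsub]) auto
    moreover have "\<pi> f + \<pi> g \<in> Ideal X m" using \<pi> fg by (intro csubspaceD(2)[OF Ideal_csubspace])
        auto
    ultimately show "\<pi> (f + g) = \<pi> f + \<pi> g"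
      by (intro uniq csubspaceD(2)[OF Em_csubspace] fg) (simp_all only: eq)
  next
    fix f :: "real^'n \<Rightarrow> complex" and c assume f: "f \<in> Em m"
    have eq: "cscale c f - cscale c (\<pi> f) = cscale c (f - \<pi> f)"
        by (simp add: fun_eq_iff right_diff_distrib)
    have "cscale c (f - \<pi> f) \<in> D" using \<pi>[OF f] by (intro csubspaceD(3)[OF Dsub]) auto
    moreover have "cscale c (\<pi> f) \<in> Ideal X m" using \<pi>[OF f] by (intro csubspaceD(3)[OF
        Ideal_csubspace]) auto
    ultimately show "\<pi> (cscale c f) = cscale c (\<pi> f)"
      by (intro uniq csubspaceD(3)[OF Em_csubspace] f) (simp_all only: eq)
  qed
  \<comment> \<open>Closed graph: the limit \<open>g\<close> stays in the ideal,
    \<open>f - g\<close> stays in the closed set \<open>D\<close>, and the decomposition is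
    unique.\<close>
  interpret closed_graph_projection m \<pi>
  proof
    fix F f g assume F: "\<And>i. F i \<in> Em m" and fg: "f \<in> Em m" "g \<in> Em m"
      and lim: "Em_tendsto m F f" "Em_tendsto m (\<lambda>i. \<pi> (F i)) g"
    have g: "g \<in> Ideal X m" using \<pi> F by (intro Ideal_Em_tendsto[OF _ fg(2) lim(2)]) auto
    have "Em_tendsto m (\<lambda>i. F i - \<pi> (F i)) (f - g)"
      unfolding Em_tendsto_def
    proof
      fix n
      show "(\<lambda>i. exhaustion m n (F i - \<pi> (F i) - (f - g))) \<longlonglongrightarrow> 0"
      proof (rule Lim_null_comparison)
        show "(\<lambda>i. exhaustion m n (F i - f) + exhaustion m n (\<pi> (F i) - g)) \<longlonglongrightarrow> 0"
          using lim unfolding Em_tendsto_def by (intro tendsto_add_zero) auto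
        show "\<forall>\<^sub>F i in sequentially. norm (exhaustion m n (F i - \<pi> (F i) - (f - g)))
            \<le> exhaustion m n (F i - f) + exhaustion m n (\<pi> (F i) - g)"
        proof (intro always_eventually allI)
          fix i
          have eq: "F i - \<pi> (F i) - (f - g) = (F i - f) - (\<pi> (F i) - g)" by simp
          have "exhaustion m n ((F i - f) - (\<pi> (F i) - g)) \<le> exhaustion m n (F i - f) + exhaustion m
            n (\<pi> (F i) - g)"
            using F fg \<pi>E by (intro snorm_triangle Em_diff) auto
          moreover have "0 \<le> exhaustion m n ((F i - f) - (\<pi> (F i) - g))"
            using F fg \<pi>E by (intro exhaustion_nonneg Em_diff) auto
          ultimately show "norm (exhaustion m n (F i - \<pi> (F i) - (f - g)))
            \<le> exhaustion m n (F i - f) + exhaustion m n (\<pi> (F i) - g)"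
            unfolding eq by simp
        qed
      qed
    qed
    then have "f - g \<in> D" using F \<pi> fg by (intro closedin_Em_tendsto[OF Dcl _ Em_diff]) auto
    then show "\<pi> f = g" using fg g by (intro uniq)
  qed (use \<pi>E lin in auto)
  obtain W where W: "\<And>F. F \<in> Whitney X m \<Longrightarrow> W F \<in> Em m" "lin_on (Whitney X m) W"
    "\<And>F. F \<in> Whitney X m \<Longrightarrow> Jm X m (W F) = F"
    "\<And>Y. compact Y \<Longrightarrow> \<exists>C\<ge>0. \<forall>F\<in>Whitney X m. snorm Y m (W F) \<le> C * Whitney_norm X m F"
    using Whitney_extension[OF X] by metis
  \<comment> \<open>Correcting \<open>W\<close> by an element of the ideal leaves the jet unchanged
    and moves the value into \<open>D\<close>.\<close>
  define T where "T = restrict (\<lambda>F. W F - \<pi> (W F)) (Whitney X m)"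
  have T: "T F = W F - \<pi> (W F)" if "F \<in> Whitney X m" for F using that by (simp add: T_def)
  have TE: "T F \<in> Em m" if "F \<in> Whitney X m" for F using T W(1) \<pi>E that by (simp add: Em_diff)
  have linT: "lin_on (Whitney X m) T"
    unfolding lin_on_def
  proof (intro conjI ballI allI)
    fix F G assume FG: "F \<in> Whitney X m" "G \<in> Whitney X m"
    have "T (F + G) = (W F + W G) - (\<pi> (W F) + \<pi> (W G))"
      by (simp only: T[OF Whitney_add[OF FG]] lin_on_add[OF W(2) FG] lin_on_add[OF lin W(1)[OF
          FG(1)] W(1)[OF FG(2)]])
    then show "T (F + G) = T F + T G" by (simp add: T FG)
  next
    fix F c assume F: "F \<in> Whitney X m"
    have "T (cscale c F) = cscale c (W F) - cscale c (\<pi> (W F))"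
      by (simp only: T[OF Whitney_cscale[OF F]] lin_on_cscale[OF W(2) F] lin_on_cscale[OF lin
          W(1)[OF F]])
    then show "T (cscale c F) = cscale c (T F)" by (simp add: T F fun_eq_iff right_diff_distrib)
  qed
  have "continuous_map (Whitney_top X m) (Em_top m) T"
    unfolding Em_top_def Whitney_top_def
  proof (rule continuous_map_seminorm_bounded[OF Whitney_seminorm_space[OF X] Em_seminorm_space TE
      linT])
    fix p' :: "(real^'n \<Rightarrow> complex) \<Rightarrow> real" assume "p' \<in> {snorm K k |K k. compact K \<and> k \<le> m}"
    then obtain K k where K: "p' = snorm K k" "compact K" "k \<le> m" by blast
    obtain n where n: "\<And>f k. f \<in> Em m \<Longrightarrow> k \<le> m \<Longrightarrow> snorm K k f \<le> exhaustion m n f"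
      using snorm_le_exhaustion[OF K(2)] by blast
    obtain l C where C: "C \<ge> 0" "\<And>f. f \<in> Em m \<Longrightarrow> q n (\<pi> f) \<le> C * q l f" using projection_bounded
        by blast
    obtain C1 where C1: "C1 \<ge> 0" "\<And>F. F \<in> Whitney X m \<Longrightarrow> q n (W F) \<le> C1 * Whitney_norm X m F"
      using W(4)[of "cball 0 (real n)"] by auto
    obtain C2 where C2: "C2 \<ge> 0" "\<And>F. F \<in> Whitney X m \<Longrightarrow> q l (W F) \<le> C2 * Whitney_norm X m F"
      using W(4)[of "cball 0 (real l)"] by auto
    have "p' (T F) \<le> (C1 + C * C2) * Whitney_norm X m F" if F: "F \<in> Whitney X m" for F
    proof -
      have "p' (T F) \<le> q n (T F)" using n[OF TE[OF F] K(3)] K(1) by simp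
      also have "\<dots> \<le> q n (W F) + q n (\<pi> (W F))" unfolding T[OF F] using W(1)[OF F] \<pi>E
          by (intro q_diff) auto
      also have "q n (\<pi> (W F)) \<le> C * (C2 * Whitney_norm X m F)"
        using C(2)[OF W(1)[OF F]] mult_left_mono[OF C2(2)[OF F] C(1)] by linarith
      finally show ?thesis using C1(2)[OF F] by (simp add: algebra_simps)
    qed
    then show "\<exists>p\<in>{Whitney_norm X m}. \<exists>C\<ge>0. \<forall>F\<in>Whitney X m. p' (T F) \<le> C * p F"
      using C(1) C1(1) C2(1) by (auto intro!: exI[of _ "C1 + C * C2"])
  qed
  moreover have JT: "Jm X m (T F) = F" if F: "F \<in> Whitney X m" for F
  proof -
    have "Jm X m (\<pi> (W F)) = 0" using \<pi>[OF W(1)[OF F]] by (simp add: Ideal_iff)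
    then show ?thesis
      using lin_on_diff[OF lin_Jm Em_csubspace W(1)[OF F] \<pi>E[OF W(1)[OF F]], of X] W(3)[OF F]
          by (simp add: T[OF F])
  qed
  ultimately have Tsec: "T \<in> jet_sections X m"
    using TE linT by (auto simp: jet_sections_def T_def)
  have TD: "T F \<in> D" if "F \<in> Whitney X m" for F using \<pi>[OF W(1)[OF that]] T[OF that] by simp
  have "D \<subseteq> T ` Whitney X m"
  proof
    fix f assume f: "f \<in> D"
    then have fE: "f \<in> Em m" using DE by blast
    then have J: "Jm X m f \<in> Whitney X m" using Jm_Whitney X by (auto simp: Em_def)
    \<comment> \<open>For \<open>f\<close> in \<open>D\<close> this difference lies in
      \<open>D\<close> and in the ideal, hence is 0.\<close>
    have "f - T (Jm X m f) \<in> D" using f TD[OF J] by (intro csubspaceD(5)[OF Dsub])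
    then have "f - T (Jm X m f) = 0" using section_facts(6)[OF Tsec fE] D0 by blast
    then show "f \<in> T ` Whitney X m" using J by auto
  qed
  then have "T ` Whitney X m = D" using TD by blast
  then show ?thesis using Tsec by blast
qed

lemma jet_sections_complements:
  "bij_betw (\<lambda>T. T ` Whitney X m) (jet_sections X m) (complements X m)"
  unfolding bij_betw_def
  using section_range_inj section_range_complement complement_is_section_range by blast

lemma jet_sections_nonempty: "jet_sections X m \<noteq> {}"
proof -
  obtain W where W: "\<And>F. F \<in> Whitney X m \<Longrightarrow> W F \<in> Em m" "lin_on (Whitney X m) W"
    "\<And>F. F \<in> Whitney X m \<Longrightarrow> Jm X m (W F) = F"
    "\<And>Y. compact Y \<Longrightarrow> \<exists>C\<ge>0. \<forall>F\<in>Whitney X m. snorm Y m (W F) \<le> C * Whitney_norm X m F"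
    using Whitney_extension[OF X] by metis
  let ?T = "restrict W (Whitney X m)"
  have lin: "lin_on (Whitney X m) ?T"
    using W(2) by (auto simp: lin_on_def Whitney_add Whitney_cscale)
  have "continuous_map (Whitney_top X m) (Em_top m) ?T"
    unfolding Em_top_def Whitney_top_def
  proof (rule continuous_map_seminorm_bounded[OF Whitney_seminorm_space[OF X] Em_seminorm_space _
      lin])
    show "?T F \<in> Em m" if "F \<in> Whitney X m" for F using W(1) that by simp
    fix p' :: "(real^'n \<Rightarrow> complex) \<Rightarrow> real" assume "p' \<in> {snorm K k |K k. compact K \<and> k \<le> m}"
    then obtain K k where K: "p' = snorm K k" "compact K" "k \<le> m" by blast
    obtain C where C: "C \<ge> 0" "\<And>F. F \<in> Whitney X m \<Longrightarrow> snorm K m (W F) \<le> C * Whitney_norm X m F"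
      using W(4)[OF K(2)] by auto
    have "p' (?T F) \<le> C * Whitney_norm X m F" if "F \<in> Whitney X m" for F
      using C(2)[OF that] snorm_mono[of m "W F" k m K K] W(1)[OF that] K that by (simp add: Em_def)
    then show "\<exists>p\<in>{Whitney_norm X m}. \<exists>C\<ge>0. \<forall>F\<in>Whitney X m. p' (?T F) \<le> C * p F"
      using C(1) by auto
  qed
  then have "?T \<in> jet_sections X m" using lin W(1,3) by (auto simp: jet_sections_def)
  then show ?thesis by blast
qed

end

section \<open>Sections and their transposes\<close>

text \<open>Induction on \<open>G\<close>. If vanishing on \<open>G\<close> already forces vanishing
  at \<open>g\<close>, the coefficient of \<open>g\<close> can be 0. Otherwise some
  \<open>\<psi>0\<close> vanishes on \<open>G\<close> with \<open>\<psi>0 g = 1\<close>, and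
  subtracting \<open>L \<psi>0 * \<psi> g\<close> reduces to \<open>G\<close>.\<close>

lemma finite_kernel:
  fixes L :: "('a \<Rightarrow> complex) \<Rightarrow> complex"
  assumes V: "csubspace V" and "finite G" and "lin_on V L"
    and "\<And>\<psi>. \<psi> \<in> V \<Longrightarrow> (\<forall>g\<in>G. \<psi> g = 0) \<Longrightarrow> L \<psi> = 0"
  shows "\<exists>c. \<forall>\<psi>\<in>V. L \<psi> = (\<Sum>g\<in>G. c g * \<psi> g)"
  using assms(2-)
proof (induction G arbitrary: L)
  case (insert g G)
  show ?case
  proof (cases "\<forall>\<psi>\<in>V. (\<forall>h\<in>G. \<psi> h = 0) \<longrightarrow> \<psi> g = 0")
    case True
    have "\<exists>c. \<forall>\<psi>\<in>V. L \<psi> = (\<Sum>g\<in>G. c g * \<psi> g)"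
      using True insert.prems by (intro insert.IH) auto
    then obtain c where c: "\<And>\<psi>. \<psi> \<in> V \<Longrightarrow> L \<psi> = (\<Sum>g\<in>G. c g * \<psi> g)" by blast
    have "(\<Sum>h\<in>insert g G. (c(g := 0)) h * \<psi> h) = (\<Sum>h\<in>G. c h * \<psi> h)" for \<psi> :: "'a \<Rightarrow> complex"
      using insert.hyps by (auto intro: sum.cong)
    then show ?thesis using c by (intro exI[of _ "c(g := 0)"]) auto
  next
    case False
    then obtain \<psi>1 where \<psi>1: "\<psi>1 \<in> V" "\<forall>h\<in>G. \<psi>1 h = 0" "\<psi>1 g \<noteq> 0" by blast
    define \<psi>0 where "\<psi>0 = cscale (inverse (\<psi>1 g)) \<psi>1"
    have \<psi>0: "\<psi>0 \<in> V" "\<forall>h\<in>G. \<psi>0 h = 0" "\<psi>0 g = 1"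
      using \<psi>1 csubspaceD(3)[OF V] by (auto simp: \<psi>0_def)
    define L' where "L' \<psi> = L \<psi> - L \<psi>0 * \<psi> g" for \<psi>
    have "\<exists>c. \<forall>\<psi>\<in>V. L' \<psi> = (\<Sum>g\<in>G. c g * \<psi> g)"
    proof (rule insert.IH)
      show "lin_on V L'"
        unfolding lin_on_def
      proof (intro conjI ballI allI)
        fix \<phi> \<psi> and c assume \<phi>\<psi>: "\<phi> \<in> V" "\<psi> \<in> V"
        have "L' (\<phi> + \<psi>) = L \<phi> + L \<psi> - L \<psi>0 * (\<phi> g + \<psi> g)"
          by (simp only: L'_def lin_on_add[OF insert.prems(1) \<phi>\<psi>] plus_fun_apply)
        also have "\<dots> = L' \<phi> + L' \<psi>" by (simp add: L'_def algebra_simps)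
        finally show "L' (\<phi> + \<psi>) = L' \<phi> + L' \<psi>" .
      next
        fix \<phi> c assume \<phi>: "\<phi> \<in> V"
        show "L' (cscale c \<phi>) = cscale c (L' \<phi>)"
          by (simp add: L'_def lin_on_cscale[OF insert.prems(1) \<phi>] right_diff_distrib)
      qed
      fix \<psi> assume \<psi>: "\<psi> \<in> V" "\<forall>h\<in>G. \<psi> h = 0"
      have *: "cscale (\<psi> g) \<psi>0 \<in> V" using \<psi>0(1) by (rule csubspaceD(3)[OF V])
      have L0: "L (\<psi> - cscale (\<psi> g) \<psi>0) = 0"
        using \<psi> \<psi>0 by (intro insert.prems(2) csubspaceD(5)[OF V \<psi>(1) *]) auto
      show "L' \<psi> = 0"
        using L0[unfolded lin_on_diff[OF insert.prems(1) V \<psi>(1) *] lin_on_cscale[OF insert.prems(1)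
            \<psi>0(1)]]
        by (simp add: L'_def mult.commute)
    qed
    then obtain c where c: "\<And>\<psi>. \<psi> \<in> V \<Longrightarrow> L' \<psi> = (\<Sum>g\<in>G. c g * \<psi> g)" by blast
    have "(\<Sum>h\<in>insert g G. (c(g := L \<psi>0)) h * \<psi> h) = L \<psi>0 * \<psi> g + (\<Sum>h\<in>G. c h * \<psi> h)"
      for \<psi> :: "'a \<Rightarrow> complex"
    proof -
      have "(\<Sum>h\<in>G. (c(g := L \<psi>0)) h * \<psi> h) = (\<Sum>h\<in>G. c h * \<psi> h)"
        using insert.hyps by (intro sum.cong) auto
      then show ?thesis using insert.hyps by simp
    qed
    then have "L \<psi> = (\<Sum>h\<in>insert g G. (c(g := L \<psi>0)) h * \<psi> h)" if "\<psi> \<in> V" for \<psi>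
      using c[OF that] by (simp add: L'_def algebra_simps)
    then show ?thesis by blast
  qed
qed auto

lemma lin_on_sum:
  fixes u :: "'a::cvector \<Rightarrow> complex"
  assumes u: "lin_on S u" and S: "csubspace S" and "finite G" "G \<subseteq> S"
  shows "(\<Sum>g\<in>G. cscale (c g) g) \<in> S \<and> u (\<Sum>g\<in>G. cscale (c g) g) = (\<Sum>g\<in>G. c g * u g)"
  using assms(3,4)
proof (induction G)
  case empty
  then show ?case using csubspaceD(1)[OF S] lin_on_0[OF u S] by simp
next
  case (insert g G)
  then have g: "g \<in> S" "cscale (c g) g \<in> S" and G: "(\<Sum>g\<in>G. cscale (c g) g) \<in> S"
    using csubspaceD(3)[OF S] by auto
  show ?case
    using insert lin_on_add[OF u g(2) G] lin_on_cscale[OF u g(1)] csubspaceD(2)[OF S g(2) G] by simp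
qed

text \<open>A weak star neighbourhood of 0 constrains only finitely many values. If all of them
  vanish, every multiple of \<open>\<psi>\<close> stays in the neighbourhood, which forces
  \<open>L \<psi> = 0\<close>; \<open>finite_kernel\<close> then gives a combination of evaluations,
  that is, one evaluation at a point of \<open>S\<close>.\<close>

lemma weak_star_continuous_functional:
  assumes S: "csubspace S" and L: "lin_on (dual S tp) L"
    and cont: "\<And>e. e > 0 \<Longrightarrow> \<exists>U. openin (weak_star S tp) U \<and> 0 \<in> U \<and> (\<forall>\<psi>\<in>U. norm (L \<psi>) < e)"
  shows "\<exists>g\<in>S. \<forall>\<psi>\<in>dual S tp. L \<psi> = \<psi> g"
proof -
  have S0: "S \<noteq> {}" using csubspaceD(1)[OF S] by blast
  obtain U where U: "openin (weak_star S tp) U" "0 \<in> U" "\<And>\<psi>. \<psi> \<in> U \<Longrightarrow> norm (L \<psi>) < 1"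
    using cont[of 1] by auto
  obtain Q e where Q: "finite Q" "Q \<subseteq> (\<lambda>f \<psi>. norm (\<psi> f)) ` S" "e > 0"
    "{\<psi>\<in>dual S tp. \<forall>p\<in>Q. p (\<psi> - 0) < e} \<subseteq> U"
    using seminorm_nbhd[OF weak_star_seminorm_space[OF S0] U(1)[unfolded weak_star_def] U(2)]
    by (elim exE conjE)
  obtain G where G: "G \<subseteq> S" "finite G" "Q = (\<lambda>f \<psi>. norm (\<psi> f)) ` G"
    using finite_subset_image[OF Q(1,2)] by blast
  have "L \<psi> = 0" if \<psi>: "\<psi> \<in> dual S tp" "\<forall>g\<in>G. \<psi> g = 0" for \<psi>
  proof (rule ccontr)
    assume nz: "L \<psi> \<noteq> 0"
    let ?\<psi> = "cscale (inverse (L \<psi>)) \<psi>"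
    have "?\<psi> \<in> dual S tp" using \<psi>(1) by (rule csubspaceD(3)[OF dual_csubspace])
    moreover have "\<forall>p\<in>Q. p (?\<psi> - 0) < e" using \<psi>(2) Q(3) by (auto simp: G(3))
    ultimately have "norm (L ?\<psi>) < 1" using Q(4) by (intro U(3)) blast
    then show False using nz lin_on_cscale[OF L \<psi>(1)] by simp
  qed
  then obtain c where c: "\<And>\<psi>. \<psi> \<in> dual S tp \<Longrightarrow> L \<psi> = (\<Sum>g\<in>G. c g * \<psi> g)"
    using finite_kernel[OF dual_csubspace G(2) L] by blast
  have "lin_on S \<psi>" if "\<psi> \<in> dual S tp" for \<psi> using that by (simp add: dual_def)
  then have "L \<psi> = \<psi> (\<Sum>g\<in>G. cscale (c g) g)" if "\<psi> \<in> dual S tp" for \<psi>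
    using lin_on_sum[OF _ S G(2,1), of \<psi> c] c[OF that] that by simp
  moreover have "(\<Sum>g\<in>G. cscale (c g) g) \<in> S"
  proof -
    \<comment> \<open>The membership claim of \<open>lin_on_sum\<close> is read off with the zero
      functional.\<close>
    have "lin_on S (\<lambda>_. 0 :: complex)" by (simp add: lin_on_def)
    then show ?thesis using lin_on_sum[OF _ S G(2,1)] by blast
  qed
  ultimately show ?thesis by blast
qed

abbreviation Ideal_dual :: "(real^'n::finite) set \<Rightarrow> nat \<Rightarrow> ((real^'n \<Rightarrow> complex) \<Rightarrow> complex) set" where
  "Ideal_dual X m \<equiv> dual (Ideal X m) (Ideal_top X m)"

text \<open>The transpose of the projection onto the ideal that \<open>T\<close> defines. The value
  0 outside \<open>Em m\<close> and the restriction follow the conventions of \<open>dual\<close>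
  and \<open>dual_sections\<close>, so that equality of sections is equality of functions.\<close>

definition transposed_section :: "(real^'n::finite) set \<Rightarrow> nat
    \<Rightarrow> ((('n \<Rightarrow> nat) \<Rightarrow> real^'n \<Rightarrow> complex) \<Rightarrow> (real^'n \<Rightarrow> complex))
    \<Rightarrow> ((real^'n \<Rightarrow> complex) \<Rightarrow> complex) \<Rightarrow> ((real^'n \<Rightarrow> complex) \<Rightarrow> complex)" where
  "transposed_section X m T = restrict (\<lambda>\<psi> f. if f \<in> Em m then \<psi> (f - T (Jm X m f)) else 0)
      (Ideal_dual X m)"

text \<open>Point evaluations, set to 0 outside the ideal as \<open>dual\<close> requires, already
  separate.\<close>

lemma Ideal_separated:
  assumes f: "f \<in> Ideal X m" and zero: "\<And>\<psi>. \<psi> \<in> Ideal_dual X m \<Longrightarrow> \<psi> f = 0"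
  shows "f = 0"
proof
  fix x
  let ?\<psi> = "\<lambda>g. if g \<in> Ideal X m then g x else 0"
  have "lin_on (Ideal X m) ?\<psi>"
    using csubspaceD[OF Ideal_csubspace[of X m]] by (auto simp: lin_on_def)
  moreover have "continuous_map (Ideal_top X m) euclidean ?\<psi>"
    unfolding Ideal_top_def
    by (rule continuous_map_eq[OF continuous_map_from_subtopology[OF continuous_map_eval[where x
        = x]]]) auto
  ultimately have "?\<psi> \<in> Ideal_dual X m" by (simp add: dual_def)
  from zero[OF this] show "f x = 0 x" using f by simp
qed

context
  fixes X :: "(real^'n::finite) set" and m :: nat
  assumes X: "compact X"
begin

lemma Ideal_nonempty: "Ideal X m \<noteq> {}"
  using csubspaceD(1)[OF Ideal_csubspace[of X m]] by blast

lemma Em_nonempty: "(Em m :: (real^'n \<Rightarrow> complex) set) \<noteq> {}"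
  using csubspaceD(1)[OF Em_csubspace[of m]] by blast

lemma section_projection_continuous:
  assumes T: "T \<in> jet_sections X m"
  shows "continuous_map (Em_top m) (Ideal_top X m) (\<lambda>f. f - T (Jm X m f))"
proof -
  let ?h = "\<lambda>f. T (Jm X m f)"
  note TF = section_facts[OF X T]
  have cont: "continuous_map (Em_top m) (Em_top m) ?h" by (rule section_Jm_continuous[OF X T])
  have "continuous_map (Em_top m) (Em_top m) (\<lambda>f. f - ?h f)"
  proof (subst (2) Em_top_def, rule continuous_map_seminorm_topologyI[OF Em_seminorm_space], unfold
      topspace_Em_top)
    show "f - ?h f \<in> Em m" if "f \<in> Em m" for f using that TF(5) by (intro Em_diff)
    fix p and f :: "real^'n \<Rightarrow> complex" and e :: real
    assume "p \<in> {snorm K k |K k. compact (K :: (real^'n) set) \<and>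
        k \<le> m}" and f: "f \<in> Em m" and e: "e > 0"
    then obtain K k where K: "p = snorm K k" "compact K" "k \<le> m" by blast
    let ?B = "\<lambda>f. {g\<in>Em m. snorm K k (g - f) < e / 2}"
    have op: "openin (Em_top m) (?B f)" if "f \<in> Em m" for f
      unfolding Em_top_def using that e K by (intro openin_seminorm_ball) auto
    have "openin (Em_top m) {g \<in> topspace (Em_top m). ?h g \<in> ?B (?h f)}"
      using cont op[OF TF(5)[OF f]] by (rule openin_continuous_map_preimage)
    then have "openin (Em_top m) (?B f \<inter> {g \<in> Em m. ?h g \<in> ?B (?h f)})"
      using op[OF f] by (intro openin_Int) simp_all
    moreover have "f \<in> ?B f \<inter> {g \<in> Em m. ?h g \<in> ?B (?h f)}"
      using f e TF(5)[OF f] by simp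
    moreover have "p ((g - ?h g) - (f - ?h f)) < e" if g: "g \<in> ?B f \<inter> {g \<in> Em m. ?h g \<in> ?B (?h f)}"
        for g
    proof -
      have gE: "g \<in> Em m" using g by simp
      have eq: "(g - ?h g) - (f - ?h f) = (g - f) - (?h g - ?h f)" by simp
      have "snorm K k ((g - f) - (?h g - ?h f)) \<le> snorm K k (g - f) + snorm K k (?h g - ?h f)"
        using gE f TF(5) K by (intro snorm_triangle(2)[where m = m] Em_diff) auto
      also have "\<dots> < e" using g by simp
      finally show ?thesis by (simp only: eq K(1))
    qed
    ultimately show "\<exists>U. openin (Em_top m) U \<and> f \<in> U \<and> (\<forall>g\<in>U. p ((g - ?h g) - (f - ?h f)) < e)"
      by blast
  qed
  then show ?thesis
    unfolding Ideal_top_def using TF(6) by (intro continuous_map_into_subtopology) auto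
qed

lemma transposed_section_apply:
  "\<psi> \<in> Ideal_dual X m \<Longrightarrow> transposed_section X m T \<psi> = (\<lambda>f. if f \<in> Em m then \<psi> (f - T (Jm X m f)) else
      0)"
  by (simp add: transposed_section_def)

lemma transposed_section_dual:
  assumes T: "T \<in> jet_sections X m" and \<psi>: "\<psi> \<in> Ideal_dual X m"
  shows "transposed_section X m T \<psi> \<in> dual (Em m) (Em_top m)"
proof -
  note TF = section_facts[OF X T]
  let ?\<pi> = "\<lambda>f. f - T (Jm X m f)"
  have J: "Jm X m f \<in> Whitney X m" if "f \<in> Em m" for f
    using that Jm_Whitney X by (auto simp: Em_def)
  have lin\<psi>: "lin_on (Ideal X m) \<psi>" and cont\<psi>: "continuous_map (Ideal_top X m) euclidean \<psi>"
    using \<psi> by (auto simp: dual_def)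
  have "lin_on (Em m) (transposed_section X m T \<psi>)"
    unfolding lin_on_def transposed_section_apply[OF \<psi>]
  proof (intro conjI ballI allI)
    fix f g :: "real^'n \<Rightarrow> complex" assume fg: "f \<in> Em m" "g \<in> Em m"
    have fg': "f + g \<in> Em m" using fg by (rule csubspaceD(2)[OF Em_csubspace])
    have "?\<pi> (f + g) = ?\<pi> f + ?\<pi> g"
      unfolding lin_on_add[OF lin_Jm fg] lin_on_add[OF TF(3) J[OF fg(1)] J[OF fg(2)]] by simp
    then show "(if f + g \<in> Em m then \<psi> (?\<pi> (f + g)) else 0)
       = (if f \<in> Em m then \<psi> (?\<pi> f) else 0) + (if g \<in> Em m then \<psi> (?\<pi> g) else 0)"
      using fg fg' lin_on_add[OF lin\<psi> TF(6)[OF fg(1)] TF(6)[OF fg(2)]] by (simp only: if_True)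
  next
    fix f :: "real^'n \<Rightarrow> complex" and c assume f: "f \<in> Em m"
    have f': "cscale c f \<in> Em m" using f by (rule csubspaceD(3)[OF Em_csubspace])
    have "?\<pi> (cscale c f) = cscale c (?\<pi> f)"
      unfolding lin_on_cscale[OF lin_Jm f] lin_on_cscale[OF TF(3) J[OF f]]
      by (simp add: fun_eq_iff right_diff_distrib)
    then show "(if cscale c f \<in> Em m then \<psi> (?\<pi> (cscale c f)) else 0)
       = cscale c (if f \<in> Em m then \<psi> (?\<pi> f) else 0)"
      using f f' lin_on_cscale[OF lin\<psi> TF(6)[OF f], of c] by (simp only: if_True)
  qed
  moreover have "continuous_map (Em_top m) euclidean (transposed_section X m T \<psi>)"
    using continuous_map_compose[OF section_projection_continuous[OF T] cont\<psi>]
    by (rule continuous_map_eq) (simp add: transposed_section_apply[OF \<psi>])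
  ultimately show ?thesis by (simp add: dual_def transposed_section_apply[OF \<psi>])
qed

lemma transposed_section_dual_sections:
  assumes T: "T \<in> jet_sections X m"
  shows "transposed_section X m T \<in> dual_sections X m"
proof -
  let ?R = "transposed_section X m T"
  note TF = section_facts[OF X T]
  note app = transposed_section_apply[of _ T]
  have lin: "lin_on (Ideal_dual X m) ?R"
    unfolding lin_on_def
  proof (intro conjI ballI allI)
    fix \<phi> \<psi> assume "\<phi> \<in> Ideal_dual X m" "\<psi> \<in> Ideal_dual X m"
    then show "?R (\<phi> + \<psi>) = ?R \<phi> + ?R \<psi>"
      by (simp only: app csubspaceD(2)[OF dual_csubspace]) (simp add: fun_eq_iff)
  next
    fix \<phi> c assume "\<phi> \<in> Ideal_dual X m"
    then show "?R (cscale c \<phi>) = cscale c (?R \<phi>)"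
      by (simp only: app csubspaceD(3)[OF dual_csubspace]) (simp add: fun_eq_iff)
  qed
  have "continuous_map (weak_star (Ideal X m) (Ideal_top X m)) (weak_star (Em m) (Em_top m)) ?R"
  proof (subst (2) weak_star_def, rule continuous_map_seminorm_topologyI[OF
      weak_star_seminorm_space[OF Em_nonempty]],
      unfold topspace_weak_star[OF Ideal_nonempty])
    show "?R \<psi> \<in> dual (Em m) (Em_top m)" if "\<psi> \<in> Ideal_dual X m" for \<psi>
      using T that by (rule transposed_section_dual)
    fix p :: "((real^'n \<Rightarrow> complex) \<Rightarrow> complex) \<Rightarrow> real" and \<psi> and e :: real
    assume "p \<in> (\<lambda>f \<psi>. norm (\<psi> f)) ` Em m" and \<psi>: "\<psi> \<in> Ideal_dual X m" and e: "e > 0"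
    then obtain f where f: "f \<in> Em m" "p = (\<lambda>\<psi>. norm (\<psi> f))" by blast
    let ?g = "f - T (Jm X m f)"
    \<comment> \<open>The seminorm of the image at \<open>f\<close> equals the seminorm of the
      argument at \<open>?g\<close>.\<close>
    let ?U = "{\<psi>'\<in>Ideal_dual X m. norm ((\<psi>' - \<psi>) ?g) < e}"
    have "openin (weak_star (Ideal X m) (Ideal_top X m)) ?U"
      unfolding weak_star_def
      using \<psi> e TF(6)[OF f(1)] by (intro openin_seminorm_ball[of \<psi> _ "\<lambda>\<psi>. norm (\<psi> ?g)"]) auto
    moreover have "p (?R \<psi>' - ?R \<psi>) < e" if "\<psi>' \<in> ?U" for \<psi>'
      using that \<psi> f by (simp add: app)
    moreover have "\<psi> \<in> ?U" using \<psi> e by simp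
    ultimately show "\<exists>U. openin (weak_star (Ideal X m) (Ideal_top X m)) U \<and> \<psi> \<in> U \<and>
        (\<forall>\<psi>'\<in>U. p (?R \<psi>' - ?R \<psi>) < e)"
      by blast
  qed
  moreover have "incl_transp (Ideal X m) (?R \<psi>) = \<psi>" if \<psi>: "\<psi> \<in> Ideal_dual X m" for \<psi>
  proof
    fix g
    show "incl_transp (Ideal X m) (?R \<psi>) g = \<psi> g"
    proof (cases "g \<in> Ideal X m")
      case True
      then have "Jm X m g = 0" "g \<in> Em m" by (auto simp: Ideal_iff)
      moreover have "T 0 = 0" by (rule lin_on_0[OF TF(3) Whitney_csubspace])
      ultimately show ?thesis using True \<psi> by (simp add: incl_transp_def app)
    next
      case False
      then show ?thesis using \<psi> by (simp add: incl_transp_def dual_def)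
    qed
  qed
  ultimately show ?thesis
    using lin transposed_section_dual[OF T] by (auto simp: dual_sections_def transposed_section_def)
qed

text \<open>Test both transposes on \<open>T1 F\<close>, whose jet is \<open>F\<close>: the first
  gives 0 and the second \<open>\<psi> (T1 F - T2 F)\<close>, and functionals separate the points of
  the ideal.\<close>

lemma transposed_section_inj: "inj_on (transposed_section X m) (jet_sections X m)"
proof (rule inj_onI)
  fix T1 T2 assume T: "T1 \<in> jet_sections X m" "T2 \<in> jet_sections X m"
    and eq: "transposed_section X m T1 = transposed_section X m T2"
  show "T1 = T2"
  proof (rule extensionalityI)
    show "T1 \<in> extensional (Whitney X m)" "T2 \<in> extensional (Whitney X m)"
      using T by (auto simp: jet_sections_def)
    fix F assume F: "F \<in> Whitney X m"
    note F1 = section_facts[OF X T(1)] and F2 = section_facts[OF X T(2)]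
    have J: "Jm X m (T1 F) = F" and E: "T1 F \<in> Em m" using F1(1,2)[OF F] by simp_all
    have I: "T1 F - T2 F \<in> Ideal X m" using F2(6)[OF E] by (simp only: J)
    have "\<psi> (T1 F - T2 F) = 0" if \<psi>: "\<psi> \<in> Ideal_dual X m" for \<psi>
    proof -
      have "transposed_section X m T1 \<psi> (T1 F) = transposed_section X m T2 \<psi> (T1 F)"
          by (simp only: eq)
      then have "\<psi> (T1 F - T1 F) = \<psi> (T1 F - T2 F)"
        using E by (simp only: transposed_section_apply[OF \<psi>] if_True J)
      moreover have "T1 F - T1 F = 0" by simp
      moreover have "\<psi> 0 = 0" using \<psi> lin_on_0[OF _ Ideal_csubspace[of X m], of \<psi>]
          by (simp add: dual_def)
      ultimately show ?thesis by simp
    qed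
    then have "T1 F - T2 F = 0" by (rule Ideal_separated[OF I])
    then show "T1 F = T2 F" by simp
  qed
qed

lemma dual_section_is_transposed:
  assumes R: "R \<in> dual_sections X m"
  shows "\<exists>T\<in>jet_sections X m. transposed_section X m T = R"
proof -
  have R_ext: "R \<in> extensional (Ideal_dual X m)"
    and R_dual: "\<And>\<psi>. \<psi> \<in> Ideal_dual X m \<Longrightarrow> R \<psi> \<in> dual (Em m) (Em_top m)"
    and R_lin: "lin_on (Ideal_dual X m) R"
    and R_cont: "continuous_map (weak_star (Ideal X m) (Ideal_top X m)) (weak_star (Em m) (Em_top
        m)) R"
    and R_sec: "\<And>\<psi>. \<psi> \<in> Ideal_dual X m \<Longrightarrow> incl_transp (Ideal X m) (R \<psi>) = \<psi>"
    using R by (auto simp: dual_sections_def)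
  have R_Ideal: "R \<psi> g = \<psi> g" if "\<psi> \<in> Ideal_dual X m" "g \<in> Ideal X m" for \<psi> g
    using fun_cong[OF R_sec[OF that(1)], of g] that(2) by (simp add: incl_transp_def)
  have R_lin_Em: "lin_on (Em m) (R \<psi>)" if "\<psi> \<in> Ideal_dual X m" for \<psi>
    using R_dual[OF that] by (simp add: dual_def)
  have R0: "R 0 = 0" by (rule lin_on_0[OF R_lin dual_csubspace])
  \<comment> \<open>The element \<open>g\<close> found here will be the ideal component of
    \<open>f\<close>.\<close>
  have eval: "\<exists>g\<in>Ideal X m. \<forall>\<psi>\<in>Ideal_dual X m. R \<psi> f = \<psi> g" if f: "f \<in> Em m" for f
  proof (rule weak_star_continuous_functional[OF Ideal_csubspace])
    show "lin_on (Ideal_dual X m) (\<lambda>\<psi>. R \<psi> f)"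
      using R_lin by (simp add: lin_on_def)
    fix e :: real assume e: "e > 0"
    let ?V = "{\<phi>\<in>dual (Em m) (Em_top m). norm ((\<phi> - 0) f) < e}"
    have "openin (weak_star (Em m) (Em_top m)) ?V"
      unfolding weak_star_def
      using f e csubspaceD(1)[OF dual_csubspace] by (intro openin_seminorm_ball[of 0 _ "\<lambda>\<psi>. norm (\<psi>
          f)"]) auto
    from openin_continuous_map_preimage[OF R_cont this]
    have "openin (weak_star (Ideal X m) (Ideal_top X m)) {\<psi> \<in> Ideal_dual X m. R \<psi> \<in> ?V}"
      by (simp only: topspace_weak_star[OF Ideal_nonempty])
    moreover have "0 \<in> {\<psi> \<in> Ideal_dual X m. R \<psi> \<in> ?V}"
      using e by (simp add: R0 csubspaceD(1)[OF dual_csubspace])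
    ultimately show "\<exists>U. openin (weak_star (Ideal X m) (Ideal_top X m)) U \<and> 0 \<in> U \<and>
        (\<forall>\<psi>\<in>U. norm (R \<psi> f) < e)"
      by (intro exI[of _ "{\<psi> \<in> Ideal_dual X m. R \<psi> \<in> ?V}"]) auto
  qed
  define D where "D = {f \<in> Em m. \<forall>\<psi>\<in>Ideal_dual X m. R \<psi> f = 0}"
  have "D = (\<Inter>\<psi>\<in>Ideal_dual X m. {f \<in> topspace (Em_top m). R \<psi> f = 0})"
    using csubspaceD(1)[OF dual_csubspace] by (auto simp: D_def)
  moreover have "closedin (Em_top m) \<dots>"
  proof (rule closedin_INT)
    show "Ideal_dual X m \<noteq> {}" using csubspaceD(1)[OF dual_csubspace] by blast
    fix \<psi> assume "\<psi> \<in> Ideal_dual X m"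
    then have "continuous_map (Em_top m) euclidean (R \<psi>)" using R_dual by (simp add: dual_def)
    then show "closedin (Em_top m) {f \<in> topspace (Em_top m). R \<psi> f = 0}"
      by (intro closedin_continuous_maps_eq[of euclidean]) auto
  qed
  ultimately have D_closed: "closedin (Em_top m) D" by simp
  \<comment> \<open>On the ideal \<open>R \<psi>\<close> agrees with \<open>\<psi>\<close>, so an
    element of both is killed by all functionals.\<close>
  have D0: "f = 0" if "f \<in> Ideal X m" "f \<in> D" for f
    using that R_Ideal by (intro Ideal_separated[OF that(1)]) (auto simp: D_def)
  have D_zero: "0 \<in> D"
    using lin_on_0[OF R_lin_Em Em_csubspace] csubspaceD(1)[OF Em_csubspace[of m]]
        by (simp add: D_def)
  have dec: "\<exists>g\<in>Ideal X m. \<exists>h\<in>D. f = g + h" if f: "f \<in> Em m" for f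
  proof -
    obtain g where g: "g \<in> Ideal X m" "\<And>\<psi>. \<psi> \<in> Ideal_dual X m \<Longrightarrow>
        R \<psi> f = \<psi> g" using eval[OF f] by blast
    have gE: "g \<in> Em m" using g(1) Ideal_subset by blast
    have "R \<psi> (f - g) = 0" if "\<psi> \<in> Ideal_dual X m" for \<psi>
      using lin_on_diff[OF R_lin_Em[OF that] Em_csubspace f gE] g(2)[OF that] R_Ideal[OF that g(1)]
          by simp
    then have "f - g \<in> D" using Em_diff[OF f gE] by (simp add: D_def)
    then show ?thesis using g(1) by (intro bexI[of _ g] bexI[of _ "f - g"]) auto
  qed
  have "D \<in> complements X m"
    unfolding complements_def
  proof (intro CollectI conjI ballI allI)
    show "D \<subseteq> Em m" by (auto simp: D_def)
    show "f + g \<in> D" if "f \<in> D" "g \<in> D" for f g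
      using that lin_on_add[OF R_lin_Em] by (simp add: D_def csubspaceD(2)[OF Em_csubspace])
    show "cscale c f \<in> D" if "f \<in> D" for c f
      using that lin_on_cscale[OF R_lin_Em] by (simp add: D_def csubspaceD(3)[OF Em_csubspace])
    show "Ideal X m \<inter> D = {0}" using D0 D_zero csubspaceD(1)[OF Ideal_csubspace[of X m]] by auto
  qed (use D_closed D_zero dec in auto)
  \<comment> \<open>Continuity of the section comes from the closed graph argument behind
    \<open>complement_is_section_range\<close>.\<close>
  then obtain T where T: "T \<in> jet_sections X m" "T ` Whitney X m = D"
    using complement_is_section_range[OF X] by blast
  note TF = section_facts[OF X T(1)]
  have "transposed_section X m T = R"
  proof (rule extensionalityI[OF _ R_ext])
    show "transposed_section X m T \<in> extensional (Ideal_dual X m)"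
        by (simp add: transposed_section_def)
    fix \<psi> assume \<psi>: "\<psi> \<in> Ideal_dual X m"
    show "transposed_section X m T \<psi> = R \<psi>"
    proof
      fix f
      show "transposed_section X m T \<psi> f = R \<psi> f"
      proof (cases "f \<in> Em m")
        case True
        have "Jm X m f \<in> Whitney X m" using True Jm_Whitney X by (auto simp: Em_def)
        then have "T (Jm X m f) \<in> D" using T(2) by blast
        \<comment> \<open>\<open>R \<psi>\<close> is determined on \<open>Em m\<close>: it vanishes
          on \<open>D\<close> and agrees with \<open>\<psi>\<close> on the ideal.\<close>
        then have "R \<psi> (T (Jm X m f)) = 0" using \<psi> by (simp add: D_def)
        moreover have "R \<psi> (f - T (Jm X m f)) = R \<psi> f - R \<psi> (T (Jm X m f))"
          using True by (intro lin_on_diff[OF R_lin_Em[OF \<psi>] Em_csubspace] TF(5))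
        moreover have "R \<psi> (f - T (Jm X m f)) = \<psi> (f - T (Jm X m f))"
          using True by (intro R_Ideal[OF \<psi>] TF(6))
        ultimately show ?thesis using True by (simp add: transposed_section_apply[OF \<psi>])
      next
        case False
        then show ?thesis using R_dual[OF \<psi>] by (simp add: transposed_section_apply[OF \<psi>] dual_def)
      qed
    qed
  qed
  then show ?thesis using T(1) by blast
qed

lemma jet_sections_dual_sections:
  "bij_betw (transposed_section X m) (jet_sections X m) (dual_sections X m)"
  unfolding bij_betw_def
  using transposed_section_inj transposed_section_dual_sections dual_section_is_transposed by blast

end

theorem theorem5p11:
  fixes X :: "(real^'n::finite) set" and m :: nat
  assumes "compact X" and "m > 0"
  shows "(\<exists>\<Phi>. bij_betw \<Phi> (complements X m) (jet_sections X m)) \<and>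
         (\<exists>\<Psi>. bij_betw \<Psi> (jet_sections X m) (dual_sections X m)) \<and>
         complements X m \<noteq> {}"
proof (intro conjI)
  note bij = jet_sections_complements[OF assms(1), of m]
  show "\<exists>\<Phi>. bij_betw \<Phi> (complements X m) (jet_sections X m)"
    \<comment> \<open>\<open>jet_sections_complements\<close> runs from sections to their ranges;
      here its inverse is wanted.\<close>
    using bij_betw_inv_into[OF bij] by blast
  show "\<exists>\<Psi>. bij_betw \<Psi> (jet_sections X m) (dual_sections X m)"
    using jet_sections_dual_sections[OF assms(1)] by blast
  show "complements X m \<noteq> {}"
    using bij jet_sections_nonempty[OF assms(1), of m] by (auto simp: bij_betw_def)
qed

end
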